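(* Let $G$ be a 3-connected graph and $X\subseteq E(G)$. Then $(G,X)$ is constraint connected if and only if $(G,X)$ has no constraint minor isomorphic to one of the following six constraint graphs: the constraint $K_4$, the constraint wheel, or one of the four constraint prisms.
   Context: All graphs are simple. A constraint graph is a pair $(G,X)$ with $G$ a graph and $X\subseteq E(G)$; it is constraint connected if $X$ is a connected edge set of $G$, i.e. the subgraph $G[X]$ formed by the edges of $X$ and their endvertices is connected (the empty set counts as connected). A constraint minor of $(G,X)$ is a constraint graph obtained by repeatedly contracting arbitrary edges and deleting edges not in $X$, where after a contraction loops are removed and each parallel class is reduced to a single edge, deleting edges not in $X$ first (so an edge of $X$ is kept whenever the class contains one); the distinguished set of the result is $X$ intersected with the remaining edges. Isomorphism of constraint graphs means a graph isomorphism mapping distinguished sets onto each other. The six obstructions: (1) Constraint $K_4$: $K_4$ with $X$ a perfect matching (two vertex-disjoint edges). (2) Constraint wheel: a 4-cycle $abcd$ plus a hub $h$ adjacent to $a,b,c,d$, with $X=\{ab,cd\}$. (3) The four constraint prisms: the prism consists of triangles $a_1b_1c_1$, $a_2b_2c_2$ and edges $a_1a_2,b_1b_2,c_1c_2$; $X$ is one of (i) all six triangle edges; (ii) $\{a_1b_1,b_1c_1,a_1c_1,a_2b_2,a_2c_2\}$; (iii) $\{a_1b_1,a_1c_1,a_2b_2,a_2c_2\}$; (iv) $\{a_1b_1,a_1c_1,a_2b_2,b_2c_2\}$. *)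

theory Defs
  imports Main
begin

type_synonym 'a graph = "'a set \<times> 'a set set"

abbreviation verts :: "'a graph \<Rightarrow> 'a set" where "verts \<equiv> fst"
abbreviation edges :: "'a graph \<Rightarrow> 'a set set" where "edges \<equiv> snd"

text \<open>Graphs are finite: a minor arises by finitely many steps.\<close>

definition simple_graph :: "'a graph \<Rightarrow> bool" where
  "simple_graph G \<longleftrightarrow> finite (verts G) \<and> (\<forall>e \<in> edges G. e \<subseteq> verts G \<and> card e = 2)"

definition connected_graph :: "'a graph \<Rightarrow> bool" where
  "connected_graph G \<longleftrightarrow> verts G \<noteq> {} \<and>
     (\<forall>u \<in> verts G. \<forall>v \<in> verts G. (u, v) \<in> {(x, y). {x, y} \<in> edges G}\<^sup>*)"

definition delete_verts :: "'a graph \<Rightarrow> 'a set \<Rightarrow> 'a graph" where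
  "delete_verts G S = (verts G - S, {e \<in> edges G. e \<inter> S = {}})"

definition k_connected :: "nat \<Rightarrow> 'a graph \<Rightarrow> bool" where
  "k_connected k G \<longleftrightarrow> card (verts G) > k \<and>
     (\<forall>S \<subseteq> verts G. card S < k \<longrightarrow> connected_graph (delete_verts G S))"

type_synonym 'a cgraph = "'a graph \<times> 'a set set"

definition edge_subgraph :: "'a set set \<Rightarrow> 'a graph" where
  "edge_subgraph X = (\<Union>X, X)"

definition connected_edge_set :: "'a set set \<Rightarrow> bool" where
  "connected_edge_set X \<longleftrightarrow> X = {} \<or> connected_graph (edge_subgraph X)"

definition constraint_connected :: "'a cgraph \<Rightarrow> bool" where
  "constraint_connected = (\<lambda>(G, X). connected_edge_set X)"

text \<open>Contracting \<open>{u, v}\<close> merges \<open>v\<close> into \<open>u\<close>.  Edges are sets, so taking images identifies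
  parallel edges; the edges that become loops are exactly those whose image is not a
  two-element set.  The edge left over from a parallel class is distinguished iff the class
  contained a distinguished edge.\<close>

definition merge :: "'a \<Rightarrow> 'a \<Rightarrow> 'a \<Rightarrow> 'a" where
  "merge u v w = (if w = v then u else w)"

definition contract_edges :: "'a \<Rightarrow> 'a \<Rightarrow> 'a set set \<Rightarrow> 'a set set" where
  "contract_edges u v F = {e \<in> (`) (merge u v) ` F. card e = 2}"

definition contract :: "'a \<Rightarrow> 'a \<Rightarrow> 'a cgraph \<Rightarrow> 'a cgraph" where
  "contract u v = (\<lambda>(G, X).
     ((merge u v ` verts G, contract_edges u v (edges G)), contract_edges u v X))"

definition delete_edge :: "'a set \<Rightarrow> 'a cgraph \<Rightarrow> 'a cgraph" where
  "delete_edge e = (\<lambda>(G, X). ((verts G, edges G - {e}), X))"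

inductive minor_step :: "'a cgraph \<Rightarrow> 'a cgraph \<Rightarrow> bool" where
  contract: "{u, v} \<in> edges G \<Longrightarrow> minor_step (G, X) (contract u v (G, X))"
| delete: "e \<in> edges G - X \<Longrightarrow> minor_step (G, X) (delete_edge e (G, X))"

definition constraint_minor :: "'a cgraph \<Rightarrow> 'a cgraph \<Rightarrow> bool" where
  "constraint_minor H C \<longleftrightarrow> minor_step\<^sup>*\<^sup>* C H"

definition cgraph_iso :: "'a cgraph \<Rightarrow> 'b cgraph \<Rightarrow> bool" where
  "cgraph_iso = (\<lambda>(G, X) (H, Y). \<exists>f. bij_betw f (verts G) (verts H) \<and>
     (`) f ` edges G = edges H \<and> (`) f ` X = Y)"

definition constraint_K4 :: "nat cgraph" where
  "constraint_K4 =
     (({0,1,2,3}, {{0,1}, {0,2}, {0,3}, {1,2}, {1,3}, {2,3}}), {{0,1}, {2,3}})"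

text \<open>The rim \<open>a b c d\<close> is \<open>0 1 2 3\<close> and the hub \<open>h\<close> is \<open>4\<close>.\<close>

definition constraint_wheel :: "nat cgraph" where
  "constraint_wheel =
     (({0,1,2,3,4}, {{0,1}, {1,2}, {2,3}, {3,0}, {4,0}, {4,1}, {4,2}, {4,3}}),
      {{0,1}, {2,3}})"

text \<open>The triangles \<open>a\<^sub>1 b\<^sub>1 c\<^sub>1\<close> and \<open>a\<^sub>2 b\<^sub>2 c\<^sub>2\<close> are \<open>0 1 2\<close> and \<open>3 4 5\<close>.\<close>

definition prism :: "nat graph" where
  "prism = ({0,1,2,3,4,5},
     {{0,1}, {1,2}, {0,2}, {3,4}, {4,5}, {3,5}, {0,3}, {1,4}, {2,5}})"

definition constraint_prisms :: "nat cgraph set" where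
  "constraint_prisms =
    {(prism, {{0,1}, {1,2}, {0,2}, {3,4}, {4,5}, {3,5}}),
     (prism, {{0,1}, {1,2}, {0,2}, {3,4}, {3,5}}),
     (prism, {{0,1}, {0,2}, {3,4}, {3,5}}),
     (prism, {{0,1}, {0,2}, {3,4}, {4,5}})}"

definition obstructions :: "nat cgraph set" where
  "obstructions = {constraint_K4, constraint_wheel} \<union> constraint_prisms"

end

theory Submission imports Defs begin

text \<open>Contractions and deletions outside \<open>X\<close> preserve connectedness of \<open>X\<close>, and no obstruction has a
  connected distinguished set.  For the converse, contract edges as long as the graph stays
  3-connected and \<open>X\<close> stays disconnected.  If this gets stuck above four vertices, every edge \<open>uv\<close>
  whose contraction keeps \<open>X\<close> disconnected lies in a 3-separator \<open>{u, v, z}\<close>; choose it with a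
  smallest side \<open>C\<close>.  Every edge from \<open>z\<close> to \<open>w \<in> C\<close> then connects \<open>X\<close> when contracted, as it would
  otherwise yield a smaller side.  Hence \<open>X\<close> has exactly two components, and \<open>zw\<close> either joins them
  or is one of them.  If \<open>C\<close> has several vertices, it consists of the two ends of a component of \<open>X\<close>
  and the constraint \<open>K\<^sub>4\<close> appears; if \<open>C = {w}\<close>, then \<open>uvw\<close> is a triangle with \<open>w\<close> of degree
  three, and two disjoint paths from \<open>z\<close> to \<open>u\<close> and \<open>v\<close> through the other side expose a \<open>K\<^sub>4\<close>,
  a wheel or a prism.\<close>

section \<open>Connected vertex sets and minors given by labellings\<close>

text \<open>Minor steps delete neither vertices nor edges of \<open>X\<close>. An obstruction is
  therefore exhibited by partitioning all of \<open>V\<close> into connected bags and accounting for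
  every edge of \<open>X\<close> between bags. Hence the disjoint paths are thickened to a partition
  of a whole side of the separator into two connected sets, and each construction must first locate
  the components of \<open>X\<close>. Minimality of \<open>C\<close> is exploited by uncrossing.
  Where two 3-separators cross, the intersection of one side of each has its neighbours in certain
  parts of both separators. If at most two vertices qualify, 3-connectivity makes the intersection
  empty; if three qualify, two of them the ends of an edge whose contraction keeps \<open>X\<close>
  disconnected, the intersection competes with \<open>C\<close> and contradicts its choice. Four
  vertices are a base case of their own, since a contraction would leave too few vertices for
  3-connectivity. From five vertices on an edge to start from exists: if none did, \<open>X\<close>
  would consist of two single edges, and a fifth vertex would supply one.\<close>

definition conn :: "'a set set \<Rightarrow> 'a set \<Rightarrow> bool" where
  "conn F S \<longleftrightarrow> (\<forall>P. P \<subseteq> S \<longrightarrow> P \<noteq> {} \<longrightarrow> P \<noteq> S \<longrightarrow> (\<exists>a\<in>P. \<exists>b\<in>S - P. {a, b} \<in> F))"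

definition adj :: "'a set set \<Rightarrow> 'a set \<Rightarrow> 'a set \<Rightarrow> bool" where
  "adj F A B \<longleftrightarrow> (\<exists>a\<in>A. \<exists>b\<in>B. {a, b} \<in> F)"

lemma adj_commute: "adj F A B \<longleftrightarrow> adj F B A"
proof -
  have "adj F D C" if "adj F C D" for C D
  proof -
    from that obtain a b where "a \<in> C" "b \<in> D" "{a, b} \<in> F" by (auto simp: adj_def)
    moreover have "{b, a} = {a, b}" by blast
    ultimately show ?thesis unfolding adj_def by metis
  qed
  then show ?thesis by blast
qed

lemma adjI: "{a, b} \<in> F \<Longrightarrow> a \<in> A \<Longrightarrow> b \<in> B \<Longrightarrow> adj F A B"
  by (auto simp: adj_def)

lemma adj_Un_left: "adj F (A \<union> B) C \<longleftrightarrow> adj F A C \<or> adj F B C"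
  and adj_Un_right: "adj F C (A \<union> B) \<longleftrightarrow> adj F C A \<or> adj F C B"
  by (auto simp: adj_def)

text \<open>Replaces induction along a path: later arguments take \<open>\<phi>\<close> to be
  membership in a part and inspect the edge on which it changes.\<close>

lemma conn_cut:
  assumes "conn F S" "x \<in> S" "\<phi> x" "y \<in> S" "\<not> \<phi> y"
  obtains a b where "a \<in> S" "\<phi> a" "b \<in> S" "\<not> \<phi> b" "{a, b} \<in> F"
proof -
  let ?P = "{x \<in> S. \<phi> x}"
  have "?P \<subseteq> S" "?P \<noteq> {}" "?P \<noteq> S" using assms by auto
  then have "\<exists>a\<in>?P. \<exists>b\<in>S - ?P. {a, b} \<in> F"
    using assms(1)[unfolded conn_def, rule_format, of ?P] by blast
  then show thesis using that by blast
qed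

lemma connI:
  assumes "\<And>P Q. P \<union> Q = S \<Longrightarrow> P \<inter> Q = {} \<Longrightarrow> P \<noteq> {} \<Longrightarrow> Q \<noteq> {} \<Longrightarrow> adj F P Q"
  shows "conn F S"
  unfolding conn_def
proof (intro allI impI)
  fix P assume "P \<subseteq> S" "P \<noteq> {}" "P \<noteq> S"
  then have "adj F P (S - P)" by (intro assms) auto
  then show "\<exists>a\<in>P. \<exists>b\<in>S - P. {a, b} \<in> F" by (simp add: adj_def)
qed

lemma connI_pointed:
  assumes "x \<in> S"
    and "\<And>P Q. P \<union> Q = S \<Longrightarrow> P \<inter> Q = {} \<Longrightarrow> x \<in> P \<Longrightarrow> Q \<noteq> {} \<Longrightarrow> adj F P Q"
  shows "conn F S"
proof (rule connI)
  fix P Q assume PQ: "P \<union> Q = S" "P \<inter> Q = {}" "P \<noteq> {}" "Q \<noteq> {}"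
  have "x \<in> P \<or> x \<in> Q" using assms(1) unfolding PQ(1)[symmetric] by simp
  then show "adj F P Q"
  proof
    assume "x \<in> P" then show ?thesis using assms(2)[OF PQ(1,2)] PQ(4) by simp
  next
    assume "x \<in> Q"
    moreover have "Q \<union> P = S" "Q \<inter> P = {}" using PQ(1,2) by (simp_all add: Un_commute Int_commute)
    ultimately show ?thesis using assms(2)[of Q P] PQ(3) adj_commute[of F P Q] by simp
  qed
qed

lemma conn_singleton: "conn F {x}"
  unfolding conn_def by (auto dest: subset_singletonD)

text \<open>Bridge to the reachability of the definitions. \<open>S\<close> has to be closed under
  \<open>F\<close>, because a path may leave \<open>S\<close> while \<open>conn\<close> sees only
  edges inside it.\<close>

lemma conn_iff_reachable:
  assumes "\<And>x y. {x, y} \<in> F \<Longrightarrow> x \<in> S \<Longrightarrow> y \<in> S"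
  shows "conn F S \<longleftrightarrow> (\<forall>u\<in>S. \<forall>v\<in>S. (u, v) \<in> {(x, y). {x, y} \<in> F}\<^sup>*)"
    (is "_ \<longleftrightarrow> (\<forall>u\<in>S. \<forall>v\<in>S. (u, v) \<in> ?R\<^sup>*)")
proof (intro iffI ballI)
  fix u v assume c: "conn F S" and uv: "u \<in> S" "v \<in> S"
  show "(u, v) \<in> ?R\<^sup>*"
  proof (rule ccontr)
    assume "(u, v) \<notin> ?R\<^sup>*"
    then obtain a b where "(u, a) \<in> ?R\<^sup>*" "(u, b) \<notin> ?R\<^sup>*" "{a, b} \<in> F"
      using conn_cut[OF c, of u "\<lambda>w. (u, w) \<in> ?R\<^sup>*" v] uv by blast
    then show False by (auto intro: rtrancl_into_rtrancl)
  qed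
next
  assume r: "\<forall>u\<in>S. \<forall>v\<in>S. (u, v) \<in> ?R\<^sup>*"
  show "conn F S"
  proof (rule connI, rule ccontr)
    fix P Q assume PQ: "P \<union> Q = S" "P \<inter> Q = {}" "P \<noteq> {}" "Q \<noteq> {}" and n: "\<not> adj F P Q"
    from PQ obtain x y where x: "x \<in> P" and y: "y \<in> Q" by blast
    then have "(x, y) \<in> ?R\<^sup>*" using r PQ by blast
    then have "y \<in> P"
    proof (induct rule: rtrancl_induct)
      case (step a b)
      then have "b \<in> S" using assms PQ by blast
      then show ?case using step n PQ by (auto simp: adj_def)
    qed (rule x)
    then show False using y PQ by blast
  qed
qed

lemma conn_image:
  assumes "conn F S"
    and "\<And>a b. a \<in> S \<Longrightarrow> b \<in> S \<Longrightarrow> {a, b} \<in> F \<Longrightarrow> g a \<noteq> g b \<Longrightarrow> {g a, g b} \<in> F'"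
  shows "conn F' (g ` S)"
proof (rule connI)
  fix P Q assume PQ: "P \<union> Q = g ` S" "P \<inter> Q = {}" "P \<noteq> {}" "Q \<noteq> {}"
  then obtain x y where "x \<in> S" "g x \<in> P" "y \<in> S" "g y \<in> Q" by (metis UnI1 UnI2 all_not_in_conv imageE)
  then obtain a b where ab: "a \<in> S" "g a \<in> P" "b \<in> S" "g b \<notin> P" "{a, b} \<in> F"
    using conn_cut[OF assms(1), of x "\<lambda>x. g x \<in> P" y] PQ(2) by blast
  then have "{g a, g b} \<in> F'" using assms(2) by metis
  moreover have "g b \<in> Q" using ab PQ(1) by blast
  ultimately show "adj F' P Q" using ab(2) by (auto simp: adj_def)
qed

lemma conn_Un:
  assumes "conn F A" "conn F B" "adj F A B"
  shows "conn F (A \<union> B)"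
proof (rule connI)
  fix P Q assume PQ: "P \<union> Q = A \<union> B" "P \<inter> Q = {}" "P \<noteq> {}" "Q \<noteq> {}"
  have *: "adj F P Q" if C: "conn F C" "C \<subseteq> P \<union> Q" "P \<inter> C \<noteq> {}" "Q \<inter> C \<noteq> {}" for C
  proof -
    from C(3,4) obtain x y where "x \<in> C" "x \<in> P" "y \<in> C" "y \<in> Q" by blast
    then obtain a b where "a \<in> C" "a \<in> P" "b \<in> C" "b \<notin> P" "{a, b} \<in> F"
      using conn_cut[OF C(1), of x "\<lambda>x. x \<in> P" y] PQ(2) by blast
    then show ?thesis using C(2) by (auto simp: adj_def)
  qed
  from assms(3) obtain a b where ab: "a \<in> A" "b \<in> B" "{a, b} \<in> F" by (auto simp: adj_def)
  have sub: "A \<subseteq> P \<union> Q" "B \<subseteq> P \<union> Q" and PQA: "P \<subseteq> A \<union> B" "Q \<subseteq> A \<union> B"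
    using PQ(1) by simp_all (metis Un_upper1 Un_upper2)+
  show "adj F P Q"
  proof (cases "P \<inter> A \<noteq> {} \<and> Q \<inter> A \<noteq> {} \<or> P \<inter> B \<noteq> {} \<and> Q \<inter> B \<noteq> {}")
    case True then show ?thesis using *[OF assms(1) sub(1)] *[OF assms(2) sub(2)] by blast
  next
    case False
    then have "a \<in> P \<and> b \<in> Q \<or> b \<in> P \<and> a \<in> Q"
      using ab(1,2) sub PQA PQ(3,4) by blast
    then show ?thesis using ab(3) adj_commute[of F P Q] by (auto simp: adj_def)
  qed
qed

lemma conn_Un_common:
  assumes "conn F A" "conn F B" "x \<in> A" "x \<in> B"
  shows "conn F (A \<union> B)"
proof (rule connI_pointed[of x])
  show "x \<in> A \<union> B" using assms(3) by simp
  fix P Q assume PQ: "P \<union> Q = A \<union> B" "P \<inter> Q = {}" "x \<in> P" "Q \<noteq> {}"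
  obtain y where y: "y \<in> Q" "y \<notin> P" using PQ(2,4) by blast
  have "y \<in> A \<or> y \<in> B" using y(1) PQ(1) by (metis Un_iff)
  then obtain S where S: "conn F S" "S \<subseteq> A \<union> B" "x \<in> S" "y \<in> S" using assms by blast
  obtain a b where ab: "a \<in> P" "b \<in> S" "b \<notin> P" "{a, b} \<in> F"
    by (rule conn_cut[where \<phi> = "\<lambda>x. x \<in> P", OF S(1,3) PQ(3) S(4) y(2)])
  then have "b \<in> Q" using S(2) PQ(1) by (metis Un_iff subsetD)
  then show "adj F P Q" using ab by (auto intro: adjI)
qed

lemma conn_adj:
  assumes "conn F S" "A \<union> B = S" "A \<inter> B = {}" "A \<noteq> {}" "B \<noteq> {}"
  shows "adj F A B"
proof -
  obtain x y where xy: "x \<in> A" "y \<in> B" using assms(4,5) by blast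
  then have x: "x \<in> A" "x \<in> S" and y: "y \<in> S" "y \<notin> A"
    using assms(3) unfolding assms(2)[symmetric] by auto
  obtain a b where ab: "a \<in> A" "b \<in> S" "b \<notin> A" "{a, b} \<in> F"
    by (rule conn_cut[where \<phi> = "\<lambda>x. x \<in> A", OF assms(1) x(2,1) y])
  then have "b \<in> B" unfolding assms(2)[symmetric] by simp
  then show ?thesis using ab by (auto intro: adjI)
qed

text \<open>Take the least subset of \<open>S\<close> that contains \<open>x\<close> and has no edge
  to the rest. If it fell into two parts without edges between them, the part with \<open>x\<close>
  would be a smaller such set.\<close>

lemma component:
  assumes "x \<in> S"
  obtains Y where "Y \<subseteq> S" "x \<in> Y" "conn F Y" "\<not> adj F Y (S - Y)"
proof
  define Y where "Y = \<Inter>{Y. x \<in> Y \<and> Y \<subseteq> S \<and> \<not> adj F Y (S - Y)}"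
  have least: "Y \<subseteq> Z" if "x \<in> Z" "Z \<subseteq> S" "\<not> adj F Z (S - Z)" for Z
    using that unfolding Y_def by blast
  show "Y \<subseteq> S" using assms by (intro least) (auto simp: adj_def)
  show x: "x \<in> Y" unfolding Y_def by blast
  show cl: "\<not> adj F Y (S - Y)" unfolding Y_def adj_def by blast
  show "conn F Y"
  proof (rule connI, rule ccontr)
    fix P Q assume PQ: "P \<union> Q = Y" "P \<inter> Q = {}" "P \<noteq> {}" "Q \<noteq> {}" and n: "\<not> adj F P Q"
    have "S - P \<subseteq> Q \<union> (S - Y)" "S - Q \<subseteq> P \<union> (S - Y)" using PQ by blast+
    moreover have "\<not> adj F P (Q \<union> (S - Y))" "\<not> adj F Q (P \<union> (S - Y))"
      using n cl PQ(1) adj_commute[of F P Q] unfolding adj_Un_right adj_Un_left PQ(1)[symmetric] by blast+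
    ultimately have "\<not> adj F P (S - P)" "\<not> adj F Q (S - Q)"
      unfolding adj_def by blast+
    moreover have "x \<in> P \<or> x \<in> Q" using x PQ by blast
    ultimately show False using least[of P] least[of Q] PQ \<open>Y \<subseteq> S\<close> by blast
  qed
qed

section \<open>Minors read off from vertex labellings\<close>

definition obstructed :: "'a cgraph \<Rightarrow> bool" where
  "obstructed C \<longleftrightarrow> (\<exists>H. constraint_minor H C \<and> (\<exists>K\<in>obstructions. cgraph_iso H K))"

lemma obstructed_step: "minor_step C C' \<Longrightarrow> obstructed C' \<Longrightarrow> obstructed C"
  unfolding obstructed_def constraint_minor_def by (meson converse_rtranclp_into_rtranclp)

lemma delete_edges_minor:
  assumes "finite D" "D \<subseteq> E" "D \<inter> X = {}"
  shows "minor_step\<^sup>*\<^sup>* ((V, E), X) ((V, E - D), X)"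
  using assms
proof (induct rule: finite_induct)
  case (insert e D)
  have "minor_step ((V, E - D), X) (delete_edge e ((V, E - D), X))"
    using insert by (intro minor_step.delete) auto
  moreover have "E - D - {e} = E - insert e D" by blast
  ultimately show ?case using insert by (auto simp: delete_edge_def intro: rtranclp.rtrancl_into_rtrancl)
qed simp

lemma contract_edges_image:
  "e \<in> contract_edges u v F \<longleftrightarrow> (\<exists>e'\<in>F. e = merge u v ` e' \<and> card e = 2)"
  by (auto simp: contract_edges_def)

lemma contract_edges_pair:
  "{a, b} \<in> F \<Longrightarrow> merge u v a \<noteq> merge u v b \<Longrightarrow> {merge u v a, merge u v b} \<in> contract_edges u v F"
  by (auto simp: contract_edges_image intro!: bexI[of _ "{a,b}"])

lemma simple_contract:
  assumes "simple_graph (V, E)"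
  shows "simple_graph (merge u v ` V, contract_edges u v E)"
  using assms by (fastforce simp: simple_graph_def contract_edges_image)

text \<open>Edges between fibres that the target lacks are not distinguished, so they can be deleted.\<close>

lemma minor_of_labelling:
  fixes f :: "'a \<Rightarrow> nat"
  assumes "simple_graph (V, E)" "X \<subseteq> E" "f ` V = VK"
    and "\<And>i. conn E {x \<in> V. f x = i}"
    and "EK \<subseteq> (`) f ` E" "\<And>e. e \<in> EK \<Longrightarrow> card e = 2"
    and "YK = {e \<in> (`) f ` X. card e = 2}" "YK \<subseteq> EK"
  shows "\<exists>H. constraint_minor H ((V, E), X) \<and> cgraph_iso H ((VK, EK), YK)"
  using assms
proof (induct "card V" arbitrary: V E X rule: less_induct)
  case less
  have fin: "finite V" and Es: "\<And>e. e \<in> E \<Longrightarrow> e \<subseteq> V \<and> card e = 2"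
    using less.prems(1) by (auto simp: simple_graph_def)
  show ?case
  proof (cases "inj_on f V")
    case True
    have c2: "card (f ` e) = 2" if "e \<in> E" for e
      using Es[OF that] card_image[of f e] inj_on_subset[OF True] by metis
    let ?D = "{e \<in> E. f ` e \<notin> EK}"
    have "finite E" by (rule finite_subset[of _ "Pow V"]) (use Es fin in auto)
    then have "finite ?D" by simp
    moreover have "?D \<inter> X = {}" using c2 less.prems(2,7,8) by auto
    ultimately have m: "constraint_minor ((V, E - ?D), X) ((V, E), X)"
      unfolding constraint_minor_def by (intro delete_edges_minor) auto
    have "bij_betw f V VK" using True less.prems by (simp add: bij_betw_def)
    moreover have "(`) f ` (E - ?D) = EK" using less.prems(5) by auto
    moreover have "(`) f ` X = YK" using less.prems(2,7) c2 by auto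
    ultimately have "cgraph_iso ((V, E - ?D), X) ((VK, EK), YK)"
      unfolding cgraph_iso_def prod.case fst_conv snd_conv by blast
    then show ?thesis using m by blast
  next
    case False
    then obtain x y where xy: "x \<in> V" "y \<in> V" "f x = f y" "x \<noteq> y" by (auto simp: inj_on_def)
    let ?S = "{w \<in> V. f w = f x}"
    \<comment> \<open>A connected fibre with two vertices contains an edge; its ends carry the same
      label, so the labelling survives its contraction.\<close>
    obtain u v where uv: "u \<in> ?S" "u = x" "v \<in> ?S" "v \<noteq> x" "{u, v} \<in> E"
      using conn_cut[OF less.prems(4)[of "f x"], of x "\<lambda>w. w = x" y] xy by auto
    then have ne: "u \<noteq> v" and fuv: "f u = f v" and v: "v \<in> V" "u \<in> V" using xy by auto
    let ?g = "merge u v"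
    have fg: "f (?g w) = f w" for w using fuv by (simp add: merge_def)
    then have fgi: "f ` ?g ` A = f ` A" for A by (simp add: image_image)
    have step: "minor_step ((V, E), X) ((?g ` V, contract_edges u v E), contract_edges u v X)"
      using minor_step.contract[of u v "(V, E)" X] uv by (simp add: contract_def)
    have "?g ` V \<subseteq> V - {v}" using ne v by (auto simp: merge_def)
    then have "card (?g ` V) < card V"
      using fin v by (meson card_Diff1_less card_mono finite_Diff le_less_trans)
    \<comment> \<open>\<open>f\<close> factors through the merge, so an edge whose ends have
      different labels does not become a loop.\<close>
    have lift: "?g ` e \<in> contract_edges u v F" if "e \<in> F" "F \<subseteq> E" "card (f ` e) = 2" for e F
    proof -
      have "card e = 2" "finite e" using Es that card.infinite by fastforce+
      then have "card (?g ` e) \<le> 2" using card_image_le by metis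
      moreover have "2 \<le> card (?g ` e)"
        using card_image_le[of "?g ` e" f] that \<open>finite e\<close> by (simp add: fgi)
      ultimately show ?thesis using that by (auto simp: contract_edges_image)
    qed
    have "\<exists>H. constraint_minor H ((?g ` V, contract_edges u v E), contract_edges u v X)
        \<and> cgraph_iso H ((VK, EK), YK)"
    proof (rule less.hyps)
      show "card (?g ` V) < card V" by fact
      show "simple_graph (?g ` V, contract_edges u v E)" using less.prems by (intro simple_contract)
      show "contract_edges u v X \<subseteq> contract_edges u v E" using less.prems by (auto simp: contract_edges_def)
      show "f ` ?g ` V = VK" using less.prems by (simp add: fgi)
      show "conn (contract_edges u v E) {x \<in> ?g ` V. f x = i}" for i
      proof -
        have "conn (contract_edges u v E) (?g ` {x \<in> V. f x = i})"
          using less.prems(4) by (rule conn_image) (rule contract_edges_pair)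
        moreover have "?g ` {x \<in> V. f x = i} = {x \<in> ?g ` V. f x = i}" using fg by auto
        ultimately show ?thesis by simp
      qed
      show "EK \<subseteq> (`) f ` contract_edges u v E"
      proof
        fix e assume "e \<in> EK"
        then obtain e0 where e0: "e0 \<in> E" "e = f ` e0" "card e = 2"
          using less.prems(5,6) by blast
        then have "?g ` e0 \<in> contract_edges u v E" by (intro lift) auto
        moreover have "e = f ` ?g ` e0" using e0 by (simp add: fgi)
        ultimately show "e \<in> (`) f ` contract_edges u v E" by blast
      qed
      show "card e = 2" if "e \<in> EK" for e using that less.prems(6) by blast
      show "YK \<subseteq> EK" by fact
      show "YK = {e \<in> (`) f ` contract_edges u v X. card e = 2}"
      proof -
        have "e \<in> (`) f ` contract_edges u v X" if "e \<in> (`) f ` X" "card e = 2" for e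
        proof -
          from that(1) obtain e0 where e0: "e0 \<in> X" "e = f ` e0" by blast
          then have "?g ` e0 \<in> contract_edges u v X" using that(2) less.prems(2) by (intro lift) auto
          moreover have "e = f ` ?g ` e0" using e0 by (simp add: fgi)
          ultimately show ?thesis by blast
        qed
        moreover have "e \<in> (`) f ` X" if "e \<in> (`) f ` contract_edges u v X" for e
          using that by (auto simp: contract_edges_image fgi)
        ultimately show ?thesis unfolding less.prems(7) by auto
      qed
    qed
    then obtain H where "constraint_minor H ((?g ` V, contract_edges u v E), contract_edges u v X)"
      and iso: "cgraph_iso H ((VK, EK), YK)" by blast
    then have "constraint_minor H ((V, E), X)"
      using step unfolding constraint_minor_def by (simp add: converse_rtranclp_into_rtranclp)
    then show ?thesis using iso by blast
  qed
qed

section \<open>Connectedness of the distinguished set under minor steps\<close>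

lemma connected_edge_set_iff_conn:
  assumes "\<And>e. e \<in> X \<Longrightarrow> card e = 2"
  shows "connected_edge_set X \<longleftrightarrow> conn X (\<Union>X)"
proof -
  have "e \<noteq> {}" if "e \<in> X" for e using assms[OF that] by auto
  then have "\<Union>X = {} \<longleftrightarrow> X = {}" by blast
  moreover have "conn X (\<Union>X) \<longleftrightarrow> (\<forall>u\<in>\<Union>X. \<forall>v\<in>\<Union>X. (u, v) \<in> {(x, y). {x, y} \<in> X}\<^sup>*)"
    by (rule conn_iff_reachable) blast
  ultimately show ?thesis
    by (auto simp: connected_edge_set_def connected_graph_def edge_subgraph_def)
qed

lemma conn_contract:
  assumes "conn X (\<Union>X)"
  shows "conn (contract_edges u v X) (\<Union>(contract_edges u v X))"
proof (rule connI)
  let ?X' = "contract_edges u v X" and ?g = "merge u v"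
  fix P Q assume PQ: "P \<union> Q = \<Union>?X'" "P \<inter> Q = {}" "P \<noteq> {}" "Q \<noteq> {}"
  have sub: "\<Union>?X' \<subseteq> ?g ` \<Union>X" by (fastforce simp: contract_edges_image)
  have "P \<subseteq> ?g ` \<Union>X" "Q \<subseteq> ?g ` \<Union>X" using sub unfolding PQ(1)[symmetric] by simp_all
  then obtain x y where x: "x \<in> \<Union>X" "?g x \<in> P" and y: "y \<in> \<Union>X" "?g y \<in> Q" using PQ(3,4) by fast
  have "?g y \<notin> P" using y(2) PQ(2) by blast
  then obtain a b where ab: "?g a \<in> P" "?g b \<notin> P" "{a, b} \<in> X"
    by (rule conn_cut[where \<phi> = "\<lambda>x. ?g x \<in> P", OF assms x y(1)])
  then have e: "{?g a, ?g b} \<in> ?X'" by (intro contract_edges_pair) auto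
  then have "?g b \<in> P \<union> Q" unfolding PQ(1) by auto
  then show "adj ?X' P Q" using ab(1,2) e by (auto intro: adjI)
qed

lemma minor_conn:
  assumes "minor_step\<^sup>*\<^sup>* C H" "conn (snd C) (\<Union>(snd C))"
  shows "conn (snd H) (\<Union>(snd H))"
  using assms
proof (induct rule: rtranclp_induct)
  case (step H H')
  from step(2) show ?case
    by cases (use step conn_contract in \<open>auto simp: contract_def delete_edge_def\<close>)
qed simp

lemma obstruction_not_conn:
  assumes "K \<in> obstructions"
  shows "\<not> conn (snd K) (\<Union>(snd K))"
proof -
  have *: "\<not> conn Y (\<Union>Y)"
    if PQ: "x \<in> P \<inter> \<Union>Y" "y \<in> \<Union>Y - P" "\<forall>e\<in>Y. e \<subseteq> P \<or> e \<inter> P = {}"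
    for Y :: "nat set set" and P x y
  proof
    assume c: "conn Y (\<Union>Y)"
    from PQ(1,2) have "x \<in> \<Union>Y" "x \<in> P" "y \<in> \<Union>Y" "y \<notin> P" by simp_all
    then obtain a b where "a \<in> P" "b \<notin> P" "{a, b} \<in> Y"
      by (rule conn_cut[where \<phi> = "\<lambda>x. x \<in> P", OF c])
    then show False using bspec[OF PQ(3), of "{a, b}"] by simp
  qed
  have w: "\<not> conn {{0,1},{2,3}} (\<Union>{{0::nat,1},{2,3}})"
    by (rule *[of 0 "{0,1}" _ 2]) auto
  consider "K = constraint_K4" | "K = constraint_wheel" | "K \<in> constraint_prisms"
    using assms by (auto simp: obstructions_def)
  then show ?thesis
  proof cases
    case 1 then show ?thesis using w by (simp add: constraint_K4_def)
  next
    case 2 then show ?thesis using w by (simp add: constraint_wheel_def)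
  next
    case 3
    \<comment> \<open>No distinguished edge of a prism runs between its triangles, so one triangle
      is a part that no such edge leaves.\<close>
    then show ?thesis unfolding constraint_prisms_def
      by (elim insertE emptyE; simp only: snd_conv; intro *[of 0 "{0,1,2}" _ 3]; auto)
  qed
qed

lemma conn_not_obstructed:
  assumes "conn X (\<Union>X)"
  shows "\<not> obstructed (G, X)"
proof
  assume "obstructed (G, X)"
  then obtain H K where H: "constraint_minor H (G, X)" and K: "K \<in> obstructions" "cgraph_iso H K"
    by (auto simp: obstructed_def)
  from H have c: "conn (snd H) (\<Union>(snd H))"
    using minor_conn assms unfolding constraint_minor_def by fastforce
  from K(2) obtain f where f: "(`) f ` snd H = snd K" unfolding cgraph_iso_def by (auto split: prod.splits)
  have "conn (snd K) (f ` \<Union>(snd H))"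
    using c
  proof (rule conn_image)
    fix a b assume "{a, b} \<in> snd H"
    then have "f ` {a, b} \<in> snd K" using f by blast
    then show "{f a, f b} \<in> snd K" by simp
  qed
  moreover have "f ` \<Union>(snd H) = \<Union>(snd K)" unfolding f[symmetric] by auto
  ultimately show False using obstruction_not_conn K by metis
qed

section \<open>Recognising the obstructions\<close>

text \<open>Branch sets of a minor; the position in the list is the vertex of the obstruction. They
  cover \<open>V\<close> because vertices cannot be deleted.\<close>

definition bags :: "'a set \<Rightarrow> 'a set set \<Rightarrow> 'a set list \<Rightarrow> bool" where
  "bags V E Bs \<longleftrightarrow> \<Union>(set Bs) = V \<and> (\<forall>j<length Bs. \<forall>i<j. Bs ! i \<inter> Bs ! j = {}) \<and>
     (\<forall>B\<in>set Bs. B \<noteq> {} \<and> conn E B)"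

text \<open>The asymmetry between \<open>EK\<close> and \<open>YK\<close> mirrors the allowed steps:
  surplus edges outside \<open>X\<close> can be deleted, so \<open>E\<close> is tested in one
  direction only, whereas edges of \<open>X\<close> persist and must match exactly.\<close>

lemma obstructed_of_bags:
  assumes "simple_graph (V, E)" "X \<subseteq> E" "bags V E Bs"
    and K: "((VK, EK), YK) \<in> obstructions" "VK = {..<length Bs}" "YK \<subseteq> EK"
    and EK: "\<forall>e\<in>EK. \<exists>j<length Bs. \<exists>i<j. e = {i, j} \<and> adj E (Bs ! i) (Bs ! j)"
    and YK: "\<forall>j<length Bs. \<forall>i<j. adj X (Bs ! i) (Bs ! j) \<longleftrightarrow> {i, j} \<in> YK"
  shows "obstructed ((V, E), X)"
proof -
  let ?n = "length Bs"
  have ne: "Bs ! i \<noteq> {}" and cn: "conn E (Bs ! i)" if "i < ?n" for i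
    using assms(3) that by (auto simp: bags_def)
  have disj: "i = j" if "i < ?n" "j < ?n" "x \<in> Bs ! i" "x \<in> Bs ! j" for i j x
  proof (rule ccontr)
    assume "i \<noteq> j"
    then have "Bs ! i \<inter> Bs ! j = {}"
      using assms(3) that(1,2) unfolding bags_def by (metis Int_commute linorder_neqE_nat)
    then show False using that by blast
  qed
  define f where "f x = (THE i. i < ?n \<and> x \<in> Bs ! i)" for x
  have f: "f x = i" if "i < ?n" "x \<in> Bs ! i" for i x
    unfolding f_def using that disj by blast
  have UV: "x \<in> V \<longleftrightarrow> (\<exists>i<?n. x \<in> Bs ! i)" for x
    using assms(3) unfolding bags_def by (metis UnionE UnionI in_set_conv_nth)
  have fV: "f x < ?n" "x \<in> Bs ! f x" if "x \<in> V" for x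
    using that f UV by auto
  have fib: "{x \<in> V. f x = i} = (if i < ?n then Bs ! i else {})" for i
    using f fV UV by auto
  have Ee: "e \<subseteq> V" "card e = 2" if "e \<in> E" for e
    using assms(1) that by (auto simp: simple_graph_def)
  have "\<exists>H. constraint_minor H ((V, E), X) \<and> cgraph_iso H ((VK, EK), YK)"
  proof (rule minor_of_labelling)
    show "f ` V = VK"
    proof -
      have "i \<in> f ` V" if "i < ?n" for i
        using ne[OF that] f[OF that] UV that by blast
      then show ?thesis using fV K(2) by auto
    qed
    show "conn E {x \<in> V. f x = i}" for i
      unfolding fib using cn by (auto simp: conn_def)
    show "EK \<subseteq> (`) f ` E"
    proof
      fix e assume "e \<in> EK"
      then obtain i j where ij: "i < j" "j < ?n" "e = {i, j}" "adj E (Bs ! i) (Bs ! j)" using EK by blast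
      then obtain a b where "a \<in> Bs ! i" "b \<in> Bs ! j" "{a, b} \<in> E" by (auto simp: adj_def)
      moreover from this have "f ` {a, b} = e" using f[of i a] f[of j b] ij by simp
      ultimately show "e \<in> (`) f ` E" by blast
    qed
    show "card e = 2" if "e \<in> EK" for e
      using bspec[OF EK that] by auto
    show "YK = {e \<in> (`) f ` X. card e = 2}"
    proof (intro equalityI subsetI)
      fix e assume e: "e \<in> YK"
      then obtain i j where ij: "i < j" "j < ?n" "e = {i, j}"
        using bspec[OF EK subsetD[OF K(3) e]] by auto
      then have "adj X (Bs ! i) (Bs ! j)" using YK e by simp
      then obtain a b where "a \<in> Bs ! i" "b \<in> Bs ! j" "{a, b} \<in> X" by (auto simp: adj_def)
      moreover from this have "f ` {a, b} = e" using f[of i a] f[of j b] ij by simp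
      ultimately have "e \<in> (`) f ` X" by (metis image_eqI)
      then show "e \<in> {e \<in> (`) f ` X. card e = 2}" using ij by simp
    next
      fix e assume "e \<in> {e \<in> (`) f ` X. card e = 2}"
      then obtain e' where e': "e' \<in> X" "e = f ` e'" "card e = 2" by auto
      from e'(1) assms(2) have "e' \<in> E" by (rule subsetD[rotated])
      from Ee[OF this] obtain a b where ab: "e' = {a, b}" "a \<in> V" "b \<in> V" by (auto simp: card_2_iff)
      then have e: "e = {f a, f b}" "f a \<noteq> f b" using e' by auto
      have *: "{f a, f b} \<in> YK" if l: "f a < f b" and ab: "{a, b} \<in> X" "a \<in> V" "b \<in> V" for a b
      proof -
        have "adj X (Bs ! f a) (Bs ! f b)" using ab fV by (intro adjI[OF ab(1)])
        then show ?thesis using YK l fV(1)[OF ab(3)] by simp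
      qed
      have "{b, a} \<in> X" "{f b, f a} = {f a, f b}" using e'(1) ab(1) by (simp_all add: insert_commute)
      then show "e \<in> YK" using *[of a b] *[of b a] e ab e'(1) by (metis linorder_neqE_nat)
    qed
  qed (use assms in auto)
  then show ?thesis using K(1) by (auto simp: obstructed_def)
qed

lemma bags_4: "bags V E [A, B, C, D] \<longleftrightarrow> A \<union> B \<union> C \<union> D = V \<and>
    A \<inter> B = {} \<and> A \<inter> C = {} \<and> A \<inter> D = {} \<and> B \<inter> C = {} \<and> B \<inter> D = {} \<and> C \<inter> D = {} \<and>
    A \<noteq> {} \<and> B \<noteq> {} \<and> C \<noteq> {} \<and> D \<noteq> {} \<and> conn E A \<and> conn E B \<and> conn E C \<and> conn E D"
  unfolding bags_def by (simp add: All_less_Suc Un_assoc conj_ac)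

lemma bags_5: "bags V E [A, B, C, D, H] \<longleftrightarrow> A \<union> B \<union> C \<union> D \<union> H = V \<and>
    A \<inter> B = {} \<and> A \<inter> C = {} \<and> A \<inter> D = {} \<and> A \<inter> H = {} \<and> B \<inter> C = {} \<and> B \<inter> D = {} \<and> B \<inter> H = {} \<and>
    C \<inter> D = {} \<and> C \<inter> H = {} \<and> D \<inter> H = {} \<and>
    A \<noteq> {} \<and> B \<noteq> {} \<and> C \<noteq> {} \<and> D \<noteq> {} \<and> H \<noteq> {} \<and>
    conn E A \<and> conn E B \<and> conn E C \<and> conn E D \<and> conn E H"
  unfolding bags_def by (simp add: All_less_Suc Un_assoc conj_ac)

lemma bags_6: "bags V E [A, B, C, A', B', C'] \<longleftrightarrow> A \<union> B \<union> C \<union> A' \<union> B' \<union> C' = V \<and>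
    A \<inter> B = {} \<and> A \<inter> C = {} \<and> B \<inter> C = {} \<and> A' \<inter> B' = {} \<and> A' \<inter> C' = {} \<and> B' \<inter> C' = {} \<and>
    A \<inter> A' = {} \<and> A \<inter> B' = {} \<and> A \<inter> C' = {} \<and> B \<inter> A' = {} \<and> B \<inter> B' = {} \<and> B \<inter> C' = {} \<and>
    C \<inter> A' = {} \<and> C \<inter> B' = {} \<and> C \<inter> C' = {} \<and>
    A \<noteq> {} \<and> B \<noteq> {} \<and> C \<noteq> {} \<and> A' \<noteq> {} \<and> B' \<noteq> {} \<and> C' \<noteq> {} \<and>
    conn E A \<and> conn E B \<and> conn E C \<and> conn E A' \<and> conn E B' \<and> conn E C'"
  unfolding bags_def by (simp add: All_less_Suc Un_assoc conj_ac)

lemma adj_mono: "F \<subseteq> F' \<Longrightarrow> adj F A B \<Longrightarrow> adj F' A B"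
  by (auto simp: adj_def)

lemma obstructed_K4:
  assumes "simple_graph (V, E)" "X \<subseteq> E" "bags V E [A, B, C, D]"
    and "adj X A B" "adj X C D" "adj E A C" "adj E A D" "adj E B C" "adj E B D"
    and "\<not> adj X A C" "\<not> adj X A D" "\<not> adj X B C" "\<not> adj X B D"
  shows "obstructed ((V, E), X)"
proof (rule obstructed_of_bags[OF assms(1-3)])
  show "(({0,1,2,3}, {{0,1}, {0,2}, {0,3}, {1,2}, {1,3}, {2,3}}), {{0,1}, {2,3}}) \<in> obstructions"
    by (simp add: obstructions_def constraint_K4_def)
  show "{0,1,2,3} = {..<length [A, B, C, D]}" by (auto simp: numeral_eq_Suc lessThan_Suc)
qed (use assms adj_mono[OF assms(2)] in
  \<open>simp_all add: All_less_Suc Ex_less_Suc lessThan_Suc doubleton_eq_iff insert_commute\<close>)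

lemma obstructed_wheel:
  assumes "simple_graph (V, E)" "X \<subseteq> E" "bags V E [A, B, C, D, H]"
    and "adj X A B" "adj X C D" "adj E B C" "adj E A D"
    and "adj E A H" "adj E B H" "adj E C H" "adj E D H"
    and "\<not> adj X A C" "\<not> adj X A D" "\<not> adj X B C" "\<not> adj X B D"
    and "\<not> adj X A H" "\<not> adj X B H" "\<not> adj X C H" "\<not> adj X D H"
  shows "obstructed ((V, E), X)"
proof (rule obstructed_of_bags[OF assms(1-3)])
  show "(({0,1,2,3,4}, {{0,1}, {1,2}, {2,3}, {3,0}, {4,0}, {4,1}, {4,2}, {4,3}}), {{0,1}, {2,3}})
      \<in> obstructions"
    by (simp add: obstructions_def constraint_wheel_def)
  show "{0,1,2,3,4} = {..<length [A, B, C, D, H]}" by (auto simp: numeral_eq_Suc lessThan_Suc)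
qed (use assms adj_mono[OF assms(2)] in
  \<open>simp_all add: All_less_Suc Ex_less_Suc lessThan_Suc doubleton_eq_iff insert_commute\<close>)

text \<open>Leaves open which pairs inside a triangle are joined by \<open>X\<close>, so that a
  single case analysis on these pairs serves every later use.\<close>

definition prism_bags ::
  "'a set \<Rightarrow> 'a set set \<Rightarrow> 'a set set \<Rightarrow> 'a set \<Rightarrow> 'a set \<Rightarrow> 'a set \<Rightarrow> 'a set \<Rightarrow> 'a set \<Rightarrow> 'a set \<Rightarrow> bool" where
  "prism_bags V E X A B C A' B' C' \<longleftrightarrow> simple_graph (V, E) \<and> X \<subseteq> E \<and> bags V E [A, B, C, A', B', C'] \<and>
     adj E A B \<and> adj E A C \<and> adj E B C \<and> adj E A' B' \<and> adj E A' C' \<and> adj E B' C' \<and>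
     adj E A A' \<and> adj E B B' \<and> adj E C C' \<and> \<not> adj X (A \<union> B \<union> C) (A' \<union> B' \<union> C')"

lemma prism_bags_swap:
  assumes "prism_bags V E X A B C A' B' C'"
  shows "prism_bags V E X B A C B' A' C'" and "prism_bags V E X A C B A' C' B'"
    and "prism_bags V E X A' B' C' A B C"
  using assms unfolding prism_bags_def bags_6
  by (simp_all add: adj_commute Un_ac Int_commute)

text \<open>Contracting the rung at \<open>C\<close> and the edge between \<open>A'\<close> and
  \<open>B'\<close> leaves a K4; its distinguished edges join \<open>A\<close> to \<open>B\<close>
  and the two merged bags to each other.\<close>

lemma prism_bags_merge:
  assumes "prism_bags V E X A B C A' B' C'"
    and "adj X A B" "\<not> adj X A C" "\<not> adj X B C" "adj X C' A' \<or> adj X C' B'"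
  shows "obstructed ((V, E), X)"
proof (rule obstructed_K4)
  show "simple_graph (V, E)" "X \<subseteq> E" using assms(1) by (auto simp: prism_bags_def)
  show "bags V E [A, B, C \<union> C', A' \<union> B']"
    using assms(1) by (auto simp: prism_bags_def bags_6 bags_4 intro: conn_Un)
qed (use assms in \<open>auto simp: prism_bags_def adj_Un_left adj_Un_right adj_commute\<close>)

text \<open>The contracted rung at \<open>C\<close> becomes the hub, and the rim runs through
  \<open>A\<close>, \<open>B\<close>, \<open>B'\<close>, \<open>A'\<close>.\<close>

lemma prism_bags_wheel:
  assumes "prism_bags V E X A B C A' B' C'"
    and "adj X A B" "\<not> adj X A C" "\<not> adj X B C" "adj X A' B'" "\<not> adj X A' C'" "\<not> adj X B' C'"
  shows "obstructed ((V, E), X)"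
proof (rule obstructed_wheel)
  show "simple_graph (V, E)" "X \<subseteq> E" using assms(1) by (auto simp: prism_bags_def)
  show "bags V E [A, B, B', A', C \<union> C']"
    using assms(1) by (auto simp: prism_bags_def bags_6 bags_5 intro: conn_Un)
qed (use assms in \<open>auto simp: prism_bags_def adj_Un_left adj_Un_right adj_commute\<close>)

lemma prism_bags_full_full:
  assumes "prism_bags V E X A B C A' B' C'"
    and "adj X A B" "adj X A C" "adj X B C" "adj X A' B'" "adj X A' C'" "adj X B' C'"
  shows "obstructed ((V, E), X)"
proof -
  have assms': "simple_graph (V, E)" "X \<subseteq> E" "bags V E [A, B, C, A', B', C']"
    using assms(1) by (simp_all add: prism_bags_def)
  show ?thesis
  proof (rule obstructed_of_bags[OF assms'])
    show "(({0,1,2,3,4,5}, {{0,1}, {1,2}, {0,2}, {3,4}, {4,5}, {3,5}, {0,3}, {1,4}, {2,5}}),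
        {{0,1}, {1,2}, {0,2}, {3,4}, {4,5}, {3,5}}) \<in> obstructions"
      by (simp add: obstructions_def constraint_prisms_def prism_def)
    show "{0,1,2,3,4,5} = {..<length [A, B, C, A', B', C']}"
      by (auto simp: numeral_eq_Suc lessThan_Suc)
  qed (use assms in
    \<open>simp_all add: prism_bags_def All_less_Suc Ex_less_Suc doubleton_eq_iff adj_Un_left adj_Un_right\<close>)
qed

lemma prism_bags_full_path:
  assumes "prism_bags V E X A B C A' B' C'"
    and "adj X A B" "adj X A C" "adj X B C" "adj X A' B'" "adj X A' C'" "\<not> adj X B' C'"
  shows "obstructed ((V, E), X)"
proof -
  have assms': "simple_graph (V, E)" "X \<subseteq> E" "bags V E [A, B, C, A', B', C']"
    using assms(1) by (simp_all add: prism_bags_def)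
  show ?thesis
  proof (rule obstructed_of_bags[OF assms'])
    show "(({0,1,2,3,4,5}, {{0,1}, {1,2}, {0,2}, {3,4}, {4,5}, {3,5}, {0,3}, {1,4}, {2,5}}),
        {{0,1}, {1,2}, {0,2}, {3,4}, {3,5}}) \<in> obstructions"
      by (simp add: obstructions_def constraint_prisms_def prism_def)
    show "{0,1,2,3,4,5} = {..<length [A, B, C, A', B', C']}"
      by (auto simp: numeral_eq_Suc lessThan_Suc)
  qed (use assms in
    \<open>simp_all add: prism_bags_def All_less_Suc Ex_less_Suc doubleton_eq_iff adj_Un_left adj_Un_right\<close>)
qed

lemma prism_bags_path_path:
  assumes "prism_bags V E X A B C A' B' C'"
    and "adj X A B" "adj X A C" "adj X A' B'" "adj X A' C'" "\<not> adj X B C" "\<not> adj X B' C'"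
  shows "obstructed ((V, E), X)"
proof -
  have assms': "simple_graph (V, E)" "X \<subseteq> E" "bags V E [A, B, C, A', B', C']"
    using assms(1) by (simp_all add: prism_bags_def)
  show ?thesis
  proof (rule obstructed_of_bags[OF assms'])
    show "(({0,1,2,3,4,5}, {{0,1}, {1,2}, {0,2}, {3,4}, {4,5}, {3,5}, {0,3}, {1,4}, {2,5}}),
        {{0,1}, {0,2}, {3,4}, {3,5}}) \<in> obstructions"
      by (simp add: obstructions_def constraint_prisms_def prism_def)
    show "{0,1,2,3,4,5} = {..<length [A, B, C, A', B', C']}"
      by (auto simp: numeral_eq_Suc lessThan_Suc)
  qed (use assms in
    \<open>simp_all add: prism_bags_def All_less_Suc Ex_less_Suc doubleton_eq_iff adj_Un_left adj_Un_right\<close>)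
qed

lemma prism_bags_path_skew:
  assumes "prism_bags V E X A B C A' B' C'"
    and "adj X A B" "adj X A C" "adj X A' B'" "adj X B' C'" "\<not> adj X B C" "\<not> adj X A' C'"
  shows "obstructed ((V, E), X)"
proof -
  have assms': "simple_graph (V, E)" "X \<subseteq> E" "bags V E [A, B, C, A', B', C']"
    using assms(1) by (simp_all add: prism_bags_def)
  show ?thesis
  proof (rule obstructed_of_bags[OF assms'])
    show "(({0,1,2,3,4,5}, {{0,1}, {1,2}, {0,2}, {3,4}, {4,5}, {3,5}, {0,3}, {1,4}, {2,5}}),
        {{0,1}, {0,2}, {3,4}, {4,5}}) \<in> obstructions"
      by (simp add: obstructions_def constraint_prisms_def prism_def)
    show "{0,1,2,3,4,5} = {..<length [A, B, C, A', B', C']}"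
      by (auto simp: numeral_eq_Suc lessThan_Suc)
  qed (use assms in
    \<open>simp_all add: prism_bags_def All_less_Suc Ex_less_Suc doubleton_eq_iff adj_Un_left adj_Un_right\<close>)
qed

text \<open>The middle bag \<open>A\<close> of the first path either faces the middle bag of the
  opposite path or does not; the two skew positions differ by exchanging \<open>B\<close> and
  \<open>C\<close>. A full opposite triangle is the remaining case.\<close>

lemma prism_bags_path:
  assumes p: "prism_bags V E X A B C A' B' C'"
    and "adj X A B" "adj X A C" "\<not> adj X B C"
    and "adj X A' B' \<and> adj X A' C' \<or> adj X A' B' \<and> adj X B' C' \<or> adj X A' C' \<and> adj X B' C'"
  shows "obstructed ((V, E), X)"
  using assms prism_bags_full_path[OF prism_bags_swap(3)[OF p]] prism_bags_path_path[OF p]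
    prism_bags_path_skew[OF p] prism_bags_path_skew[OF prism_bags_swap(2)[OF p]]
  by (auto simp: adj_commute)

lemma prism_bags_single:
  assumes p: "prism_bags V E X A B C A' B' C'"
    and "adj X A B" "\<not> adj X A C" "\<not> adj X B C"
    and "adj X A' B' \<or> adj X A' C' \<or> adj X B' C'"
  shows "obstructed ((V, E), X)"
  using assms prism_bags_merge[OF p] prism_bags_wheel[OF p] by (auto simp: adj_commute)

lemma prism_bags_few:
  assumes p: "prism_bags V E X A B C A' B' C'"
    and "adj X A B \<or> adj X A C \<or> adj X B C"
    and "\<not> (adj X A B \<and> adj X A C \<or> adj X A B \<and> adj X B C \<or> adj X A C \<and> adj X B C)"
    and "adj X A' B' \<or> adj X A' C' \<or> adj X B' C'"
  shows "obstructed ((V, E), X)"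
  using assms prism_bags_single[OF p] prism_bags_single[OF prism_bags_swap(2)[OF p]]
    prism_bags_single[OF prism_bags_swap(2)[OF prism_bags_swap(1)[OF p]]]
  by (auto simp: adj_commute)

lemma prism_bags_two:
  assumes p: "prism_bags V E X A B C A' B' C'"
    and "adj X A B \<and> adj X A C \<or> adj X A B \<and> adj X B C \<or> adj X A C \<and> adj X B C"
    and "\<not> (adj X A B \<and> adj X A C \<and> adj X B C)"
    and "adj X A' B' \<and> adj X A' C' \<or> adj X A' B' \<and> adj X B' C' \<or> adj X A' C' \<and> adj X B' C'"
  shows "obstructed ((V, E), X)"
  using assms prism_bags_path[OF p] prism_bags_path[OF prism_bags_swap(1)[OF p]]
    prism_bags_path[OF prism_bags_swap(1)[OF prism_bags_swap(2)[OF p]]]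
  by (auto simp: adj_commute)

text \<open>Count the pairs joined by \<open>X\<close> in each triangle. Exactly one pair in some
  triangle leads to the K4 or the wheel; two or three pairs in both triangles lead to the four
  prisms.\<close>

lemma obstructed_prism:
  assumes p: "prism_bags V E X A B C A' B' C'"
    and "adj X A B \<or> adj X A C \<or> adj X B C"
    and "adj X A' B' \<or> adj X A' C' \<or> adj X B' C'"
  shows "obstructed ((V, E), X)"
  using assms prism_bags_few[OF p] prism_bags_few[OF prism_bags_swap(3)[OF p]]
    prism_bags_two[OF p] prism_bags_two[OF prism_bags_swap(3)[OF p]] prism_bags_full_full[OF p]
  by argo

section \<open>Three-connected graphs and components of the distinguished set\<close>

definition edge :: "'a set set \<Rightarrow> 'a \<Rightarrow> 'a \<Rightarrow> bool" where
  "edge F u v \<longleftrightarrow> {u, v} \<in> F"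

lemma edge_sym: "edge F u v \<longleftrightarrow> edge F v u"
  by (simp add: edge_def insert_commute)

lemma adj_edge: "adj F A B \<longleftrightarrow> (\<exists>a\<in>A. \<exists>b\<in>B. edge F a b)"
  by (simp add: adj_def edge_def)

definition nbrs :: "'a set set \<Rightarrow> 'a set \<Rightarrow> 'a set" where
  "nbrs E P = {b. b \<notin> P \<and> (\<exists>a\<in>P. edge E a b)}"

lemma edge_contract:
  assumes "\<And>e. e \<in> F \<Longrightarrow> card e = 2"
  shows "edge (contract_edges u v F) a b \<longleftrightarrow>
    a \<noteq> b \<and> (\<exists>x y. edge F x y \<and> merge u v x = a \<and> merge u v y = b)"
proof
  assume "edge (contract_edges u v F) a b"
  then obtain e where e: "e \<in> F" "{a, b} = merge u v ` e" "card {a, b} = 2"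
    by (auto simp: edge_def contract_edges_image)
  from assms[OF e(1)] obtain x y where xy: "e = {x, y}" by (auto simp: card_2_iff)
  then have "{a, b} = {merge u v x, merge u v y}" using e(2) by simp
  moreover have "edge F x y" "edge F y x" using e(1) xy edge_sym[of F x y] by (auto simp: edge_def)
  moreover have "a \<noteq> b" using e(3) by auto
  ultimately show "a \<noteq> b \<and> (\<exists>x y. edge F x y \<and> merge u v x = a \<and> merge u v y = b)"
    by (auto simp: doubleton_eq_iff)
next
  assume "a \<noteq> b \<and> (\<exists>x y. edge F x y \<and> merge u v x = a \<and> merge u v y = b)"
  then show "edge (contract_edges u v F) a b" unfolding edge_def using contract_edges_pair by fast
qed

text \<open>Phrased by neighbourhoods: when some vertex lies beyond \<open>P\<close> and its
  neighbours, \<open>nbrs E P\<close> is a separator. This form is easy to transfer to a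
  contraction.\<close>

locale three_connected =
  fixes V :: "'a set" and E :: "'a set set"
  assumes simple: "simple_graph (V, E)"
    and card_V: "4 \<le> card V"
    and nbrs3: "\<And>P. P \<subseteq> V \<Longrightarrow> P \<noteq> {} \<Longrightarrow> P \<union> nbrs E P \<noteq> V \<Longrightarrow> 3 \<le> card (nbrs E P)"

lemma three_connected_of_k_connected:
  assumes "simple_graph (V, E)" "k_connected 3 (V, E)"
  shows "three_connected V E"
proof
  show "simple_graph (V, E)" by fact
  show "4 \<le> card V" using assms(2) by (simp add: k_connected_def)
  have inV: "a \<in> V" "b \<in> V" if "{a, b} \<in> E" for a b
    using assms(1) that by (auto simp: simple_graph_def)
  fix P assume P: "P \<subseteq> V" "P \<noteq> {}" "P \<union> nbrs E P \<noteq> V"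
  show "3 \<le> card (nbrs E P)"
  proof (rule ccontr)
    assume c: "\<not> 3 \<le> card (nbrs E P)"
    let ?T = "nbrs E P"
    let ?F = "{e \<in> E. e \<inter> ?T = {}}"
    have TV: "?T \<subseteq> V" using inV by (auto simp: nbrs_def edge_def)
    then have "connected_graph (delete_verts (V, E) ?T)"
      using assms(2) c by (simp add: k_connected_def)
    then have r: "\<forall>u\<in>V - ?T. \<forall>v\<in>V - ?T. (u, v) \<in> {(x, y). {x, y} \<in> ?F}\<^sup>*"
      by (simp add: connected_graph_def delete_verts_def)
    have "y \<in> V - ?T" if "{x, y} \<in> ?F" for x y
      using that inV[of x y] by simp
    then have "conn ?F (V - ?T) \<longleftrightarrow>
        (\<forall>u\<in>V - ?T. \<forall>v\<in>V - ?T. (u, v) \<in> {(x, y). {x, y} \<in> ?F}\<^sup>*)"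
      by (rule conn_iff_reachable)
    with r have cn: "conn ?F (V - ?T)" by (rule iffD2[rotated])
    obtain x where x: "x \<in> P" using P(2) by blast
    then have x': "x \<in> V - ?T" using P(1) by (auto simp: nbrs_def)
    have "P \<union> ?T \<subset> V" using P(1,3) TV by (intro psubsetI) simp_all
    from psubset_imp_ex_mem[OF this] obtain y where y: "y \<in> V - ?T" "y \<notin> P" by blast
    obtain a b where "a \<in> P" "b \<in> V - ?T" "b \<notin> P" "{a, b} \<in> ?F"
      by (rule conn_cut[where \<phi> = "\<lambda>x. x \<in> P", OF cn x' x y])
    then show False by (auto simp: nbrs_def edge_def)
  qed
qed

section \<open>Contractions that make the distinguished set connected\<close>

definition disconnected :: "'a set set \<Rightarrow> bool" where
  "disconnected X \<longleftrightarrow> \<not> conn X (\<Union>X)"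

lemma in_Union_edge: 
  assumes "\<And>e. e \<in> X \<Longrightarrow> card e = 2"
  shows "x \<in> \<Union>X \<longleftrightarrow> (\<exists>y. edge X x y)"
proof
  assume "x \<in> \<Union>X"
  then obtain e where e: "e \<in> X" "x \<in> e" by blast
  from assms[OF e(1)] obtain a b where "e = {a, b}" by (auto simp: card_2_iff)
  then have "edge X x b \<or> edge X x a" using e by (auto simp: edge_def insert_commute)
  then show "\<exists>y. edge X x y" by blast
qed (auto simp: edge_def)

text \<open>No edge of \<open>X\<close> crosses \<open>P\<close>, and the merge respects
  \<open>P\<close> because \<open>u\<close> and \<open>v\<close> lie on the same side. On each side
  an edge other than \<open>uv\<close> survives, so \<open>P\<close> still separates the contracted
  set.\<close>

lemma disc_contract:
  assumes "\<And>e. e \<in> X \<Longrightarrow> card e = 2"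
    and P: "\<And>a b. edge X a b \<Longrightarrow> a \<in> P \<longleftrightarrow> b \<in> P" "u \<in> P \<longleftrightarrow> v \<in> P"
    and ab: "edge X a b" "a \<in> P" "{a, b} \<noteq> {u, v}"
    and cd: "edge X c d" "c \<notin> P" "{c, d} \<noteq> {u, v}"
  shows "disconnected (contract_edges u v X)"
  unfolding disconnected_def
proof
  let ?X = "contract_edges u v X" and ?g = "merge u v"
  assume cn: "conn ?X (\<Union>?X)"
  have g: "?g x \<in> P \<longleftrightarrow> x \<in> P" for x using P(2) by (auto simp: merge_def)
  have *: "?g x \<in> \<Union>?X" if "edge X x y" "{x, y} \<noteq> {u, v}" for x y
  proof -
    have "card {x, y} = 2" using assms(1) that(1) by (simp add: edge_def)
    then have "x \<noteq> y" by auto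
    then have "?g x \<noteq> ?g y" using that(2) by (auto simp: merge_def split: if_splits)
    then have "{?g x, ?g y} \<in> ?X" using contract_edges_pair that(1) by (simp add: edge_def contract_edges_pair)
    then show ?thesis by blast
  qed
  have "?g a \<in> P" "?g c \<notin> P" using g ab(2) cd(2) by blast+
  then obtain x y where "x \<in> P" "y \<notin> P" "{x, y} \<in> ?X"
    by (rule conn_cut[where \<phi> = "\<lambda>x. x \<in> P", OF cn *[OF ab(1,3)] _ *[OF cd(1,3)]])
  moreover from this obtain x' y' where "edge X x' y'" "?g x' = x" "?g y' = y"
    using edge_contract[OF assms(1), of X u v x y] by (auto simp: edge_def)
  ultimately show False using P(1) g by blast
qed

definition two_comp :: "'a set set \<Rightarrow> 'a set \<Rightarrow> 'a set \<Rightarrow> bool" where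
  "two_comp X C1 C2 \<longleftrightarrow> (\<forall>a b. edge X a b \<longrightarrow> a \<in> C1 \<and> b \<in> C1 \<or> a \<in> C2 \<and> b \<in> C2) \<and> C1 \<inter> C2 = {} \<and>
     C1 \<subseteq> \<Union>X \<and> C2 \<subseteq> \<Union>X \<and> C1 \<noteq> {} \<and> C2 \<noteq> {} \<and> conn X C1 \<and> conn X C2"

lemma two_comp_sym: "two_comp X C1 C2 \<Longrightarrow> two_comp X C2 C1"
  by (auto simp: two_comp_def)

text \<open>Every other situation admits a set for \<open>disc_contract\<close>: an uncovered end of
  \<open>uv\<close> can be moved to the side of the other end, a third component survives outside
  \<open>C1 \<union> C2\<close>, and a component with a vertex besides \<open>u\<close> and
  \<open>v\<close> keeps an edge.\<close>

lemma two_comp_of_connecting: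
  assumes c2: "\<And>e. e \<in> X \<Longrightarrow> card e = 2"
    and "disconnected X" and uv: "\<not> disconnected (contract_edges u v X)"
  shows "\<exists>C1 C2. two_comp X C1 C2 \<and> u \<in> C1 \<and> (v \<in> C2 \<or> C1 = {u, v})"
proof -
  note dc = disc_contract[of X _ u v, OF c2]
  note UX = in_Union_edge[of X, OF c2]
  from \<open>disconnected X\<close> obtain S0 where S0: "S0 \<subseteq> \<Union>X" "S0 \<noteq> {}" "S0 \<noteq> \<Union>X"
    "\<forall>a\<in>S0. \<forall>b\<in>\<Union>X - S0. {a, b} \<notin> X"
    unfolding disconnected_def conn_def by auto
  have S0c: "a \<in> S0 \<longleftrightarrow> b \<in> S0" if "edge X a b" for a b
    using S0(4) that edge_sym[of X a b] UX unfolding edge_def by blast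
  obtain a0 b0 where a0: "edge X a0 b0" "a0 \<in> S0" using S0(1,2) UX by blast
  have "S0 \<subset> \<Union>X" using S0(1,3) by (rule psubsetI)
  from psubset_imp_ex_mem[OF this] obtain c0 d0 where c0: "edge X c0 d0" "c0 \<notin> S0"
    using UX by auto
  have ux: "w \<in> \<Union>X" if "w = u \<or> w = v" for w
  proof (rule ccontr)
    assume w: "w \<notin> \<Union>X"
    define w' where "w' = (if w = u then v else u)"
    define P where "P = (if w' \<in> S0 then insert w S0 else S0 - {w})"
    have nw: "a \<noteq> w \<and> b \<noteq> w" if "edge X a b" for a b using w that by (auto simp: edge_def)
    have "a \<in> P \<longleftrightarrow> b \<in> P" if "edge X a b" for a b
      using S0c[OF that] nw[OF that] by (simp add: P_def)
    moreover have "w \<in> P \<longleftrightarrow> w' \<in> P" by (auto simp: P_def w'_def)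
    then have "u \<in> P \<longleftrightarrow> v \<in> P" using that by (auto simp: w'_def split: if_splits)
    moreover have "a0 \<in> P" "c0 \<notin> P" 
      using a0(2) c0(2) nw[OF a0(1)] nw[OF c0(1)] by (simp_all add: P_def)
    moreover have "w \<in> {u, v}" "w \<notin> {a0, b0}" "w \<notin> {c0, d0}"
      using nw[OF a0(1)] nw[OF c0(1)] that by blast+
    then have "{a0, b0} \<noteq> {u, v}" "{c0, d0} \<noteq> {u, v}" by metis+
    ultimately show False using dc[of P a0 b0 c0 d0] uv a0(1) c0(1) by simp
  qed
  have "u \<in> \<Union>X" by (rule ux) simp
  then obtain C1 where C1: "C1 \<subseteq> \<Union>X" "u \<in> C1" "conn X C1" "\<not> adj X C1 (\<Union>X - C1)"
    by (rule component)
  have cl: "a \<in> C \<longleftrightarrow> b \<in> C" if "edge X a b" "\<not> adj X C (\<Union>X - C)" for a b C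
  proof -
    have "a \<in> \<Union>X" "b \<in> \<Union>X" "edge X b a" 
      using that(1) edge_sym[of X a b] UX[of a] UX[of b] by blast+
    then show ?thesis using that unfolding adj_edge by blast
  qed
  have "C1 \<noteq> \<Union>X" using C1(3) \<open>disconnected X\<close> by (auto simp: disconnected_def)
  with C1(1) have "C1 \<subset> \<Union>X" by (rule psubsetI)
  from psubset_imp_ex_mem[OF this] obtain y0 where y0: "y0 \<in> \<Union>X" "y0 \<notin> C1" by auto
  \<comment> \<open>Choosing \<open>v\<close> itself when it lies outside \<open>C1\<close> is what
    puts it into \<open>C2\<close>.\<close>
  define y where "y = (if v \<in> C1 then y0 else v)"
  have y: "y \<in> \<Union>X" "y \<notin> C1" using y0 ux by (auto simp: y_def)
  from y(1) obtain C2 where C2: "C2 \<subseteq> \<Union>X" "y \<in> C2" "conn X C2" "\<not> adj X C2 (\<Union>X - C2)"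
    by (rule component)
  have disj: "C1 \<inter> C2 = {}"
  proof (rule ccontr)
    assume "C1 \<inter> C2 \<noteq> {}"
    then obtain w where "w \<in> C2" "w \<in> C1" by blast
    then obtain a b where "a \<in> C1" "b \<notin> C1" "{a, b} \<in> X"
      by (rule conn_cut[where \<phi> = "\<lambda>x. x \<in> C1", OF C2(3) _ _ C2(2) y(2)])
    then show False using cl[of a b C1] C1(4) by (auto simp: edge_def)
  qed
  have cov: "x \<in> C1 \<or> x \<in> C2" if x: "x \<in> \<Union>X" for x
  proof (rule ccontr)
    assume n: "\<not> (x \<in> C1 \<or> x \<in> C2)"
    let ?P = "C1 \<union> C2"
    obtain x' where x': "edge X x x'" using x UX by blast
    have P: "a \<in> ?P \<longleftrightarrow> b \<in> ?P" if "edge X a b" for a b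
      using cl[OF that C1(4)] cl[OF that C2(4)] by blast
    have uvP: "u \<in> ?P" "v \<in> ?P" using C1(2) C2(2) by (auto simp: y_def split: if_splits)
    obtain y' where y': "edge X y y'" using y(1) UX by blast
    have "y' \<notin> C1" using cl[OF y' C1(4)] y(2) by blast
    then have "{y, y'} \<noteq> {u, v}" using C1(2) y(2) by auto
    moreover have "{x, x'} \<noteq> {u, v}" using uvP n by auto
    ultimately show False using dc[of ?P y y' x x'] P uvP y' x' C2(2) n uv by blast
  qed
  have two: "two_comp X C1 C2"
    unfolding two_comp_def
  proof (intro conjI allI impI)
    fix a b assume ab: "edge X a b"
    then have "a \<in> \<Union>X" using UX by blast
    then show "a \<in> C1 \<and> b \<in> C1 \<or> a \<in> C2 \<and> b \<in> C2"
      using cov cl[OF ab C1(4)] cl[OF ab C2(4)] by blast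
  qed (use C1 C2 disj in auto)
  have "C1 = {u, v}" if v: "v \<in> C1"
  proof (rule ccontr)
    assume "C1 \<noteq> {u, v}"
    then obtain x where x: "x \<in> C1" "x \<noteq> u" "x \<noteq> v" using C1(2) v by blast
    obtain x' where x': "edge X x x'" using x C1(1) UX by blast
    obtain y' where y': "edge X y y'" using y(1) UX by blast
    have "x \<notin> {u, v}" "y \<notin> {u, v}" using x y(2) v C1(2) by auto
    then have "{x, x'} \<noteq> {u, v}" "{y, y'} \<noteq> {u, v}" by blast+
    then show False using dc[OF _ cl[OF _ C1(4)] _ x' x(1) _ y' y(2)] v C1(2) uv by simp
  qed
  then show ?thesis using two C1(2) C2(2) by (auto simp: y_def split: if_splits)
qed

lemma disc_contract_uncovered:
  assumes c2: "\<And>e. e \<in> X \<Longrightarrow> card e = 2" and "disconnected X" "a \<notin> \<Union>X \<or> b \<notin> \<Union>X"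
  shows "disconnected (contract_edges a b X)"
proof (rule ccontr)
  assume "\<not> disconnected (contract_edges a b X)"
  from two_comp_of_connecting[of X, OF c2 \<open>disconnected X\<close> this] obtain D1 D2
    where D: "two_comp X D1 D2" "a \<in> D1" "b \<in> D2 \<or> D1 = {a, b}" by metis
  then have "a \<in> \<Union>X" "b \<in> \<Union>X" unfolding two_comp_def by auto
  then show False using assms(3) by simp
qed

lemma two_comp_edge: "two_comp X C1 C2 \<Longrightarrow> edge X a b \<Longrightarrow> a \<in> C1 \<and> b \<in> C1 \<or> a \<in> C2 \<and> b \<in> C2"
  and two_comp_disj: "two_comp X C1 C2 \<Longrightarrow> x \<in> C1 \<Longrightarrow> x \<notin> C2"
  and two_comp_Union: "two_comp X C1 C2 \<Longrightarrow> x \<in> C1 \<or> x \<in> C2 \<Longrightarrow> x \<in> \<Union>X"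
  and two_comp_conn: "two_comp X C1 C2 \<Longrightarrow> conn X C1"
  and two_comp_ex: "two_comp X C1 C2 \<Longrightarrow> \<exists>x. x \<in> C2"
  unfolding two_comp_def by auto

text \<open>The third vertex \<open>x\<close> keeps an edge of \<open>X\<close> alive in
  \<open>C1\<close>, and the edges in \<open>C2\<close> are untouched.\<close>

lemma disc_contract_same:
  assumes c2: "\<And>e. e \<in> X \<Longrightarrow> card e = 2"
    and two: "two_comp X C1 C2" and uvx: "u \<in> C1" "v \<in> C1" "x \<in> C1" "x \<noteq> u" "x \<noteq> v"
  shows "disconnected (contract_edges u v X)"
proof -
  obtain y where y: "y \<in> C2" using two_comp_ex[OF two] by metis
  then have yn: "y \<notin> C1" using two_comp_disj[OF two] by metis
  have "x \<in> \<Union>X" "y \<in> \<Union>X" using two_comp_Union[OF two] y uvx(3) by simp_all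
  then obtain x' y' where e: "edge X x x'" "edge X y y'" using in_Union_edge[of X, OF c2] by metis
  have n: "x \<notin> {u, v}" "y \<notin> {u, v}" using uvx yn by auto
  show ?thesis
  proof (rule disc_contract[of X C1 u v x x' y y', OF c2])
    show "a \<in> C1 \<longleftrightarrow> b \<in> C1" if "edge X a b" for a b
      using two_comp_edge[OF two that] two_comp_disj[OF two] by metis
    show "{x, x'} \<noteq> {u, v}" "{y, y'} \<noteq> {u, v}" using n by blast+
  qed (use e y yn uvx in simp_all)
qed

section \<open>Two disjoint paths in a connected set\<close>

text \<open>Menger's theorem for two paths, thickened to a partition of \<open>D\<close>. The last
  hypothesis excludes one-vertex bottlenecks. For the induction, remove some \<open>x\<close> in
  \<open>Au\<close> and pass to the component \<open>Y\<close> of the remainder containing a vertex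
  of \<open>Az\<close>; the rest of \<open>D\<close> touches \<open>Y\<close> only at
  \<open>x\<close>.\<close>

lemma fan:
  assumes "finite D" "conn F D" "Au \<inter> D \<noteq> {}" "Av \<inter> D \<noteq> {}"
    and "\<exists>z1\<in>Az \<inter> D. \<exists>z2\<in>Az \<inter> D. z1 \<noteq> z2"
    and "\<And>P q. P \<subseteq> D \<Longrightarrow> P \<noteq> {} \<Longrightarrow> q \<in> D - P \<Longrightarrow>
      \<forall>p\<in>P. \<forall>r\<in>D. edge F p r \<longrightarrow> r \<in> P \<or> r = q \<Longrightarrow> \<exists>p\<in>P. p \<in> Au \<or> p \<in> Av"
  shows "\<exists>D1 D2. D1 \<union> D2 = D \<and> D1 \<inter> D2 = {} \<and> conn F D1 \<and> conn F D2 \<and>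
    Au \<inter> D1 \<noteq> {} \<and> Az \<inter> D1 \<noteq> {} \<and> Av \<inter> D2 \<noteq> {} \<and> Az \<inter> D2 \<noteq> {}"
  using assms
proof (induct "card D" arbitrary: D Au Av rule: less_induct)
  case less
  note meets = less.prems(6)
  obtain x where x: "x \<in> Au" "x \<in> D" using less.prems(3) by blast
  obtain z where z: "z \<in> Az" "z \<in> D" "z \<noteq> x" using less.prems(5) by blast
  have "z \<in> D - {x}" using z by simp
  then obtain Y where Y: "Y \<subseteq> D - {x}" "z \<in> Y" "conn F Y" "\<not> adj F Y (D - {x} - Y)"
    by (rule component)
  let ?R = "D - Y"
  have YR: "Y \<union> ?R = D" "Y \<inter> ?R = {}" using Y(1) by auto
  have xR: "x \<in> ?R" using x Y(1) by auto
  have YD: "Y \<subseteq> D" using Y(1) by auto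
  have nYR: "r = x" if "p \<in> Y" "r \<in> ?R" "edge F p r" for p r
    using Y(4) that unfolding adj_edge by blast
  \<comment> \<open>A part of \<open>?R\<close> without \<open>x\<close> must be joined to something
    in \<open>D\<close>, and it cannot be \<open>Y\<close>, whose only neighbour in
    \<open>?R\<close> is \<open>x\<close>.\<close>
  have cR: "conn F ?R"
  proof (rule connI_pointed[OF xR])
    fix A B assume AB: "A \<union> B = ?R" "A \<inter> B = {}" "x \<in> A" "B \<noteq> {}"
    obtain b where b: "b \<in> B" using AB(4) by blast
    have sub: "B \<subseteq> ?R" using AB(1) by (metis Un_upper2)
    have xB: "x \<notin> B" using AB(2,3) by auto
    have bD: "b \<in> D" using sub b by auto
    obtain c d where cd: "c \<in> B" "d \<in> D" "d \<notin> B" "{c, d} \<in> F"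
      by (rule conn_cut[where \<phi> = "\<lambda>x. x \<in> B", OF less.prems(2) bD b x(2) xB])
    have "d \<in> ?R"
    proof (rule ccontr)
      assume "d \<notin> ?R"
      then have "d \<in> Y" using cd(2) by simp
      moreover have "edge F d c" using cd(4) edge_sym[of F c d] by (simp add: edge_def)
      ultimately show False using nYR[of d c] cd(1) sub xB by auto
    qed
    then have "d \<in> A" unfolding AB(1)[symmetric] using cd(3) by simp
    then have "adj F B A" using cd(1,4) by (auto intro: adjI)
    then show "adj F A B" by (simp add: adj_commute)
  qed
  have xY: "x \<notin> Y" using Y(1) by auto
  obtain a b where ab: "a \<in> Y" "b \<in> D" "b \<notin> Y" "{a, b} \<in> F"
    by (rule conn_cut[where \<phi> = "\<lambda>x. x \<in> Y", OF less.prems(2) z(2) Y(2) x(2) xY])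
  then have "b = x" using nYR[of a b] by (simp add: edge_def)
  then have ax: "a \<in> Y" "edge F x a" using ab edge_sym[of F a x] by (simp_all add: edge_def)
  have less_card: "card Y < card D"
    using less.prems(1) YD xY x(2) by (metis psubsetI psubset_card_mono)
  have finY: "finite Y" using less.prems(1) YD by (rule finite_subset[rotated])
  \<comment> \<open>A part of \<open>Y\<close> without neighbours of \<open>x\<close> has the same
    neighbours in \<open>D\<close> as in \<open>Y\<close>, so the hypothesis on \<open>D\<close>
    applies to it.\<close>
  have meetsY: "\<exists>p\<in>P. p \<in> Au \<or> p \<in> Av \<or> edge F x p"
    if P: "P \<subseteq> Y" "P \<noteq> {}" "q \<in> Y - P"
      "\<forall>p\<in>P. \<forall>r\<in>Y. edge F p r \<longrightarrow> r \<in> P \<or> r = q" for P q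
  proof (rule ccontr)
    assume n: "\<not> ?thesis"
    have "\<exists>p\<in>P. p \<in> Au \<or> p \<in> Av"
    proof (rule meets)
      show "P \<subseteq> D" "P \<noteq> {}" "q \<in> D - P" using P YD by auto
      have "r \<in> P \<or> r = q" if pr: "p \<in> P" "r \<in> D" "edge F p r" for p r
      proof (cases "r \<in> Y")
        case True then show ?thesis using P(4) pr by blast
      next
        case False
        then have "r = x" using nYR[of p r] pr P(1) by blast
        then show ?thesis using n pr edge_sym[of F p x] by blast
      qed
      then show "\<forall>p\<in>P. \<forall>r\<in>D. edge F p r \<longrightarrow> r \<in> P \<or> r = q" by blast
    qed
    then show False using n by blast
  qed
  have adjR: "adj F B ?R" if "p \<in> B" "edge F x p" for p B
    using that xR edge_sym[of F x p] unfolding adj_edge by blast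
  have AvD: "Av \<inter> Y \<noteq> {} \<or> Av \<inter> ?R \<noteq> {}" using less.prems(4) by blast
  have Yz: "Az \<inter> Y \<noteq> {}" using z(1) Y(2) by blast
  have AzY: "\<exists>z1\<in>Az \<inter> Y. \<exists>z2\<in>Az \<inter> Y. z1 \<noteq> z2" if "Az \<inter> ?R = {}"
    using less.prems(5) that by blast
  have AuR: "Au \<inter> ?R \<noteq> {}" using x xR by blast
  have parts: "(D1 \<union> ?R) \<union> D2 = D" "(D1 \<union> ?R) \<inter> D2 = {}" "D1 \<union> (D2 \<union> ?R) = D" "D1 \<inter> (D2 \<union> ?R) = {}"
    if "D1 \<union> D2 = Y" "D1 \<inter> D2 = {}" for D1 D2
    using that YD by auto
  show ?case
  proof (cases "Av \<inter> Y = {}")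
    case False
    show ?thesis
    proof (cases "Az \<inter> ?R = {}")
      case R: False
      have "?R \<union> Y = D" "?R \<inter> Y = {}" using YD by auto
      then show ?thesis using R False cR Y(3) Yz AuR by metis
    next
      case R: True
      \<comment> \<open>Since \<open>x\<close> lies in \<open>Au\<close>, its neighbours become
        additional targets. Afterwards \<open>?R\<close> joins \<open>D1\<close> if \<open>x\<close>
        has a neighbour there; otherwise \<open>D1\<close> meets \<open>Au\<close> itself and
        \<open>?R\<close> joins \<open>D2\<close>.\<close>
      let ?Au = "Au \<union> {y. edge F x y}"
      have "\<exists>D1 D2. D1 \<union> D2 = Y \<and> D1 \<inter> D2 = {} \<and> conn F D1 \<and> conn F D2 \<and>
        ?Au \<inter> D1 \<noteq> {} \<and> Az \<inter> D1 \<noteq> {} \<and> Av \<inter> D2 \<noteq> {} \<and> Az \<inter> D2 \<noteq> {}"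
      proof (rule less.hyps[OF less_card finY Y(3) _ False AzY[OF R]])
        show "?Au \<inter> Y \<noteq> {}" using ax by blast
        fix P q assume "P \<subseteq> Y" "P \<noteq> {}" "q \<in> Y - P"
          "\<forall>p\<in>P. \<forall>r\<in>Y. edge F p r \<longrightarrow> r \<in> P \<or> r = q"
        from meetsY[OF this] show "\<exists>p\<in>P. p \<in> ?Au \<or> p \<in> Av" by blast
      qed
      then obtain D1 D2 where D: "D1 \<union> D2 = Y" "D1 \<inter> D2 = {}" "conn F D1" "conn F D2"
        "?Au \<inter> D1 \<noteq> {}" "Az \<inter> D1 \<noteq> {}" "Av \<inter> D2 \<noteq> {}" "Az \<inter> D2 \<noteq> {}" by metis
      show ?thesis
      proof (cases "\<exists>p\<in>D1. edge F x p")
        case True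
        then have "conn F (D1 \<union> ?R)" using adjR conn_Un[OF D(3) cR] by blast
        moreover have "Au \<inter> (D1 \<union> ?R) \<noteq> {}" "Az \<inter> (D1 \<union> ?R) \<noteq> {}" using AuR D(6) by blast+
        ultimately show ?thesis using parts(1,2)[OF D(1,2)] D(4,7,8) by metis
      next
        case n: False
        have "a \<in> D1 \<or> a \<in> D2" using ax(1) unfolding D(1)[symmetric] by simp
        then have "a \<in> D2" using n ax(2) by blast
        then have "conn F (D2 \<union> ?R)" using adjR ax(2) conn_Un[OF D(4) cR] by blast
        moreover have "Av \<inter> (D2 \<union> ?R) \<noteq> {}" "Az \<inter> (D2 \<union> ?R) \<noteq> {}" using D(7,8) by blast+
        moreover have "Au \<inter> D1 \<noteq> {}" using D(5) n by blast
        ultimately show ?thesis using parts(3,4)[OF D(1,2)] D(3,6) by metis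
      qed
    qed
  next
    case True
    then have AvR: "Av \<inter> ?R \<noteq> {}" using AvD by simp
    have "\<exists>p\<in>Y. p \<in> Au \<or> p \<in> Av"
    proof (rule meets)
      show "Y \<subseteq> D" by (rule YD)
      show "Y \<noteq> {}" using Y(2) by auto
      show "x \<in> D - Y" using x xY by simp
      show "\<forall>p\<in>Y. \<forall>r\<in>D. edge F p r \<longrightarrow> r \<in> Y \<or> r = x" using nYR by blast
    qed
    then have AuY: "Au \<inter> Y \<noteq> {}" using True by blast
    show ?thesis
    proof (cases "Az \<inter> ?R = {}")
      case R: False
      then show ?thesis using YR AuY AvR cR Y(3) Yz by metis
    next
      case R: True
      \<comment> \<open>\<open>Y\<close> misses \<open>Av\<close>, so the second path must leave
        through \<open>x\<close> and finish inside \<open>?R\<close>.\<close>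
      let ?Av = "{y. edge F x y}"
      have "\<exists>D1 D2. D1 \<union> D2 = Y \<and> D1 \<inter> D2 = {} \<and> conn F D1 \<and> conn F D2 \<and>
        Au \<inter> D1 \<noteq> {} \<and> Az \<inter> D1 \<noteq> {} \<and> ?Av \<inter> D2 \<noteq> {} \<and> Az \<inter> D2 \<noteq> {}"
      proof (rule less.hyps[OF less_card finY Y(3) AuY _ AzY[OF R]])
        show "?Av \<inter> Y \<noteq> {}" using ax by blast
        fix P q assume P: "P \<subseteq> Y" "P \<noteq> {}" "q \<in> Y - P"
          "\<forall>p\<in>P. \<forall>r\<in>Y. edge F p r \<longrightarrow> r \<in> P \<or> r = q"
        from meetsY[OF this] show "\<exists>p\<in>P. p \<in> Au \<or> p \<in> ?Av" using P(1) True by blast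
      qed
      then obtain D1 D2 where D: "D1 \<union> D2 = Y" "D1 \<inter> D2 = {}" "conn F D1" "conn F D2"
        "Au \<inter> D1 \<noteq> {}" "Az \<inter> D1 \<noteq> {}" "?Av \<inter> D2 \<noteq> {}" "Az \<inter> D2 \<noteq> {}" by metis
      then have "conn F (D2 \<union> ?R)" using adjR conn_Un[OF D(4) cR] by blast
      moreover have "Av \<inter> (D2 \<union> ?R) \<noteq> {}" "Az \<inter> (D2 \<union> ?R) \<noteq> {}" using AvR D(8) by blast+
      ultimately show ?thesis using parts(3,4)[OF D(1,2)] D(3,5,6) by metis
    qed
  qed
qed

section \<open>Fragments\<close>

lemma merge_image:
  assumes "u \<in> V" "v \<in> V" "u \<noteq> v"
  shows "merge u v ` V = V - {v}"
  using assms by (auto simp: merge_def image_iff)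

context three_connected
begin

abbreviation ad :: "'a \<Rightarrow> 'a \<Rightarrow> bool" where "ad \<equiv> edge E"

text \<open>A union of components of the graph without \<open>a\<close>, \<open>b\<close>,
  \<open>c\<close>, with a vertex left over on the other side. Connectedness is not part of the
  notion, so that complements and intersections of sides stay within it; distinctness of
  \<open>a\<close>, \<open>b\<close>, \<open>c\<close> follows in
  \<open>frag_distinct\<close>.\<close>

definition fragment :: "'a \<Rightarrow> 'a \<Rightarrow> 'a \<Rightarrow> 'a set \<Rightarrow> bool" where
  "fragment a b c C \<longleftrightarrow> C \<subseteq> V \<and> C \<noteq> {} \<and> a \<in> V \<and> b \<in> V \<and> c \<in> V \<and> a \<notin> C \<and> b \<notin> C \<and> c \<notin> C \<and>
     (\<forall>p q. p \<in> C \<longrightarrow> ad p q \<longrightarrow> q \<in> C \<or> q = a \<or> q = b \<or> q = c) \<and>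
     (\<exists>y\<in>V. y \<notin> C \<and> y \<noteq> a \<and> y \<noteq> b \<and> y \<noteq> c)"

definition in_separator :: "'a \<Rightarrow> 'a \<Rightarrow> bool" where
  "in_separator u v \<longleftrightarrow> (\<exists>z C. fragment u v z C)"

lemma finite_V: "finite V"
  and card_edge: "e \<in> E \<Longrightarrow> card e = 2"
  using simple by (auto simp: simple_graph_def)

lemma ad_V: "ad u v \<Longrightarrow> u \<in> V" "ad u v \<Longrightarrow> v \<in> V" "ad u v \<Longrightarrow> u \<noteq> v"
proof -
  assume uv: "ad u v"
  then have e: "{u, v} \<subseteq> V" "card {u, v} = 2" using simple by (auto simp: simple_graph_def edge_def)
  then show "u \<in> V" "v \<in> V" by simp_all
  show "u \<noteq> v" using e(2) by auto
qed

lemma ad_sym: "ad u v \<Longrightarrow> ad v u"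
  using edge_sym by metis

text \<open>The vertices \<open>a\<close> and \<open>b\<close> may coincide, which covers cut
  vertices as well.\<close>

lemma two_sep:
  assumes "P \<subseteq> V" "x \<in> P" "\<forall>p\<in>P. \<forall>q. ad p q \<longrightarrow> q \<in> P \<or> q = a \<or> q = b"
    and "y \<in> V" "y \<notin> P" "y \<noteq> a" "y \<noteq> b"
  shows False
proof -
  have sub: "nbrs E P \<subseteq> {a, b}" using assms(3) by (auto simp: nbrs_def)
  then have "card (nbrs E P) \<le> card {a, b}" by (intro card_mono) auto
  also have "\<dots> \<le> 2" by (simp add: card_insert_if)
  finally have "card (nbrs E P) \<le> 2" .
  moreover have "y \<notin> P \<union> nbrs E P" using sub assms(5-7) by auto
  then have "P \<union> nbrs E P \<noteq> V" using assms(4) by metis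
  ultimately show False using nbrs3[of P] assms(1,2) by fastforce
qed

lemma ex_vertex:
  assumes "card {a, b, c} < card V"
  obtains y where "y \<in> V" "y \<noteq> a" "y \<noteq> b" "y \<noteq> c"
proof -
  have "\<not> V \<subseteq> {a, b, c}" using assms card_mono[of "{a, b, c}" V] by auto
  then show ?thesis using that by blast
qed

lemma card_3_less: "card {a, b, c} < card V"
proof -
  have "card {a, b, c} \<le> 3" by (simp add: card_insert_if)
  then show ?thesis using card_V by simp
qed

lemma third_nbr:
  assumes "x \<in> V"
  obtains q where "ad x q" "q \<noteq> a" "q \<noteq> b"
proof -
  obtain y where y: "y \<in> V" "y \<noteq> x" "y \<noteq> a" "y \<noteq> b" using ex_vertex[OF card_3_less] by metis
  have "\<exists>q. ad x q \<and> q \<noteq> a \<and> q \<noteq> b"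
  proof (rule ccontr)
    assume "\<not> ?thesis"
    then show False using two_sep[of "{x}" x a b y] assms y by auto
  qed
  then show ?thesis using that by blast
qed

lemma fragD:
  assumes "fragment a b c C"
  shows "C \<subseteq> V" "C \<noteq> {}" "a \<in> V" "b \<in> V" "c \<in> V" "a \<notin> C" "b \<notin> C" "c \<notin> C"
    and frag_closed: "p \<in> C \<Longrightarrow> ad p q \<Longrightarrow> q \<in> C \<or> q = a \<or> q = b \<or> q = c"
    and "\<exists>y\<in>V. y \<notin> C \<and> y \<noteq> a \<and> y \<noteq> b \<and> y \<noteq> c"
  using assms unfolding fragment_def by simp_all

lemma frag_perm:
  assumes "fragment a b c C"
  shows "fragment b a c C" "fragment a c b C" "fragment c b a C"
  using assms unfolding fragment_def by auto

lemma frag_nbr_first: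
  assumes "fragment a b c C"
  shows "\<exists>p\<in>C. ad a p" "b \<noteq> c"
proof -
  note f = fragD[OF assms]
  obtain x where x: "x \<in> C" using f(2) by blast
  obtain y where y: "y \<in> V" "y \<notin> C" "y \<noteq> a" "y \<noteq> b" "y \<noteq> c" using f(10) by blast
  show "\<exists>p\<in>C. ad a p"
  proof (rule ccontr)
    assume "\<not> ?thesis"
    then have "\<forall>p\<in>C. \<forall>q. ad p q \<longrightarrow> q \<in> C \<or> q = b \<or> q = c" using f(9) ad_sym by metis
    from two_sep[OF f(1) x this y(1,2,4,5)] show False .
  qed
  show "b \<noteq> c"
  proof
    assume "b = c"
    then have "\<forall>p\<in>C. \<forall>q. ad p q \<longrightarrow> q \<in> C \<or> q = a \<or> q = b" using f(9) by metis
    from two_sep[OF f(1) x this y(1-4)] show False .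
  qed
qed

lemma frag_nbr:
  assumes "fragment a b c C"
  shows "\<exists>p\<in>C. ad a p" "\<exists>p\<in>C. ad b p" "\<exists>p\<in>C. ad c p"
    and frag_distinct: "a \<noteq> b" "a \<noteq> c" "b \<noteq> c"
  using frag_nbr_first[OF assms] frag_nbr_first[OF frag_perm(1)[OF assms]]
    frag_nbr_first[OF frag_perm(3)[OF assms]] by metis+

lemma frag_compl:
  assumes "fragment a b c C"
  shows "fragment a b c (V - C - {a, b, c})"
proof -
  note f = fragD[OF assms]
  have cl: "q \<in> V - C - {a, b, c} \<or> q = a \<or> q = b \<or> q = c"
    if p: "p \<in> V - C - {a, b, c}" "ad p q" for p q
  proof -
    have "q \<notin> C" using f(9)[of q p] ad_sym[OF p(2)] p(1) by blast
    then show ?thesis using ad_V(2)[OF p(2)] by blast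
  qed
  obtain x where x: "x \<in> C" using f(2) by blast
  obtain y where y: "y \<in> V" "y \<notin> C" "y \<noteq> a" "y \<noteq> b" "y \<noteq> c" using f(10) by blast
  have "\<exists>x\<in>V. x \<notin> V - C - {a, b, c} \<and> x \<noteq> a \<and> x \<noteq> b \<and> x \<noteq> c"
    using x f(1,6-8) by (intro bexI[of _ x]) auto
  moreover have "V - C - {a, b, c} \<noteq> {}" "V - C - {a, b, c} \<subseteq> V" using y by auto
  ultimately show ?thesis unfolding fragment_def using f(3-5) cl by simp
qed

lemma in_separator_sym: "in_separator u v \<longleftrightarrow> in_separator v u"
  unfolding in_separator_def using frag_perm(1) by metis

lemma edge_contract_E: "edge (contract_edges u v E) a b \<longleftrightarrow>
    a \<noteq> b \<and> (\<exists>x y. ad x y \<and> merge u v x = a \<and> merge u v y = b)"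
  using card_edge by (rule edge_contract)

text \<open>A set with at most two neighbours lifts to such a set in the original graph unless
  \<open>u\<close> is one of the neighbours. In that case \<open>u\<close>, \<open>v\<close> and at
  most one further vertex cut it off, which \<open>in_separator\<close> or \<open>two_sep\<close>
  excludes.\<close>

lemma contract_three_connected:
  assumes uv: "ad u v" and V5: "5 \<le> card V" and "\<not> in_separator u v"
  shows "three_connected (V - {v}) (contract_edges u v E)"
proof
  have uvV: "u \<in> V" "v \<in> V" "u \<noteq> v" using ad_V[OF uv] by auto
  show "simple_graph (V - {v}, contract_edges u v E)"
    using simple_contract[OF simple, of u v] merge_image[OF uvV] by simp
  show "4 \<le> card (V - {v})" using V5 uvV finite_V by simp
  let ?E = "contract_edges u v E" and ?g = "merge u v"
  fix P assume P: "P \<subseteq> V - {v}" "P \<noteq> {}" "P \<union> nbrs ?E P \<noteq> V - {v}"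
  let ?T = "nbrs ?E P"
  have PV: "P \<subseteq> V" "v \<notin> P" using P(1) by auto
  have T: "q \<in> ?T" if "p \<in> P'" "ad p q'" "?g p \<in> P" "?g q' = q" "q \<notin> P" for p q q' P'
    unfolding nbrs_def using that edge_contract_E[of u v "?g p" q] by auto
  have TV: "?T \<subseteq> V - {v}"
  proof
    fix q assume "q \<in> ?T"
    then obtain p x y where "ad x y" "?g y = q" by (auto simp: nbrs_def edge_contract_E)
    then have "q \<in> ?g ` V" using ad_V(2) by blast
    then show "q \<in> V - {v}" by (simp only: merge_image[OF uvV])
  qed
  then have fT: "finite ?T" using finite_V finite_subset by blast
  have "P \<union> ?T \<subset> V - {v}" using P(1,3) TV by (intro psubsetI) simp_all
  from psubset_imp_ex_mem[OF this]
  obtain y where y: "y \<in> V" "y \<noteq> v" "y \<notin> P" "y \<notin> ?T" by blast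
  obtain x where x: "x \<in> P" using P(2) by blast
  show "3 \<le> card ?T"
  proof (cases "u \<in> P")
    case True
    let ?P = "insert v P"
    have sub: "nbrs E ?P \<subseteq> ?T"
    proof
      fix q assume "q \<in> nbrs E ?P"
      then obtain p where p: "p \<in> ?P" "ad p q" "q \<noteq> v" "q \<notin> P" by (auto simp: nbrs_def)
      then show "q \<in> ?T" using T[of p ?P q q] True by (auto simp: merge_def)
    qed
    then have "y \<notin> ?P \<union> nbrs E ?P" using y by blast
    then have "?P \<union> nbrs E ?P \<noteq> V" using y(1) by metis
    then have "3 \<le> card (nbrs E ?P)" using PV uvV by (intro nbrs3) auto
    then show ?thesis using card_mono[OF fT sub] by simp
  next
    case False
    have gp: "?g p = p" if "p \<in> P" for p using that PV(2) by (auto simp: merge_def)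
    have nb: "q \<in> P \<or> q \<in> ?T \<or> q = v \<and> u \<in> ?T" if "p \<in> P" "ad p q" for p q
    proof (cases "q = v")
      case True then show ?thesis using T[of p P v u] that gp False by (simp add: merge_def)
    next
      case F: False
      then have "?g q = q" by (simp add: merge_def)
      then show ?thesis using T[of p P q q] that gp by auto
    qed
    show ?thesis
    proof (cases "u \<in> ?T")
      case uT: False
      have sub: "nbrs E P \<subseteq> ?T"
      proof
        fix q assume "q \<in> nbrs E P"
        then obtain p where "p \<in> P" "ad p q" "q \<notin> P" by (auto simp: nbrs_def)
        then show "q \<in> ?T" using nb[of p q] uT by blast
      qed
      then have "y \<notin> P \<union> nbrs E P" using y by blast
      then have "P \<union> nbrs E P \<noteq> V" using y(1) by metis
      then have "3 \<le> card (nbrs E P)" using PV P(2) by (intro nbrs3) auto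
      then show ?thesis using card_mono[OF fT sub] by simp
    next
      case uT: True
      show ?thesis
      proof (rule ccontr)
        assume c: "\<not> 3 \<le> card ?T"
        have "card (?T - {u}) \<le> 1" using c uT fT by simp
        then obtain z where z: "?T - {u} \<subseteq> {z}"
          by (metis card_le_Suc0_iff_eq One_nat_def finite_Diff fT insertCI subsetI)
        have cl: "q \<in> P \<or> q = u \<or> q = v \<or> (q = z \<and> z \<in> ?T)" if "p \<in> P" "ad p q" for p q
          using nb[OF that] z by blast
        show False
        proof (cases "z \<in> ?T")
          case True
          have "z \<notin> P" using True by (simp add: nbrs_def)
          moreover have "z \<in> V" using True TV by auto
          moreover have "\<exists>y\<in>V. y \<notin> P \<and> y \<noteq> u \<and> y \<noteq> v \<and> y \<noteq> z"
            using y uT True by (intro bexI[of _ y]) auto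
          ultimately have "fragment u v z P"
            unfolding fragment_def using PV False P(2) uvV cl by blast
          then show False using assms(3) by (auto simp: in_separator_def)
        next
          case n: False
          have "\<forall>p\<in>P. \<forall>q. ad p q \<longrightarrow> q \<in> P \<or> q = u \<or> q = v" using cl n by blast
          from two_sep[OF PV(1) x this y(1,3)] y(2,4) uT show False by auto
        qed
      qed
    qed
  qed
qed

text \<open>A bottleneck \<open>q\<close> in the sense of \<open>fan\<close> would, together with
  \<open>z\<close>, cut off a part of \<open>D\<close> from \<open>u\<close>.\<close>

lemma fan_frag:
  assumes f: "fragment u v z D" and cD: "conn E D"
    and z: "z1 \<in> D" "z2 \<in> D" "z1 \<noteq> z2" "ad z z1" "ad z z2"
  shows "\<exists>D1 D2. D1 \<union> D2 = D \<and> D1 \<inter> D2 = {} \<and> conn E D1 \<and> conn E D2 \<and>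
    adj E {u} D1 \<and> adj E {z} D1 \<and> adj E {v} D2 \<and> adj E {z} D2"
proof -
  note fd = fragD[OF f]
  have "\<exists>D1 D2. D1 \<union> D2 = D \<and> D1 \<inter> D2 = {} \<and> conn E D1 \<and> conn E D2 \<and>
    {y. ad u y} \<inter> D1 \<noteq> {} \<and> {y. ad z y} \<inter> D1 \<noteq> {} \<and> {y. ad v y} \<inter> D2 \<noteq> {} \<and> {y. ad z y} \<inter> D2 \<noteq> {}"
  proof (rule fan)
    show "finite D" using fd(1) finite_V finite_subset by blast
    show "conn E D" by (rule cD)
    show "{y. ad u y} \<inter> D \<noteq> {}" "{y. ad v y} \<inter> D \<noteq> {}" using frag_nbr(1,2)[OF f] by blast+
    show "\<exists>z1\<in>{y. ad z y} \<inter> D. \<exists>z2\<in>{y. ad z y} \<inter> D. z1 \<noteq> z2" using z by blast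
    fix P q assume P: "P \<subseteq> D" "P \<noteq> {}" "q \<in> D - P"
      "\<forall>p\<in>P. \<forall>r\<in>D. ad p r \<longrightarrow> r \<in> P \<or> r = q"
    show "\<exists>p\<in>P. p \<in> {y. ad u y} \<or> p \<in> {y. ad v y}"
    proof (rule ccontr)
      assume n: "\<not> ?thesis"
      obtain x where x: "x \<in> P" using P(2) by blast
      have "\<forall>p\<in>P. \<forall>r. ad p r \<longrightarrow> r \<in> P \<or> r = q \<or> r = z"
      proof (intro ballI allI impI)
        fix p r assume pr: "p \<in> P" "ad p r"
        have "r \<noteq> u" "r \<noteq> v" using n pr ad_sym[OF pr(2)] by auto
        then show "r \<in> P \<or> r = q \<or> r = z" using fd(9)[of p r] pr P(1,4) by blast
      qed
      moreover have "P \<subseteq> V" "u \<notin> P" "u \<noteq> q" using P(1,3) fd(1,6) by auto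
      ultimately show False using two_sep[of P x q z u] x fd(3) frag_distinct(2)[OF f] by blast
    qed
  qed
  then obtain D1 D2 where D: "D1 \<union> D2 = D" "D1 \<inter> D2 = {}" "conn E D1" "conn E D2"
    "{y. ad u y} \<inter> D1 \<noteq> {}" "{y. ad z y} \<inter> D1 \<noteq> {}" "{y. ad v y} \<inter> D2 \<noteq> {}" "{y. ad z y} \<inter> D2 \<noteq> {}"
    by metis
  have "adj E {w} S" if "{y. ad w y} \<inter> S \<noteq> {}" for w S using that unfolding adj_edge by blast
  then show ?thesis using D by metis
qed

end

section \<open>Contraction-critical constraint graphs\<close>

text \<open>\<open>merge\<close> is not symmetric, whence the two orientations.\<close>

definition keeps_disconnected :: "'a set set \<Rightarrow> 'a \<Rightarrow> 'a \<Rightarrow> bool" where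
  "keeps_disconnected X u v \<longleftrightarrow> disconnected (contract_edges u v X) \<or> disconnected (contract_edges v u X)"

context three_connected
begin

lemma Int_closed:
  assumes "fragment s1 s2 s3 C" "fragment t1 t2 t3 K" "p \<in> K \<inter> C" "ad p q"
  shows "(q \<in> C \<or> q = s1 \<or> q = s2 \<or> q = s3) \<and> (q \<in> K \<or> q = t1 \<or> q = t2 \<or> q = t3)"
  using frag_closed[OF assms(1), of p q] frag_closed[OF assms(2), of p q] assms(3,4) by blast

text \<open>Uncrossing: a neighbour of the corner \<open>K \<inter> C\<close> lies in each side or
  its separator. If only \<open>a\<close>, \<open>b\<close>, \<open>c\<close> qualify outside the
  corner, they separate it.\<close>

lemma Int_frag:
  assumes "fragment s1 s2 s3 C" "fragment t1 t2 t3 K" "K \<inter> C \<noteq> {}"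
    and "a \<in> V" "b \<in> V" "c \<in> V" "a \<notin> K \<inter> C" "b \<notin> K \<inter> C" "c \<notin> K \<inter> C"
    and "\<And>q. q \<in> C \<or> q = s1 \<or> q = s2 \<or> q = s3 \<Longrightarrow> q \<in> K \<or> q = t1 \<or> q = t2 \<or> q = t3 \<Longrightarrow>
      q \<in> K \<and> q \<in> C \<or> q = a \<or> q = b \<or> q = c"
    and "y \<in> V" "y \<notin> K \<inter> C" "y \<noteq> a" "y \<noteq> b" "y \<noteq> c"
  shows "fragment a b c (K \<inter> C)"
proof -
  have "K \<inter> C \<subseteq> V" using fragD(1)[OF assms(1)] by auto
  moreover have "q \<in> K \<inter> C \<or> q = a \<or> q = b \<or> q = c" if "p \<in> K \<inter> C" "ad p q" for p q
    using assms(10)[of q] Int_closed[OF assms(1,2) that] by blast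
  ultimately show ?thesis unfolding fragment_def using assms(3-9,11-15) by blast
qed

text \<open>With just two candidates for the boundary, a nonempty corner would contradict
  \<open>two_sep\<close>.\<close>

lemma Int_empty:
  assumes "fragment s1 s2 s3 C" "fragment t1 t2 t3 K"
    and "\<And>q. q \<in> C \<or> q = s1 \<or> q = s2 \<or> q = s3 \<Longrightarrow> q \<in> K \<or> q = t1 \<or> q = t2 \<or> q = t3 \<Longrightarrow>
      q \<in> K \<and> q \<in> C \<or> q = a \<or> q = b"
    and "y \<in> V" "y \<notin> K \<inter> C" "y \<noteq> a" "y \<noteq> b"
  shows "K \<inter> C = {}"
proof (rule ccontr)
  assume "K \<inter> C \<noteq> {}"
  then obtain x where x: "x \<in> K \<inter> C" by blast
  have "K \<inter> C \<subseteq> V" using fragD(1)[OF assms(1)] by auto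
  moreover have "\<forall>p\<in>K \<inter> C. \<forall>q. ad p q \<longrightarrow> q \<in> K \<inter> C \<or> q = a \<or> q = b"
    using assms(3) Int_closed[OF assms(1,2)] by blast
  ultimately show False using two_sep[OF _ x] assms(4-7) by blast
qed

end

locale contraction_critical = three_connected V E for V :: "'a set" and E +
  fixes X :: "'a set set"
  assumes XE: "X \<subseteq> E" and disc_X: "disconnected X" and V5: "5 \<le> card V"
    and critical: "\<And>u v. edge E u v \<Longrightarrow> keeps_disconnected X u v \<Longrightarrow> in_separator u v"
begin

abbreviation xd :: "'a \<Rightarrow> 'a \<Rightarrow> bool" where "xd \<equiv> edge X"
abbreviation F :: "'a \<Rightarrow> 'a \<Rightarrow> bool" where "F \<equiv> keeps_disconnected X"

lemma F_sym: "F u v \<Longrightarrow> F v u"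
  by (auto simp: keeps_disconnected_def)

lemma card_X: "e \<in> X \<Longrightarrow> card e = 2"
  using XE card_edge by blast

lemma xd_ad: "xd u v \<Longrightarrow> ad u v"
  using XE by (auto simp: edge_def)

lemma F_unc: "u \<notin> \<Union>X \<or> v \<notin> \<Union>X \<Longrightarrow> F u v"
  unfolding keeps_disconnected_def using disc_contract_uncovered[of X u v, OF card_X disc_X] by blast

lemma F_same: "two_comp X C1 C2 \<Longrightarrow> u \<in> C1 \<Longrightarrow> v \<in> C1 \<Longrightarrow> x \<in> C1 \<Longrightarrow> x \<noteq> u \<Longrightarrow> x \<noteq> v \<Longrightarrow> F u v"
  unfolding keeps_disconnected_def using disc_contract_same[of X, OF card_X] by blast

lemma not_F: "\<not> F u v \<Longrightarrow> \<exists>C1 C2. two_comp X C1 C2 \<and> u \<in> C1 \<and> (v \<in> C2 \<or> C1 = {u, v})"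
  unfolding keeps_disconnected_def using two_comp_of_connecting[of X u v, OF card_X disc_X] by blast

lemma two_comp_cover: "two_comp X C1 C2 \<Longrightarrow> x \<in> \<Union>X \<longleftrightarrow> x \<in> C1 \<or> x \<in> C2"
  using in_Union_edge[of X x, OF card_X] two_comp_edge[of X C1 C2 x] two_comp_Union by metis

lemma xnbr:
  assumes "two_comp X C1 C2" "x \<in> C1"
  obtains y where "y \<in> C1" "xd x y" "y \<noteq> x" "ad x y"
proof -
  have "x \<in> \<Union>X" using two_comp_Union assms by metis
  then obtain y where y: "xd x y" using in_Union_edge[of X x, OF card_X] by blast
  then have "y \<in> C1" using two_comp_edge[OF assms(1) y] two_comp_disj[OF assms(1)] assms(2) by blast
  then show ?thesis using that y xd_ad ad_V(3) by metis
qed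

text \<open>Otherwise both components of \<open>X\<close> are single edges, covering four vertices.
  A fifth vertex is uncovered, and contracting any edge at it keeps \<open>X\<close>
  disconnected.\<close>

lemma ex_F: "\<exists>u v. ad u v \<and> F u v"
proof (rule ccontr)
  assume n: "\<nexists>u v. ad u v \<and> F u v"
  have "X \<noteq> {}" using disc_X by (auto simp: disconnected_def conn_def)
  then obtain e where e: "e \<in> X" by blast
  obtain x y where "e = {x, y}" using card_X[OF e] by (auto simp: card_2_iff)
  then have xy: "xd x y" using e by (simp add: edge_def)
  then have "\<not> F x y" using n xd_ad by blast
  then obtain C1 C2 where two: "two_comp X C1 C2" and x: "x \<in> C1" "y \<in> C2 \<or> C1 = {x, y}"
    using not_F by blast
  have C1: "C1 = {x, y}" using two_comp_edge[OF two xy] two_comp_disj[OF two] x by blast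
  obtain c where c: "c \<in> C2" using two_comp_ex[OF two] by blast
  obtain d where d: "d \<in> C2" "xd c d" using xnbr[OF two_comp_sym[OF two] c] by metis
  have C2: "C2 \<subseteq> {c, d}" using F_same[OF two_comp_sym[OF two] c d(1)] n d(2) xd_ad by blast
  have "card {x, y, c, d} \<le> 4" by (simp add: card_insert_if)
  then have "\<not> V \<subseteq> {x, y, c, d}" using V5 card_mono[of "{x, y, c, d}" V] by auto
  then obtain r where r: "r \<in> V" "r \<notin> {x, y, c, d}" by blast
  then have "r \<notin> \<Union>X" using two_comp_cover[OF two, of r] C1 C2 by blast
  obtain q where "ad r q" using third_nbr[OF r(1)] by metis
  then show False using n F_unc \<open>r \<notin> \<Union>X\<close> by blast
qed

end

text \<open>Minimality ranges over all edges in \<open>F\<close> and all their separators, so sides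
  found at other edges compete with \<open>C\<close>.\<close>

locale minimal_fragment = contraction_critical V E X for V :: "'a set" and E and X +
  fixes u v z :: 'a and C :: "'a set"
  assumes uv: "edge E u v" and Fuv: "keeps_disconnected X u v" and fC: "fragment u v z C"
    and minimal: "\<And>u' v' z' C'. edge E u' v' \<Longrightarrow> keeps_disconnected X u' v' \<Longrightarrow> fragment u' v' z' C' \<Longrightarrow> card C \<le> card C'"
begin

definition D :: "'a set" where "D = V - C - {u, v, z}"

lemma fD: "fragment u v z D"
  unfolding D_def by (rule frag_compl[OF fC])

lemma swap: "minimal_fragment V E X v u z C"
proof
  show "ad v u" using ad_sym[OF uv] .
  show "F v u" using F_sym[OF Fuv] .
  show "fragment v u z C" using frag_perm(1)[OF fC] .
qed (rule minimal)

lemmas C = fragD[OF fC] and Dd = fragD[OF fD] and dist = frag_distinct[OF fC]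

lemma CD: "x \<in> V \<Longrightarrow> x \<in> C \<or> x \<in> D \<or> x = u \<or> x = v \<or> x = z" "x \<in> D \<Longrightarrow> x \<notin> C"
  by (auto simp: D_def)

lemma no_smaller:
  assumes "ad a b" "F a b" "fragment a b c K" "K \<subseteq> C" "x \<in> C" "x \<notin> K"
  shows False
proof -
  have "finite C" using C(1) finite_V finite_subset by blast
  moreover have "K \<subset> C" using assms(4-6) by blast
  ultimately have "card K < card C" by (rule psubset_card_mono)
  then show False using minimal[OF assms(1-3)] by simp
qed

text \<open>Otherwise \<open>K \<inter> C\<close>, which contains a neighbour of \<open>w\<close>,
  would be a fragment for the same separator; it misses \<open>w\<close> and so is smaller than
  \<open>C\<close>.\<close>

lemma meets_sep:
  assumes "w \<in> C" "ad w p" "F w p" "fragment w p t K"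
  shows "u \<in> K \<or> v \<in> K \<or> z \<in> K"
proof (rule ccontr)
  assume n: "\<not> (u \<in> K \<or> v \<in> K \<or> z \<in> K)"
  note k = fragD[OF assms(4)]
  obtain x where x: "x \<in> K" "ad w x" using frag_nbr(1)[OF assms(4)] by blast
  then have "x \<in> C" using C(9)[OF assms(1) x(2)] n by blast
  then have ne: "K \<inter> C \<noteq> {}" using x by blast
  obtain y where y: "y \<in> V" "y \<notin> K" "y \<noteq> w" "y \<noteq> p" "y \<noteq> t" using k(10) by blast
  have "fragment w p t (K \<inter> C)"
    by (rule Int_frag[OF fC assms(4) ne, of w p t y]) (use k n y in blast)+
  then show False using no_smaller[OF assms(2,3)] assms(1) k(6) by blast
qed

text \<open>As \<open>u\<close> and \<open>v\<close> are adjacent, some side of a separator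
  \<open>{w, z, t}\<close> contains neither, nor \<open>z\<close>, against
  \<open>meets_sep\<close>.\<close>

lemma w_nbr_not_F:
  assumes "w \<in> C" "ad z w"
  shows "\<not> F z w"
proof
  assume F: "F z w"
  then obtain t K0 where K0: "fragment w z t K0"
    using critical[OF assms(2)] in_separator_sym[of z w] unfolding in_separator_def by blast
  have "\<exists>K. fragment w z t K \<and> u \<notin> K \<and> v \<notin> K"
  proof (cases "u \<in> K0 \<or> v \<in> K0")
    case True
    let ?K = "V - K0 - {w, z, t}"
    have K: "fragment w z t ?K" by (rule frag_compl[OF K0])
    have "u \<notin> ?K \<and> v \<notin> ?K"
    proof (cases "u \<in> K0")
      case uK: True
      then have "v \<in> K0 \<or> v = w \<or> v = z \<or> v = t" using fragD(9)[OF K0 uK uv] by blast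
      then show ?thesis using uK by blast
    next
      case False
      then have vK: "v \<in> K0" using True by blast
      then have "u \<in> K0 \<or> u = w \<or> u = z \<or> u = t" using fragD(9)[OF K0 vK ad_sym[OF uv]] by blast
      then show ?thesis using vK by blast
    qed
    then show ?thesis using K by blast
  next
    case False then show ?thesis using K0 by blast
  qed
  then obtain K where K: "fragment w z t K" "u \<notin> K" "v \<notin> K" by blast
  have "z \<notin> K" using fragD(7)[OF K(1)] .
  then show False using meets_sep[OF assms(1) ad_sym[OF assms(2)] F_sym[OF F] K(1)] K(2,3) by blast
qed

text \<open>Both sides meet \<open>{u, v, z}\<close> and the edge \<open>uv\<close> cannot run
  between them, so \<open>z\<close> is alone on its side.\<close>

lemma sides:
  assumes "w \<in> C" "ad w p" "F w p" "fragment w p t K0"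
  obtains K where "fragment w p t K" "z \<in> K" "u \<notin> K" "v \<notin> K"
    "u \<in> V - K - {w, p, t} \<or> v \<in> V - K - {w, p, t}"
proof -
  let ?K0 = "V - K0 - {w, p, t}"
  have K0': "fragment w p t ?K0" by (rule frag_compl[OF assms(4)])
  have compl: "V - ?K0 - {w, p, t} = K0"
    using fragD(1,6-8)[OF assms(4)] by blast
  have m: "u \<in> K0 \<or> v \<in> K0 \<or> z \<in> K0" "u \<in> ?K0 \<or> v \<in> ?K0 \<or> z \<in> ?K0"
    using meets_sep[OF assms(1-3)] assms(4) K0' by blast+
  have cl: "v \<notin> ?K0" if "u \<in> K0"
    using fragD(9)[OF assms(4) that uv] by blast
  have cl': "u \<notin> ?K0" if "v \<in> K0"
    using fragD(9)[OF assms(4) that ad_sym[OF uv]] by blast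
  show ?thesis
  proof (cases "u \<in> K0 \<or> v \<in> K0")
    case True
    then have "u \<notin> ?K0" "v \<notin> ?K0" using cl cl' by blast+
    moreover from this have "z \<in> ?K0" using m(2) by blast
    ultimately show ?thesis using that[OF K0'] True unfolding compl by blast
  next
    case False
    then have n: "u \<notin> K0" "v \<notin> K0" and z: "z \<in> K0" using m(1) by blast+
    then have "u \<in> ?K0 \<or> v \<in> ?K0" using m(2) by blast
    then show ?thesis using that[OF assms(4) z n] by blast
  qed
qed

text \<open>If \<open>t\<close> were elsewhere, the separator would miss \<open>D\<close>, and each
  of its sides would meet \<open>D\<close> in a corner bounded by two of \<open>u\<close>,
  \<open>v\<close>, \<open>z\<close>. Both corners would be empty, although \<open>D\<close> is
  not.\<close>

lemma third_in_D:
  assumes "w \<in> C" "p \<noteq> z" "p \<in> C \<or> p = u \<or> p = v"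
    and K: "fragment w p t K" "z \<in> K" "u \<notin> K" "v \<notin> K" "u \<in> V - K - {w, p, t} \<or> v \<in> V - K - {w, p, t}"
  shows "t \<in> D"
proof (rule ccontr)
  assume t: "t \<notin> D"
  let ?K = "V - K - {w, p, t}"
  have K': "fragment w p t ?K" by (rule frag_compl[OF K(1)])
  have nD: "w \<notin> D" "p \<notin> D" using assms(1,3) CD(2) Dd(6,7) by blast+
  have "K \<inter> D = {}"
  proof (cases "u \<in> ?K")
    case True
    show ?thesis
      by (rule Int_empty[OF fD K(1), of z v u]) (use True K nD t dist Dd C assms in blast)+
  next
    case False
    then have v: "v \<in> ?K" using K(5) by blast
    show ?thesis
      by (rule Int_empty[OF fD K(1), of z u v]) (use v K nD t dist Dd C assms in blast)+
  qed
  moreover have "?K \<inter> D = {}"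
    by (rule Int_empty[OF fD K', of u v z]) (use K fragD(6-8)[OF K(1)] nD t dist Dd C assms in blast)+
  moreover obtain x where "x \<in> D" using Dd(2) by blast
  ultimately show False using nD t Dd(1) by blast
qed

text \<open>The corner of \<open>C\<close> on the side of \<open>z\<close> would be cut off by
  \<open>w\<close>, \<open>p\<close>, \<open>z\<close> and be smaller than \<open>C\<close>. Hence
  it is empty, and \<open>z\<close> reaches \<open>C\<close> only at separator vertices.\<close>

lemma F_nbr:
  assumes "w \<in> C" "ad w p" "F w p" "p \<noteq> z" "r \<in> C" "ad z r"
  shows "r = w \<or> r = p"
proof -
  obtain t K0 where K0: "fragment w p t K0" using critical[OF assms(2,3)] unfolding in_separator_def by blast
  obtain K where K: "fragment w p t K" "z \<in> K" "u \<notin> K" "v \<notin> K"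
    "u \<in> V - K - {w, p, t} \<or> v \<in> V - K - {w, p, t}"
    using sides[OF assms(1-3) K0] by metis
  note k = fragD[OF K(1)]
  have p: "p \<in> C \<or> p = u \<or> p = v" using C(9)[OF assms(1,2)] assms(4) by blast
  have t: "t \<in> D" by (rule third_in_D[OF assms(1,4) p K])
  then have t': "t \<notin> C" "t \<noteq> u" "t \<noteq> v" "t \<noteq> z" using CD(2) Dd(6-8) by blast+
  have "K \<inter> C = {}"
  proof (rule ccontr)
    assume ne: "K \<inter> C \<noteq> {}"
    have "t \<noteq> w" "t \<noteq> p" using frag_distinct[OF K(1)] by blast+
    then have "fragment w p z (K \<inter> C)"
      by (intro Int_frag[OF fC K(1) ne, of w p z t]) (use k K t' C p in blast)+
    then show False using no_smaller[OF assms(2,3)] assms(1) k(6) by blast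
  qed
  then show ?thesis using k(9)[OF K(2) assms(6)] assms(5) t'(1) by blast
qed

text \<open>Here \<open>u\<close> is in the separator, so \<open>v\<close> lies opposite to
  \<open>z\<close>. The corner of \<open>C\<close> on that side has boundary \<open>r\<close>,
  \<open>u\<close>, \<open>v\<close> and is empty by minimality.\<close>

lemma F_nbr_u:
  assumes "r \<in> C" "ad r u" "F r u" "q \<in> C" "ad v q"
  shows "q = r"
proof -
  obtain t K0 where K0: "fragment r u t K0" using critical[OF assms(2,3)] unfolding in_separator_def by blast
  obtain K where K: "fragment r u t K" "z \<in> K" "u \<notin> K" "v \<notin> K"
    "u \<in> V - K - {r, u, t} \<or> v \<in> V - K - {r, u, t}"
    using sides[OF assms(1-3) K0] by metis
  let ?K = "V - K - {r, u, t}"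
  have K': "fragment r u t ?K" by (rule frag_compl[OF K(1)])
  note k' = fragD[OF K']
  have v: "v \<in> ?K" using K(5) by blast
  have "u \<noteq> z" using dist by blast
  then have t: "t \<in> D" using third_in_D[OF assms(1) _ _ K] by blast
  then have t': "t \<notin> C" "t \<noteq> u" "t \<noteq> v" "t \<noteq> z" using CD(2) Dd(6-8) by blast+
  have "?K \<inter> C = {}"
  proof (rule ccontr)
    assume ne: "?K \<inter> C \<noteq> {}"
    have "t \<noteq> r" "t \<noteq> u" using frag_distinct[OF K(1)] by blast+
    then have "fragment r u v (?K \<inter> C)"
      by (intro Int_frag[OF fC K' ne, of r u v t]) (use k' v K t' C in blast)+
    then show False using no_smaller[OF assms(2,3)] assms(1) k'(6) by blast
  qed
  then show ?thesis using k'(9)[OF v assms(5)] assms(4) t'(1) C(6) by blast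
qed

end

context contraction_critical
begin

lemma no_cross_X:
  assumes "two_comp X C1 C2" "A \<subseteq> C1" "A \<inter> C2 = {}" "B \<inter> C1 = {}"
  shows "\<not> adj X A B"
  using two_comp_edge[OF assms(1)] assms(2-4) unfolding adj_edge by blast

end

section \<open>Sides with several vertices\<close>

context minimal_fragment
begin

text \<open>Otherwise \<open>w\<close> could replace \<open>z\<close> in the separator, cutting off
  the smaller side \<open>C - {w}\<close>.\<close>

lemma second_z_nbr:
  assumes "w \<in> C" "ad z w" "C \<noteq> {w}"
  shows "\<exists>w'\<in>C. w' \<noteq> w \<and> ad z w'"
proof (rule ccontr)
  assume n: "\<not> ?thesis"
  have "q \<in> C - {w} \<or> q = u \<or> q = v \<or> q = w" if "p \<in> C - {w}" "ad p q" for p q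
    using C(9)[of p q] that n ad_sym[of p q] by blast
  moreover have "\<exists>y\<in>V. y \<notin> C - {w} \<and> y \<noteq> u \<and> y \<noteq> v \<and> y \<noteq> w"
    using C(5,8) dist assms(1) by (intro bexI[of _ z]) auto
  ultimately have "fragment u v w (C - {w})"
    unfolding fragment_def using C(1-8) assms(1,3) by blast
  then show False using no_smaller[OF uv Fuv] assms(1) by blast
qed

lemma z_nbr_comp:
  assumes two: "two_comp X C1 C2" "z \<in> C1" and w: "w \<in> C" "ad z w"
  shows "w \<in> C2 \<or> C1 = {z, w}"
proof (rule ccontr)
  assume n: "\<not> ?thesis"
  have nF: "\<not> F z w" by (rule w_nbr_not_F[OF w])
  then have "w \<in> \<Union>X" using F_unc by blast
  then have "w \<in> C1" using two_comp_cover[OF two(1)] n by blast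
  then obtain x where "x \<in> C1" "x \<noteq> z" "x \<noteq> w" using n two(2) by blast
  then show False using F_same[OF two \<open>w \<in> C1\<close>] nF by blast
qed

text \<open>\<open>F_nbr\<close>, applied at both neighbours of \<open>z\<close>, first reduces
  \<open>C2\<close> to \<open>w1\<close> and its partner \<open>p\<close>, and then forbids edges
  from \<open>w\<close> or \<open>w1\<close> to uncovered vertices. So \<open>z\<close> and
  \<open>p\<close> would separate \<open>{w, w1}\<close>.\<close>

lemma z_partner_unique:
  assumes two: "two_comp X {z, w} C2" and w: "w \<in> C" "ad z w"
    and w1: "w1 \<in> C" "ad z w1" "w1 \<noteq> w"
  shows False
proof -
  have "w1 \<in> C2" using z_nbr_comp[OF two _ w1(1,2)] w1(3) C(8) w(1) by auto
  then obtain p where p: "p \<in> C2" "xd w1 p" "p \<noteq> w1" "ad w1 p"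
    using xnbr[OF two_comp_sym[OF two]] by metis
  have pz: "p \<noteq> z" "p \<noteq> w" using two_comp_disj[OF two_comp_sym[OF two] p(1)] by auto
  have C2: "C2 \<subseteq> {w1, p}"
  proof
    fix x assume x: "x \<in> C2"
    show "x \<in> {w1, p}"
    proof (rule ccontr)
      assume "x \<notin> {w1, p}"
      then have "F w1 p" using F_same[OF two_comp_sym[OF two] \<open>w1 \<in> C2\<close> p(1) x] by blast
      then show False using F_nbr[OF w1(1) p(4) _ pz(1) w] w1(3) pz by blast
    qed
  qed
  have unc: "q \<notin> \<Union>X" if "q \<noteq> z" "q \<noteq> w" "q \<noteq> w1" "q \<noteq> p" for q
    using two_comp_cover[OF two, of q] C2 that by blast
  have c1: "q = z \<or> q = w \<or> q = p" if "ad w1 q" for q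
  proof (rule ccontr)
    assume n: "\<not> ?thesis"
    then have "F w1 q" using F_unc unc[of q] ad_V(3)[OF that] by blast
    then show False using F_nbr[OF w1(1) that _ _ w] n w1(3) by blast
  qed
  have c: "q = z \<or> q = w1 \<or> q = p" if "ad w q" for q
  proof (rule ccontr)
    assume n: "\<not> ?thesis"
    then have "F w q" using F_unc unc[of q] ad_V(3)[OF that] by blast
    then show False using F_nbr[OF w(1) that _ _ w1(1,2)] n w1(3) by blast
  qed
  have cl: "\<forall>x\<in>{w, w1}. \<forall>q. ad x q \<longrightarrow> q \<in> {w, w1} \<or> q = z \<or> q = p" using c c1 by blast
  have s: "{w, w1} \<subseteq> V" "w \<in> {w, w1}" using w(1) w1(1) C(1) by auto
  have uvn: "u \<notin> {w, w1}" "v \<notin> {w, w1}" using w(1) w1(1) C(6,7) by auto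
  show False
  proof (cases "u = p")
    case True
    then show ?thesis using two_sep[OF s cl C(4) uvn(2)] dist by blast
  next
    case False
    then show ?thesis using two_sep[OF s cl C(3) uvn(1)] dist by blast
  qed
qed

text \<open>\<open>F_nbr_u\<close> in both orientations makes \<open>r\<close> the only neighbour of
  \<open>u\<close> and of \<open>v\<close> in \<open>C\<close>, so \<open>r\<close> and
  \<open>z\<close> would cut off the rest of \<open>C\<close>.\<close>

lemma no_leaf_nbr:
  assumes "r \<in> C" "ad r u" "F r u" "F r v" "w1 \<in> C" "w1 \<noteq> r"
  shows False
proof -
  interpret sw: minimal_fragment V E X v u z C by (rule swap)
  have vr: "q = r" if "q \<in> C" "ad v q" for q using F_nbr_u[OF assms(1-3) that] .
  moreover obtain q where "q \<in> C" "ad v q" using frag_nbr(2)[OF fC] by blast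
  ultimately have "ad r v" using ad_sym by blast
  then have ur: "q = r" if "q \<in> C" "ad u q" for q using sw.F_nbr_u[OF assms(1) _ assms(4) that] by blast
  have "\<forall>p\<in>C - {r}. \<forall>q. ad p q \<longrightarrow> q \<in> C - {r} \<or> q = r \<or> q = z"
    using C(9) vr ur ad_sym by blast
  then show False using two_sep[of "C - {r}" w1 r z u] C(1,3,6) dist assms(1,5,6) by blast
qed

text \<open>A part not joined to \<open>u\<close> cannot contain \<open>v\<close> either, so
  \<open>z\<close> alone would cut it off.\<close>

lemma conn_rest: "conn E (V - C - {z})"
proof (rule connI_pointed[of u])
  show "u \<in> V - C - {z}" using C(3,6) dist by blast
  fix P Q assume PQ: "P \<union> Q = V - C - {z}" "P \<inter> Q = {}" "u \<in> P" "Q \<noteq> {}"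
  show "adj E P Q"
  proof (rule ccontr)
    assume n: "\<not> adj E P Q"
    have PQ': "x \<in> P \<or> x \<in> Q \<longleftrightarrow> x \<in> V \<and> x \<notin> C \<and> x \<noteq> z" for x
      using PQ(1) by (metis Diff_iff UnI1 UnI2 UnE singletonD singletonI)
    obtain x where x: "x \<in> Q" using PQ(4) by blast
    have vQ: "v \<notin> Q" using n PQ(3) uv unfolding adj_edge by blast
    have uQ: "u \<notin> Q" using PQ(2,3) by blast
    have "q \<in> Q \<or> q = z" if pq: "p \<in> Q" "ad p q" for p q
    proof -
      have "p \<in> D" using PQ'[of p] pq(1) uQ vQ by (auto simp: D_def)
      then have "q \<in> V" "q \<notin> C" using ad_V(2)[OF pq(2)] C(9)[of q p] ad_sym[OF pq(2)] CD(2) Dd(6-8) by blast+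
      moreover have "q \<notin> P" using n pq ad_sym[OF pq(2)] unfolding adj_edge by blast
      ultimately show ?thesis using PQ'[of q] by blast
    qed
    then have "\<forall>p\<in>Q. \<forall>q. ad p q \<longrightarrow> q \<in> Q \<or> q = z \<or> q = z" by blast
    moreover have "Q \<subseteq> V" using PQ' by blast
    ultimately show False using two_sep[OF _ x _ C(3) uQ] dist by blast
  qed
qed

lemma obstructed_nontrivial:
  assumes "\<And>w. C \<noteq> {w}"
  shows "obstructed ((V, E), X)"
proof -
  obtain w1 where w1: "w1 \<in> C" "ad z w1" using frag_nbr(3)[OF fC] by blast
  obtain w2 where w2: "w2 \<in> C" "w2 \<noteq> w1" "ad z w2" using second_z_nbr[OF w1 assms] by blast
  obtain C1 C2 where two: "two_comp X C1 C2" and z: "z \<in> C1"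
    using not_F[OF w_nbr_not_F[OF w1]] by blast
  note two' = two_comp_sym[OF two]
  have W: "w \<in> C2" if "w \<in> C" "ad z w" for w
  proof -
    have "C1 \<noteq> {z, w}"
    proof
      assume "C1 = {z, w}"
      then have t: "two_comp X {z, w} C2" using two by simp
      show False
        using z_partner_unique[OF t that w1] z_partner_unique[OF t that w2(1,3)] w2(2) by blast
    qed
    then show ?thesis using z_nbr_comp[OF two z that] by blast
  qed
  have w12: "w1 \<in> C2" "w2 \<in> C2" using W w1 w2 by blast+
  have zC2: "z \<notin> C2" using two_comp_disj[OF two z] .
  \<comment> \<open>If \<open>p\<close> were not \<open>b\<close>, then \<open>b\<close> would be a
    third vertex of \<open>C2\<close> and the edge \<open>ap\<close> would lie in \<open>F\<close>;
    \<open>F_nbr\<close> leaves no room for \<open>b\<close> as a neighbour of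
    \<open>z\<close>.\<close>
  have partner: "p = b"
    if "x \<in> C2" "x \<notin> {w1, w2}" and ab: "{a, b} = {w1, w2}" "a \<noteq> b" and p: "p \<in> C2" "xd a p" for x a b p
  proof (rule ccontr)
    assume "p \<noteq> b"
    have abC: "a \<in> C" "b \<in> C" "ad z b" "b \<in> C2" "a \<in> C2" using ab w1 w2 w12 by (auto simp: doubleton_eq_iff)
    have "F a p" using F_same[OF two' abC(5) p(1) abC(4)] ab(2) \<open>p \<noteq> b\<close> by blast
    moreover have "p \<noteq> z" using p(1) zC2 by blast
    ultimately show False using F_nbr[OF abC(1) xd_ad[OF p(2)] _ _ abC(2,3)] ab(2) \<open>p \<noteq> b\<close> by blast
  qed
  have C2: "x = w1 \<or> x = w2" if "x \<in> C2" for x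
  proof (rule ccontr)
    assume "\<not> ?thesis"
    then have x: "x \<in> C2" "x \<notin> {w1, w2}" using that by auto
    have "w1 \<in> {w1, w2}" by simp
    then obtain a c where ac: "a \<in> {w1, w2}" "c \<in> C2" "c \<notin> {w1, w2}" "{a, c} \<in> X"
      by (rule conn_cut[where \<phi> = "\<lambda>x. x \<in> {w1, w2}", OF two_comp_conn[OF two'] w12(1) _ x])
    then show False
      using partner[OF x, of w1 w2 c] partner[OF x, of w2 w1 c] w2(2) by (auto simp: edge_def)
  qed
  have w12X: "xd w1 w2" using xnbr[OF two' w12(1)] C2 by metis
  have Fn: "F a b" if "a \<notin> C2" "b \<notin> C2" "a \<noteq> z" "b \<noteq> z" for a b
  proof (cases "a \<in> \<Union>X \<and> b \<in> \<Union>X")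
    case True
    then have "a \<in> C1" "b \<in> C1" using two_comp_cover[OF two] that by blast+
    then show ?thesis using F_same[OF two _ _ z] that by blast
  qed (use F_unc in blast)
  have uvC2: "u \<notin> C2" "v \<notin> C2" using C2 w1(1) w2(1) C(6,7) by blast+
  have Ceq: "C \<subseteq> {w1, w2}"
  proof (rule ccontr)
    assume "\<not> ?thesis"
    then obtain x where x: "x \<in> C - {w1, w2}" by blast
    have "\<exists>r\<in>C - {w1, w2}. ad r u \<or> ad r v"
    proof (rule ccontr)
      assume n: "\<not> ?thesis"
      have "\<forall>p\<in>C - {w1, w2}. \<forall>q. ad p q \<longrightarrow> q \<in> C - {w1, w2} \<or> q = w1 \<or> q = w2"
      proof (intro ballI allI impI)
        fix p q assume p: "p \<in> C - {w1, w2}" "ad p q"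
        then have "q \<noteq> z" using W[of p] C2[of p] ad_sym[OF p(2)] by blast
        then show "q \<in> C - {w1, w2} \<or> q = w1 \<or> q = w2" using C(9)[of p q] p n by blast
      qed
      moreover have "C - {w1, w2} \<subseteq> V" "u \<notin> C - {w1, w2}" "u \<noteq> w1" "u \<noteq> w2"
        using C(1,6) w1(1) w2(1) by blast+
      ultimately show False using two_sep[of "C - {w1, w2}" x w1 w2 u] x C(3) by blast
    qed
    then obtain r where r: "r \<in> C" "r \<noteq> w1" "r \<noteq> w2" "ad r u \<or> ad r v" by blast
    have "F r u" "F r v" using Fn[of r] uvC2 C2[of r] r C(8) dist by blast+
    then show False
      using no_leaf_nbr[OF r(1)] minimal_fragment.no_leaf_nbr[OF swap r(1)] r w1(1) by blast
  qed
  let ?R = "V - C - {z}"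
  have CC: "C = {w1, w2}" using Ceq w1(1) w2(1) by blast
  have C2C: "C2 \<subseteq> C" using C2 w1(1) w2(1) by blast
  obtain y where y: "y \<in> C1" "xd z y" "y \<noteq> z" "ad z y" using xnbr[OF two z] by metis
  have yR: "y \<in> ?R" using ad_V(2)[OF y(4)] y(1,3) C2 two_comp_disj[OF two] w12 CC by blast
  have nb: "adj E {w} ?R" if w: "w = w1 \<or> w = w2" for w
  proof -
    have "w \<in> V" "w \<in> C" using w w1(1) w2(1) C(1) by blast+
    obtain q where q: "ad w q" "q \<noteq> z" "q \<noteq> (if w = w1 then w2 else w1)" using third_nbr[OF \<open>w \<in> V\<close>] by metis
    then have "q \<in> ?R" using ad_V(2,3)[OF q(1)] w CC by (auto split: if_splits)
    then show ?thesis using q(1) unfolding adj_edge by blast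
  qed
  have nX: "\<not> adj X {w} {z}" "\<not> adj X {w} ?R" if "w = w1 \<or> w = w2" for w
  proof -
    have "\<not> adj X {w} B" if "B \<inter> C2 = {}" for B
      using no_cross_X[OF two', of "{w}" B] two_comp_disj[OF two'] w12 that \<open>w = w1 \<or> w = w2\<close> by blast
    moreover have "{z} \<inter> C2 = {}" "?R \<inter> C2 = {}" using zC2 C2C by blast+
    ultimately show "\<not> adj X {w} {z}" "\<not> adj X {w} ?R" by blast+
  qed
  have zw: "adj E {w1} {z}" "adj E {w2} {z}"
    using ad_sym[OF w1(2)] ad_sym[OF w2(3)] unfolding adj_edge by blast+
  have X12: "adj X {w1} {w2}" "adj X {z} ?R" using w12X y(2) yR unfolding adj_edge by blast+
  \<comment> \<open>Everything beyond \<open>z\<close> forms one bag; the partner \<open>y\<close>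
    of \<open>z\<close> supplies its distinguished edge.\<close>
  have "bags V E [{w1}, {w2}, {z}, ?R]"
    unfolding bags_4 using C(1,5,8) w2(2) conn_rest CC yR by (auto simp: conn_singleton)
  then show ?thesis
    using obstructed_K4[OF simple XE] X12 zw nb nX by blast
qed

end

section \<open>Fragments with one vertex\<close>

context contraction_critical
begin

text \<open>The images of the components share the merged vertex. Each vertex keeps an edge of
  \<open>X\<close>, since the edges inside a component differ from \<open>uv\<close>.\<close>

lemma cross_not_disc:
  assumes two: "two_comp X C1 C2" and u: "u \<in> C1" and v: "v \<in> C2"
  shows "\<not> disconnected (contract_edges u v X)"
proof -
  let ?X = "contract_edges u v X" and ?g = "merge u v"
  note two' = two_comp_sym[OF two]
  have c: "conn ?X (?g ` C)" if "conn X C" for C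
    using that by (rule conn_image) (rule contract_edges_pair)
  have "?g u = u" "?g v = u" by (auto simp: merge_def)
  then have "u \<in> ?g ` C1" "u \<in> ?g ` C2" 
    using image_eqI[of u ?g u C1] image_eqI[of u ?g v C2] u v by simp_all
  with c[OF two_comp_conn[OF two]] c[OF two_comp_conn[OF two']]
  have cn: "conn ?X (?g ` C1 \<union> ?g ` C2)" by (rule conn_Un_common)
  have disj: "v \<notin> C1" "u \<notin> C2" using two_comp_disj[OF two] two_comp_disj[OF two'] u v by blast+
  have g: "?g x \<in> \<Union>?X" if "xd x y" "y \<noteq> x" "\<not> (x = u \<and> y = v)" "\<not> (x = v \<and> y = u)" for x y
  proof -
    have "?g x \<noteq> ?g y" using that(2-4) by (auto simp: merge_def)
    then have "{?g x, ?g y} \<in> ?X" using that(1) by (auto simp: edge_def intro: contract_edges_pair)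
    then show ?thesis by blast
  qed
  have sub1: "?g ` C1 \<subseteq> \<Union>?X"
  proof
    fix q assume "q \<in> ?g ` C1"
    then obtain x where x: "q = ?g x" "x \<in> C1" by blast
    obtain y where "y \<in> C1" "xd x y" "y \<noteq> x" using xnbr[OF two x(2)] by metis
    then show "q \<in> \<Union>?X" using g[of x y] disj x by blast
  qed
  have sub2: "?g ` C2 \<subseteq> \<Union>?X"
  proof
    fix q assume "q \<in> ?g ` C2"
    then obtain x where x: "q = ?g x" "x \<in> C2" by blast
    obtain y where "y \<in> C2" "xd x y" "y \<noteq> x" using xnbr[OF two' x(2)] by metis
    then show "q \<in> \<Union>?X" using g[of x y] disj x by blast
  qed
  have "\<Union>?X \<subseteq> ?g ` C1 \<union> ?g ` C2"
  proof
    fix q assume "q \<in> \<Union>?X"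
    then obtain e x where "e \<in> X" "x \<in> e" "q = ?g x" by (auto simp: contract_edges_image)
    then show "q \<in> ?g ` C1 \<union> ?g ` C2" using two_comp_cover[OF two, of x] by blast
  qed
  then have "\<Union>?X = ?g ` C1 \<union> ?g ` C2" using sub1 sub2 by (intro equalityI Un_least)
  then show ?thesis using cn by (simp add: disconnected_def)
qed

lemma cross_not_F: "two_comp X C1 C2 \<Longrightarrow> u \<in> C1 \<Longrightarrow> v \<in> C2 \<Longrightarrow> \<not> F u v"
  unfolding keeps_disconnected_def using cross_not_disc two_comp_sym by blast

end

locale trivial_fragment = minimal_fragment V E X u v z "{w}" for V :: "'a set" and E X u v z w
begin

lemma trivial_fragment_swap: "trivial_fragment V E X v u z w"
  unfolding trivial_fragment_def by (rule swap)

lemma w_V: "w \<in> V" and w_ne: "w \<noteq> u" "w \<noteq> v" "w \<noteq> z" "w \<notin> D"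
  using C by (auto simp: D_def)

lemma w_nbr: "ad w q \<Longrightarrow> q = u \<or> q = v \<or> q = z"
  using C(9)[of w q] ad_V(3) by blast

lemma w_ad: "ad w u" "ad w v" "ad w z" "ad u w" "ad v w" "ad z w"
  using frag_nbr[OF fC] ad_sym by blast+

lemma V_cases: "x \<in> V \<longleftrightarrow> x = w \<or> x = u \<or> x = v \<or> x = z \<or> x \<in> D"
  using CD(1)[of x] w_V C(3-5) Dd(1) by blast

lemma D_ad: "adj E {u} D" "adj E {v} D" "adj E {z} D"
  using frag_nbr[OF fD] unfolding adj_edge by blast+

text \<open>The trace on \<open>D\<close> of a separator \<open>{v, w, t}\<close>: \<open>P1\<close>
  is the part of \<open>D\<close> on the side of \<open>u\<close>, and \<open>P2\<close> the part on
  the side of \<open>z\<close>.\<close>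

definition cut :: "'a \<Rightarrow> 'a set \<Rightarrow> 'a set \<Rightarrow> bool" where
  "cut t P1 P2 \<longleftrightarrow> t \<in> D \<and> t \<notin> P1 \<and> t \<notin> P2 \<and> P1 \<subseteq> D \<and> P2 \<subseteq> D \<and> P1 \<inter> P2 = {} \<and> D \<subseteq> {t} \<union> P1 \<union> P2 \<and>
     (\<forall>p q. p \<in> P1 \<longrightarrow> ad p q \<longrightarrow> q \<in> P1 \<or> q = t \<or> q = u \<or> q = v) \<and>
     (\<forall>p q. p \<in> P2 \<longrightarrow> ad p q \<longrightarrow> q \<in> P2 \<or> q = t \<or> q = z \<or> q = v) \<and>
     (\<forall>q. ad u q \<longrightarrow> q \<in> P1 \<or> q = v \<or> q = w \<or> q = t) \<and>
     (\<forall>q. ad z q \<longrightarrow> q \<in> P2 \<or> q = v \<or> q = w \<or> q = t)"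

text \<open>\<open>w\<close> has a neighbour on each side of \<open>{v, w, t}\<close>, and only
  \<open>u\<close> and \<open>z\<close> are available. With \<open>t\<close> outside
  \<open>D\<close>, the corners of \<open>D\<close> would be bounded by \<open>u\<close>,
  \<open>v\<close> and by \<open>v\<close>, \<open>z\<close>, hence empty.\<close>

lemma ex_cut:
  assumes "F v w"
  shows "\<exists>t P1 P2. cut t P1 P2"
proof -
  obtain t K0 where K0: "fragment v w t K0" using critical[OF w_ad(5) assms] unfolding in_separator_def by blast
  let ?K0 = "V - K0 - {v, w, t}"
  have K0': "fragment v w t ?K0" by (rule frag_compl[OF K0])
  have "u \<in> K0 \<or> z \<in> K0" using frag_nbr(2)[OF K0] w_nbr fragD(6)[OF K0] by blast
  moreover have "u \<in> ?K0 \<or> z \<in> ?K0" using frag_nbr(2)[OF K0'] w_nbr fragD(6)[OF K0'] by blast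
  moreover have "V - ?K0 - {v, w, t} = K0" using fragD(1,6-8)[OF K0] by blast
  ultimately have "\<exists>K. fragment v w t K \<and> u \<in> K \<and> z \<in> V - K - {v, w, t}"
    using K0 K0' by (metis Diff_iff)
  then obtain K where K: "fragment v w t K" "u \<in> K" and z: "z \<in> V - K - {v, w, t}" by blast
  let ?K = "V - K - {v, w, t}"
  have K': "fragment v w t ?K" by (rule frag_compl[OF K(1)])
  note k = fragD[OF K(1)] and k' = fragD[OF K']
  have t: "t \<in> D"
  proof (rule ccontr)
    assume t: "t \<notin> D"
    have "K \<inter> D = {}"
      by (rule Int_empty[OF fD K(1), of u v z]) (use z K k w_ne t dist Dd in blast)+
    moreover have "?K \<inter> D = {}"
      by (rule Int_empty[OF fD K', of v z u]) (use z K k w_ne t dist Dd in blast)+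
    moreover obtain x where "x \<in> D" using Dd(2) by blast
    ultimately show False using Dd(1,7) w_ne t by blast
  qed
  have "cut t (K \<inter> D) (?K \<inter> D)"
    unfolding cut_def
  proof (intro conjI allI impI)
    show "t \<in> D" by fact
    show "t \<notin> K \<inter> D" "t \<notin> ?K \<inter> D" "K \<inter> D \<subseteq> D" "?K \<inter> D \<subseteq> D" "(K \<inter> D) \<inter> (?K \<inter> D) = {}"
      using k(8) by blast+
    show "D \<subseteq> {t} \<union> (K \<inter> D) \<union> (?K \<inter> D)" using Dd(1,7) w_ne(4) by blast
    fix q
    show "q \<in> K \<inter> D \<or> q = t \<or> q = u \<or> q = v" if "p \<in> K \<inter> D" "ad p q" for p
      using Int_closed[OF fD K(1) that] z w_ne by blast
    show "q \<in> ?K \<inter> D \<or> q = t \<or> q = z \<or> q = v" if "p \<in> ?K \<inter> D" "ad p q" for p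
      using Int_closed[OF fD K' that] K(2) k w_ne by blast
    show "q \<in> K \<inter> D \<or> q = v \<or> q = w \<or> q = t" if "ad u q"
      using k(9)[OF K(2) that] ad_V[OF that] V_cases[of q] z by blast
    show "q \<in> ?K \<inter> D \<or> q = v \<or> q = w \<or> q = t" if "ad z q"
      using k'(9)[OF z that] ad_V[OF that] V_cases[of q] K(2) by blast
  qed
  then show ?thesis by blast
qed

lemma cutD:
  assumes "cut t P1 P2"
  shows "t \<in> D" "t \<notin> P1" "t \<notin> P2" "P1 \<subseteq> D" "P2 \<subseteq> D" "P1 \<inter> P2 = {}" "D \<subseteq> {t} \<union> P1 \<union> P2"
    and "p \<in> P1 \<Longrightarrow> ad p q \<Longrightarrow> q \<in> P1 \<or> q = t \<or> q = u \<or> q = v"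
    and "p \<in> P2 \<Longrightarrow> ad p q \<Longrightarrow> q \<in> P2 \<or> q = t \<or> q = z \<or> q = v"
    and "ad u q \<Longrightarrow> q \<in> P1 \<or> q = v \<or> q = w \<or> q = t"
    and "ad z q \<Longrightarrow> q \<in> P2 \<or> q = v \<or> q = w \<or> q = t"
  using assms unfolding cut_def by simp_all

text \<open>A part of \<open>D\<close> not joined to the part containing \<open>t\<close> meets
  \<open>P1\<close> in a set cut off by \<open>u\<close>, \<open>v\<close> and \<open>P2\<close> in
  one cut off by \<open>z\<close>, \<open>v\<close>.\<close>

lemma conn_D:
  assumes "F v w"
  shows "conn E D" "\<not> ad u z" "\<not> ad z u"
proof -
  obtain t P1 P2 where c: "cut t P1 P2" using ex_cut[OF assms] by blast
  note c = cutD[OF c]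
  have nt: "t \<noteq> u" "t \<noteq> v" "t \<noteq> z" using c(1) Dd(6-8) by blast+
  show "\<not> ad u z" using c(10)[of z] c(4) nt dist w_ne Dd(8) by blast
  then show "\<not> ad z u" using ad_sym by blast
  show "conn E D"
  proof (rule connI_pointed[OF c(1)])
    fix P Q assume PQ: "P \<union> Q = D" "P \<inter> Q = {}" "t \<in> P" "Q \<noteq> {}"
    show "adj E P Q"
    proof (rule ccontr)
      assume n: "\<not> adj E P Q"
      have inD: "x \<in> P \<or> x \<in> Q \<longleftrightarrow> x \<in> D" for x using PQ(1) by (metis Un_iff)
      have sub: "Q \<inter> S \<subseteq> V" for S using inD Dd(1) by blast
      have nP: "q \<notin> P" if "p \<in> Q" "ad p q" for p q
        using n that ad_sym unfolding adj_edge by blast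
      have "Q \<inter> P1 = {}"
      proof (rule ccontr)
        assume "Q \<inter> P1 \<noteq> {}"
        then obtain x where x: "x \<in> Q \<inter> P1" by blast
        have "\<forall>p\<in>Q \<inter> P1. \<forall>q. ad p q \<longrightarrow> q \<in> Q \<inter> P1 \<or> q = u \<or> q = v"
          using nP c(8) PQ(3) inD c(4) by blast
        then show False using two_sep[OF sub x _ C(5)] dist inD Dd(8) by blast
      qed
      moreover have "Q \<inter> P2 = {}"
      proof (rule ccontr)
        assume "Q \<inter> P2 \<noteq> {}"
        then obtain x where x: "x \<in> Q \<inter> P2" by blast
        have "\<forall>p\<in>Q \<inter> P2. \<forall>q. ad p q \<longrightarrow> q \<in> Q \<inter> P2 \<or> q = z \<or> q = v"
          using nP c(9) PQ(3) inD c(5) by blast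
        then show False using two_sep[OF sub x _ C(3)] dist inD Dd(6) by blast
      qed
      moreover obtain x where "x \<in> Q" using PQ(4) by blast
      ultimately show False using inD[of x] c(7) PQ(2,3) by blast
    qed
  qed
qed

text \<open>Otherwise the corners of \<open>P2\<close> with \<open>Q1\<close> and \<open>Q2\<close>
  have two boundary vertices each, so \<open>P2\<close> is empty. Then \<open>v\<close> would be the
  third neighbour of \<open>z\<close>, which the second cut excludes.\<close>

lemma cut_other_side:
  assumes c: "cut t P1 P2" and sc: "trivial_fragment.cut V E v u z w s Q1 Q2"
  shows "s \<in> P2"
proof (rule ccontr)
  assume s: "s \<notin> P2"
  interpret sw: trivial_fragment V E X v u z w by (rule trivial_fragment_swap)
  have swD: "sw.D = D" unfolding D_def sw.D_def by (simp add: insert_commute)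
  note c = cutD[OF c] and d = sw.cutD[OF sc, unfolded swD]
  have nt: "t \<noteq> u" "t \<noteq> v" "t \<noteq> z" "s \<noteq> u" "s \<noteq> v" "s \<noteq> z" using c(1) d(1) Dd(6-8) by blast+
  have nD: "u \<notin> P2" "v \<notin> P2" "z \<notin> P2" "u \<notin> Q1" "v \<notin> Q1" "z \<notin> Q1" "u \<notin> Q2" "v \<notin> Q2" "z \<notin> Q2"
    using c(5) d(4,5) Dd(6-8) by blast+
  have sub: "P2 \<inter> S \<subseteq> V" for S using c(5) Dd(1) by blast
  have "P2 \<inter> Q2 = {}"
  proof (rule ccontr)
    assume "P2 \<inter> Q2 \<noteq> {}"
    then obtain x where x: "x \<in> P2 \<inter> Q2" by blast
    have "\<forall>p\<in>P2 \<inter> Q2. \<forall>q. ad p q \<longrightarrow> q \<in> P2 \<inter> Q2 \<or> q = t \<or> q = z"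
      using c(9) d(9) s nD nt dist by blast
    then show False using two_sep[OF sub x _ C(3)] nD nt dist by blast
  qed
  moreover have "P2 \<inter> Q1 = {}"
  proof (rule ccontr)
    assume "P2 \<inter> Q1 \<noteq> {}"
    then obtain x where x: "x \<in> P2 \<inter> Q1" by blast
    have "\<forall>p\<in>P2 \<inter> Q1. \<forall>q. ad p q \<longrightarrow> q \<in> P2 \<inter> Q1 \<or> q = t \<or> q = v"
      using c(9) d(8) s nD nt dist by blast
    then show False using two_sep[OF sub x _ C(3)] nD nt dist by blast
  qed
  ultimately have P2: "P2 = {}" using s c(5) d(7) by blast
  obtain q where q: "ad z q" "q \<noteq> w" "q \<noteq> t" using third_nbr[OF C(5)] by metis
  then have "q = v" using c(11)[OF q(1)] P2 by blast
  then show False using d(11)[OF q(1)] nD nt dist w_ne by blast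
qed

text \<open>The two cuts together empty \<open>P1\<close>, leaving \<open>u\<close> the neighbours
  \<open>v\<close>, \<open>w\<close>, \<open>t\<close>. A separator containing \<open>u\<close> and
  \<open>t\<close> would have to place the adjacent vertices \<open>v\<close> and \<open>w\<close>
  on opposite sides.\<close>

lemma triangle_third:
  assumes "F v w" "F u w"
  shows "\<exists>t\<in>D. ad u t \<and> (\<forall>q. ad u q \<longrightarrow> q = v \<or> q = w \<or> q = t) \<and> \<not> F u t"
proof -
  interpret sw: trivial_fragment V E X v u z w by (rule trivial_fragment_swap)
  have swD: "sw.D = D" unfolding D_def sw.D_def by (simp add: insert_commute)
  obtain t P1 P2 where c0: "cut t P1 P2" using ex_cut[OF assms(1)] by blast
  obtain s Q1 Q2 where d0: "sw.cut s Q1 Q2" using sw.ex_cut[OF assms(2)] by blast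
  note c = cutD[OF c0] and d = sw.cutD[OF d0, unfolded swD]
  have s: "s \<in> P2" by (rule cut_other_side[OF c0 d0])
  have t: "t \<in> Q2" by (rule sw.cut_other_side[OF d0 c0])
  have nt: "t \<noteq> u" "t \<noteq> v" "t \<noteq> z" "s \<noteq> u" "s \<noteq> v" "s \<noteq> z" using c(1) d(1) Dd(6-8) by blast+
  have nD: "u \<notin> P1" "v \<notin> P1" "z \<notin> P1" "u \<notin> Q1" "v \<notin> Q1" "z \<notin> Q1" "u \<notin> Q2" "v \<notin> Q2" "z \<notin> Q2"
    using c(4) d(4,5) Dd(6-8) by blast+
  have st: "s \<noteq> t" "s \<notin> P1" "t \<notin> Q1" using s t c(3,6) d(6) by blast+
  have sub: "P1 \<inter> S \<subseteq> V" for S using c(4) Dd(1) by blast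
  have "P1 \<inter> Q2 = {}"
  proof (rule ccontr)
    assume "P1 \<inter> Q2 \<noteq> {}"
    then obtain x where x: "x \<in> P1 \<inter> Q2" by blast
    have "\<forall>p\<in>P1 \<inter> Q2. \<forall>q. ad p q \<longrightarrow> q \<in> P1 \<inter> Q2 \<or> q = t \<or> q = u"
      using c(8) d(9) st nD nt dist by blast
    then show False using two_sep[OF sub x _ C(5)] nD nt dist by blast
  qed
  moreover have "P1 \<inter> Q1 = {}"
  proof (rule ccontr)
    assume "P1 \<inter> Q1 \<noteq> {}"
    then obtain x where x: "x \<in> P1 \<inter> Q1" by blast
    have "\<forall>p\<in>P1 \<inter> Q1. \<forall>q. ad p q \<longrightarrow> q \<in> P1 \<inter> Q1 \<or> q = u \<or> q = v"
      using c(8) d(8) st nD nt dist by blast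
    then show False using two_sep[OF sub x _ C(5)] nD nt dist by blast
  qed
  ultimately have "P1 = {}" using st c(4) d(7) by blast
  then have un: "q = v \<or> q = w \<or> q = t" if "ad u q" for q using c(10)[OF that] by blast
  obtain q where "ad u q" "q \<noteq> v" "q \<noteq> w" using third_nbr[OF C(3)] by metis
  then have ut: "ad u t" using un by blast
  have "\<not> F u t"
  proof
    assume "F u t"
    then obtain r K where K: "fragment u t r K" using critical[OF ut] unfolding in_separator_def by blast
    let ?K = "V - K - {u, t, r}"
    have K': "fragment u t r ?K" by (rule frag_compl[OF K])
    have "v \<in> K \<or> w \<in> K" using frag_nbr(1)[OF K] un fragD(7)[OF K] by blast
    moreover have "v \<in> ?K \<or> w \<in> ?K" using frag_nbr(1)[OF K'] un by blast
    ultimately show False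
      using fragD(9)[OF K _ w_ad(2)] fragD(9)[OF K _ w_ad(5)] by blast
  qed
  then show ?thesis using c(1) ut un by blast
qed

text \<open>All neighbours of \<open>z\<close> except \<open>w\<close> lie in \<open>D\<close>, so
  there are two of them for \<open>fan_frag\<close>.\<close>

lemma split_D:
  assumes "conn E D" "\<not> ad z u" "\<not> ad z v"
  obtains D1 D2 where "D1 \<union> D2 = D" "D1 \<inter> D2 = {}" "conn E D1" "conn E D2" "D1 \<noteq> {}" "D2 \<noteq> {}"
    "adj E {u} D1" "adj E {z} D1" "adj E {v} D2" "adj E {z} D2" "adj E D1 D2"
proof -
  have inD: "q \<in> D" if "ad z q" "q \<noteq> w" for q
    using ad_V[OF that(1)] that V_cases[of q] assms(2,3) by blast
  obtain z1 where z1: "ad z z1" "z1 \<noteq> w" using third_nbr[OF C(5)] by metis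
  obtain z2 where z2: "ad z z2" "z2 \<noteq> w" "z2 \<noteq> z1" using third_nbr[OF C(5)] by metis
  obtain D1 D2 where D: "D1 \<union> D2 = D" "D1 \<inter> D2 = {}" "conn E D1" "conn E D2"
    "adj E {u} D1" "adj E {z} D1" "adj E {v} D2" "adj E {z} D2"
    using fan_frag[OF fD assms(1) inD[OF z1] inD[OF z2(1,2)]] z1 z2 by metis
  have ne: "D1 \<noteq> {}" "D2 \<noteq> {}" using D(6,8) by (auto simp: adj_def)
  have "adj E D1 D2" by (rule conn_adj[OF assms(1) D(1,2) ne])
  then show ?thesis using that[OF D(1-4) ne D(5-8)] by blast
qed

end

section \<open>Obstructions around a vertex of degree three\<close>

context trivial_fragment
begin

lemma V_eqI: "(\<And>x. x \<in> S \<longleftrightarrow> x = w \<or> x = u \<or> x = v \<or> x = z \<or> x \<in> D) \<Longrightarrow> S = V"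
  using V_cases by (intro set_eqI) simp

text \<open>The triangles are \<open>u\<close>, \<open>v\<close>, \<open>w\<close> and
  \<open>D1\<close>, \<open>D2\<close>, \<open>z\<close>; the rungs join them in this order.\<close>

lemma prism_finish:
  assumes "conn E D" "\<not> ad z u" "\<not> ad z v"
    and nX: "\<not> adj X {u, v, w} (insert z D)" and zX: "adj X {z} D" and wu: "xd w u"
  shows "obstructed ((V, E), X)"
proof -
  obtain D1 D2 where D: "D1 \<union> D2 = D" "D1 \<inter> D2 = {}" "conn E D1" "conn E D2" "D1 \<noteq> {}" "D2 \<noteq> {}"
    "adj E {u} D1" "adj E {z} D1" "adj E {v} D2" "adj E {z} D2" "adj E D1 D2"
    using split_D[OF assms(1-3)] .
  have D12: "x \<in> D1 \<or> x \<in> D2 \<longleftrightarrow> x \<in> D" for x using D(1) by (metis Un_iff)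
  have n: "x \<notin> D1 \<and> x \<notin> D2" if "x = u \<or> x = v \<or> x = w \<or> x = z" for x
    using that D12[of x] Dd(6-8) w_ne(4) by blast
  have "prism_bags V E X {u} {v} {w} D1 D2 {z}"
    unfolding prism_bags_def
  proof (intro conjI)
    show "simple_graph (V, E)" "X \<subseteq> E" by (fact simple XE)+
    show "bags V E [{u}, {v}, {w}, D1, D2, {z}]"
    proof -
      have "{u} \<union> {v} \<union> {w} \<union> D1 \<union> D2 \<union> {z} = V" by (rule V_eqI) (use D12 in blast)
      then show ?thesis
        unfolding bags_6 using D(2-6) n[of u] n[of v] n[of w] n[of z] dist w_ne
        by (simp add: conn_singleton)
    qed
    show "adj E {u} {v}" "adj E {u} {w}" "adj E {v} {w}" "adj E {w} {z}"
      using uv w_ad by (simp_all add: adj_edge)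
    show "adj E D1 D2" "adj E {u} D1" "adj E {v} D2" by fact+
    show "adj E D1 {z}" "adj E D2 {z}" using D(8,10) by (simp_all add: adj_commute)
    have "{u} \<union> {v} \<union> {w} = {u, v, w}" "D1 \<union> D2 \<union> {z} = insert z D" using D(1) by auto
    then show "\<not> adj X ({u} \<union> {v} \<union> {w}) (D1 \<union> D2 \<union> {z})" using nX by simp
  qed
  moreover have "adj X {u} {w}" using wu edge_sym[of X w u] by (simp add: adj_edge)
  moreover have "adj X D1 {z} \<or> adj X D2 {z}"
    using zX unfolding D(1)[symmetric] adj_Un_right by (simp add: adj_commute)
  ultimately show ?thesis using obstructed_prism by blast
qed

text \<open>The component \<open>{z, w}\<close> is one distinguished edge of the K4, and
  \<open>A\<close>, \<open>B\<close> form the other; \<open>w\<close> reaches the two bags at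
  \<open>u\<close> and \<open>v\<close>.\<close>

lemma obstructed_K4_tip:
  assumes two: "two_comp X {z, w} C2"
    and AB: "A \<union> B = {u, v} \<union> D" "A \<inter> B = {}" "u \<in> A" "v \<in> B" "conn E A" "conn E B"
    and zA: "adj E {z} A" "adj E {z} B" and X: "adj X A B"
  shows "obstructed ((V, E), X)"
proof -
  have inAB: "x \<in> A \<or> x \<in> B \<longleftrightarrow> x = u \<or> x = v \<or> x \<in> D" for x using AB(1) by (metis Un_iff insert_iff singletonD)
  have n: "w \<notin> A" "w \<notin> B" "z \<notin> A" "z \<notin> B" using inAB[of w] inAB[of z] w_ne dist Dd(8) by blast+
  have "w \<in> {z, w}" by simp
  then obtain y where y: "y \<in> {z, w}" "xd w y" "y \<noteq> w" using xnbr[OF two] by metis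
  then have wz: "adj X {w} {z}" by (auto simp: adj_edge)
  have nX: "\<not> adj X {a} S" if "a \<in> {z, w}" "z \<notin> S" "w \<notin> S" for a S
    using no_cross_X[OF two, of "{a}" S] that two_comp_disj[OF two that(1)] by blast
  have "bags V E [{w}, {z}, A, B]"
  proof -
    have "{w} \<union> {z} \<union> A \<union> B = V" by (rule V_eqI) (use inAB in blast)
    moreover have "A \<noteq> {}" "B \<noteq> {}" using AB(3,4) by blast+
    ultimately show ?thesis unfolding bags_4 using AB(2,5,6) n w_ne(3) by (simp add: conn_singleton)
  qed
  moreover have "adj E {w} A" "adj E {w} B" using AB(3,4) w_ad unfolding adj_edge by blast+
  ultimately show ?thesis
    using obstructed_K4[OF simple XE _ wz X] zA nX n by simp
qed

lemma obstructed_apart: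
  assumes two: "two_comp X C1 C2" and z: "z \<in> C1" and w: "w \<in> C2" and wu: "xd w u"
  shows "obstructed ((V, E), X)"
proof -
  interpret sw: trivial_fragment V E X v u z w by (rule trivial_fragment_swap)
  have swD: "sw.D = D" unfolding D_def sw.D_def by (simp add: insert_commute)
  note two' = two_comp_sym[OF two]
  have dj: "x \<notin> C2" if "x \<in> C1" for x using two_comp_disj[OF two that] .
  have u: "u \<in> C2" using two_comp_edge[OF two wu] dj w by blast
  \<comment> \<open>Otherwise \<open>uv\<close> would join the two components, and contracting it
    would connect \<open>X\<close>.\<close>
  have v: "v \<notin> C1" using cross_not_F[OF two' u] Fuv by blast
  have Fvw: "F v w"
  proof (cases "v \<in> C2")
    case True
    then show ?thesis using F_same[OF two' True w u] dist w_ne by blast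
  next
    case False
    then show ?thesis using F_unc two_comp_cover[OF two] v by blast
  qed
  note cD = conn_D[OF Fvw]
  obtain y where y: "y \<in> C1" "xd z y" "y \<noteq> z" "ad z y" using xnbr[OF two z] by metis
  then have "y \<in> D" using V_cases[of y] ad_V(2)[OF y(4)] dj u v w by blast
  then have zD: "adj X {z} D" using y(2) by (auto simp: adj_edge)
  show ?thesis
  proof (cases "\<exists>x\<in>C2. x \<noteq> u \<and> x \<noteq> w")
    case False
    have C2: "x = u \<or> x = w" if "x \<in> C2" for x using False that by blast
    have "v \<notin> C2" using C2[of v] dist(1) w_ne(2) by metis
    then have vU: "v \<notin> \<Union>X" using two_comp_cover[OF two, of v] v by simp
    have zD2: "x \<notin> C2" if "x = z \<or> x \<in> D" for x using C2[of x] that Dd(6) w_ne dj z by blast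
    have nX: "\<not> adj X {a} S" if "a \<in> C2" "\<forall>x\<in>S. x \<notin> C2" for a S
      using no_cross_X[OF two', of "{a}" S] that two_comp_disj[OF two'] by blast
    show ?thesis
    \<comment> \<open>Here \<open>v\<close> is uncovered: adjacent to \<open>z\<close>, it is the
      hub of a wheel; otherwise \<open>D\<close> can be split for a prism.\<close>
    proof (cases "ad z v")
      case zv: True
      have nv: "\<not> adj X S {v}" for S
      proof
        assume "adj X S {v}"
        then have "v \<in> \<Union>X" by (auto simp: adj_def)
        then show False using vU by blast
      qed
      show ?thesis
      proof (rule obstructed_wheel[OF simple XE, of "{w}" "{u}" D "{z}" "{v}"])
        show "bags V E [{w}, {u}, D, {z}, {v}]"
        proof -
          have "{w} \<union> {u} \<union> D \<union> {z} \<union> {v} = V" by (rule V_eqI) blast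
          then show ?thesis
            unfolding bags_5 using cD(1) w_ne dist Dd(2,6-8) by (simp add: conn_singleton)
        qed
        show "adj X {w} {u}" "adj E {w} {z}" "adj E {w} {v}" "adj E {u} {v}" "adj E {z} {v}"
          using wu w_ad uv zv by (simp_all add: adj_edge)
        show "adj X D {z}" "adj E D {v}" using zD D_ad(2) by (simp_all add: adj_commute)
        show "adj E {u} D" by (rule D_ad)
        show "\<not> adj X {w} D" "\<not> adj X {w} {z}" "\<not> adj X {u} D" "\<not> adj X {u} {z}"
          using nX[OF w] nX[OF u] zD2 by simp_all
      qed (rule nv)+
    next
      case zv: False
      have "\<not> adj X {u, v, w} (insert z D)"
      proof
        assume "adj X {u, v, w} (insert z D)"
        then obtain a b where ab: "a \<in> {u, v, w}" "b \<in> insert z D" "xd a b" unfolding adj_edge by blast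
        then have "a \<in> C2" using two_comp_edge[OF two ab(3)] v w u vU in_Union_edge[of X a, OF card_X] by blast
        then show False using two_comp_edge[OF two ab(3)] dj zD2[of b] ab(2) by blast
      qed
      then show ?thesis using prism_finish[OF cD(1,3) zv _ zD wu] by blast
    qed
  next
    case True
    then obtain x where x: "x \<in> C2" "x \<noteq> u" "x \<noteq> w" by blast
    have Fuw: "F u w" using F_same[OF two' u w x] .
    have zv: "\<not> ad z v" using sw.conn_D(3)[OF Fuw] .
    obtain t where t: "t \<in> D" "\<And>q. ad u q \<Longrightarrow> q = v \<or> q = w \<or> q = t" "\<not> F u t"
      using triangle_third[OF Fvw Fuw] by blast
    obtain s where s: "s \<in> D" "\<And>q. ad v q \<Longrightarrow> q = u \<or> q = w \<or> q = s" "\<not> F v s"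
      using sw.triangle_third[OF Fuw Fvw] unfolding swD by blast
    \<comment> \<open>An edge of \<open>X\<close> leaving the triangle within \<open>C2\<close>
      could only be \<open>ut\<close> or \<open>vs\<close>. With \<open>w\<close> as a third vertex
      of \<open>C2\<close> it would lie in \<open>F\<close>, against the choice of \<open>t\<close>
      and \<open>s\<close>.\<close>
    have C2: "y \<in> {u, v, w}" if y: "y \<in> C2" for y
    proof (rule ccontr)
      assume yn: "y \<notin> {u, v, w}"
      have "w \<in> {u, v, w}" by simp
      then obtain a b where ab: "a \<in> C2" "a \<in> {u, v, w}" "b \<in> C2" "b \<notin> {u, v, w}" "{a, b} \<in> X"
        by (rule conn_cut[where \<phi> = "\<lambda>x. x \<in> {u, v, w}", OF two_comp_conn[OF two'] w _ y yn])
      then have abX: "xd a b" by (simp add: edge_def)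
      have "a \<noteq> w" using w_nbr[of b] xd_ad[OF abX] ab(3,4) dj z by blast
      then have "a = u \<and> b = t \<or> a = v \<and> b = s" using t(2)[of b] s(2)[of b] xd_ad[OF abX] ab(2,4) by blast
      moreover have "F a b" using F_same[OF two' ab(1,3) w] \<open>a \<noteq> w\<close> ab(4) by blast
      ultimately show False using t(3) s(3) by blast
    qed
    have "\<not> adj X {u, v, w} (insert z D)"
    proof
      assume "adj X {u, v, w} (insert z D)"
      then obtain a b where ab: "a \<in> {u, v, w}" "b \<in> insert z D" "xd a b" unfolding adj_edge by blast
      have "a \<notin> C1" using ab(1) v dj u w by blast
      moreover have "b \<notin> C2" using C2[of b] ab(2) Dd(6,7) w_ne dist by blast
      ultimately show False using two_comp_edge[OF two ab(3)] by blast
    qed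
    then show ?thesis using prism_finish[OF cD(1,3) zv _ zD wu] by blast
  qed
qed

lemma obstructed_one_covered:
  assumes two: "two_comp X {z, w} C2" and v: "v \<in> C2" and u: "u \<notin> C2"
  shows "obstructed ((V, E), X)"
proof -
  interpret sw: trivial_fragment V E X v u z w by (rule trivial_fragment_swap)
  have swD: "sw.D = D" unfolding D_def sw.D_def by (simp add: insert_commute)
  have uU: "u \<notin> \<Union>X" using two_comp_cover[OF two, of u] u w_ne dist by blast
  have Fuw: "F u w" using F_unc uU by blast
  note cD = sw.conn_D[OF Fuw, unfolded swD]
  have zwC2: "z \<notin> C2" "w \<notin> C2" using two_comp_disj[OF two] by blast+
  obtain y where y: "y \<in> C2" "xd v y" "y \<noteq> v" "ad v y" using xnbr[OF two_comp_sym[OF two] v] by metis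
  then have yD: "y \<in> D" using V_cases[of y] ad_V(2)[OF y(4)] u zwC2 by blast
  have "w \<in> {z, w}" by simp
  then obtain y' where y': "y' \<in> {z, w}" "xd w y'" "y' \<noteq> w" using xnbr[OF two] by metis
  then have wz: "adj X {w} {z}" by (auto simp: adj_edge)
  have nX: "\<not> adj X {w} S" "\<not> adj X {z} S" if "z \<notin> S" "w \<notin> S" for S
    using no_cross_X[OF two, of "{w}" S] no_cross_X[OF two, of "{z}" S] that zwC2 by blast+
  have zwD: "z \<notin> D" "w \<notin> D" using Dd(8) w_ne by blast+
  show ?thesis
  proof (cases "ad z u")
    case True
    have nu: "\<not> adj X S {u}" for S
    proof
      assume "adj X S {u}"
      then have "u \<in> \<Union>X" by (auto simp: adj_def)
      then show False using uU by blast
    qed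
    show ?thesis
    proof (rule obstructed_wheel[OF simple XE, of "{w}" "{z}" D "{v}" "{u}"])
      show "bags V E [{w}, {z}, D, {v}, {u}]"
      proof -
        have "{w} \<union> {z} \<union> D \<union> {v} \<union> {u} = V" by (rule V_eqI) blast
        then show ?thesis
          unfolding bags_5 using cD(1) w_ne dist Dd(2,6-8) by (simp add: conn_singleton)
      qed
      show "adj X {w} {z}" by (rule wz)
      have "adj X {v} D" using y(2) yD unfolding adj_edge by blast
      then show "adj X D {v}" "adj E D {u}" using D_ad(1) by (simp_all add: adj_commute)
      show "adj E {z} D" by (rule D_ad)
      show "adj E {w} {v}" "adj E {w} {u}" "adj E {z} {u}" "adj E {v} {u}"
        using w_ad ad_sym[OF uv] True by (simp_all add: adj_edge)
      show "\<not> adj X {w} D" "\<not> adj X {w} {v}" "\<not> adj X {z} D" "\<not> adj X {z} {v}"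
        using nX[of D] nX[of "{v}"] zwD w_ne dist by simp_all
    qed (rule nu)+
  next
    case False
    obtain D1 D2 where D: "D1 \<union> D2 = D" "D1 \<inter> D2 = {}" "conn E D1" "conn E D2" "D1 \<noteq> {}" "D2 \<noteq> {}"
      "adj E {u} D1" "adj E {z} D1" "adj E {v} D2" "adj E {z} D2" "adj E D1 D2"
      using split_D[OF cD(1) False cD(3)] .
    have D12: "x \<in> D1 \<or> x \<in> D2 \<longleftrightarrow> x \<in> D" for x using D(1) by (metis Un_iff)
    have n: "x \<notin> D1 \<and> x \<notin> D2" if "x = u \<or> x = v \<or> x = w \<or> x = z" for x
      using that D12[of x] Dd(6-8) w_ne(4) by blast
    have cA: "conn E ({u} \<union> D1)" "conn E ({v} \<union> D2)"
      using conn_Un[OF conn_singleton D(3,7)] conn_Un[OF conn_singleton D(4,9)] .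
    show ?thesis
    proof (cases "adj X ({u} \<union> D1) ({v} \<union> D2)")
      case True
      show ?thesis
      proof (rule obstructed_K4_tip[OF two _ _ _ _ cA _ _ True])
        show "{u} \<union> D1 \<union> ({v} \<union> D2) = {u, v} \<union> D" using D(1) by auto
        show "({u} \<union> D1) \<inter> ({v} \<union> D2) = {}" using D(2) n dist by auto
      qed (use D(8,10) in \<open>simp_all add: adj_Un_right del: Un_insert_left\<close>)
    next
      \<comment> \<open>Now no edge of \<open>X\<close> leaves the bag
        \<open>{u} \<union> D1\<close>, which becomes the hub, and the partner \<open>y\<close> of
        \<open>v\<close> must lie in \<open>D2\<close>.\<close>
      case in_separator: False
      have nX': "\<not> adj X D2 ({u} \<union> D1)" "\<not> adj X {v} ({u} \<union> D1)"
        using in_separator by (simp_all add: adj_Un_right adj_commute del: Un_insert_left)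
      show ?thesis
      proof (rule obstructed_wheel[OF simple XE, of "{w}" "{z}" D2 "{v}" "{u} \<union> D1"])
        show "bags V E [{w}, {z}, D2, {v}, {u} \<union> D1]"
        proof -
          have "{w} \<union> {z} \<union> D2 \<union> {v} \<union> ({u} \<union> D1) = V" by (rule V_eqI) (use D12 in blast)
          moreover have "D2 \<inter> ({u} \<union> D1) = {}" using D(2) n[of u] by blast
          ultimately show ?thesis
            unfolding bags_5 using cA(1) D(4,6) n[of u] n[of v] n[of w] n[of z] w_ne dist
            by (simp add: conn_singleton del: Un_insert_left)
        qed
        have "y \<notin> D1" using nX'(2) y(2) unfolding adj_edge by blast
        then have "y \<in> D2" using yD unfolding D(1)[symmetric] by simp
        then have "adj X {v} D2" using y(2) unfolding adj_edge by blast
        then show "adj X D2 {v}" by (simp add: adj_commute)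
        show "adj X {w} {z}" by (rule wz)
        show "adj E {z} D2" by (rule D)
        show "adj E {w} {v}" using w_ad by (simp add: adj_edge)
        have "adj E {w} {u}" "adj E {v} {u}" using w_ad ad_sym[OF uv] by (simp_all add: adj_edge)
        then show "adj E {w} ({u} \<union> D1)" "adj E {z} ({u} \<union> D1)" "adj E D2 ({u} \<union> D1)" "adj E {v} ({u} \<union> D1)"
          using D(8,11) by (simp_all add: adj_Un_right adj_commute del: Un_insert_left)
        show "\<not> adj X {w} D2" "\<not> adj X {w} {v}" "\<not> adj X {z} D2" "\<not> adj X {z} {v}"
          "\<not> adj X {w} ({u} \<union> D1)" "\<not> adj X {z} ({u} \<union> D1)"
          using nX[of D2] nX[of "{v}"] nX[of "{u} \<union> D1"] n[of z] n[of w] w_ne dist by simp_all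
      qed (rule nX')+
    qed
  qed
qed

text \<open>\<open>P\<close> is a fragment for \<open>u\<close>, \<open>v\<close>, \<open>z\<close>,
  so a part of it not joined to \<open>u\<close> would be cut off by \<open>v\<close> and
  \<open>z\<close>, and symmetrically for \<open>v\<close>. Taking \<open>Q\<close> empty covers all
  of \<open>D\<close>.\<close>

lemma conn_half:
  assumes PQ: "P \<union> Q = D" "\<not> adj E P Q" "P \<noteq> {}"
  shows "conn E ({u} \<union> P)" "conn E ({v} \<union> P)" "adj E {z} P"
proof -
  have inD: "x \<in> P \<or> x \<in> Q \<longleftrightarrow> x \<in> D" for x using PQ(1) by (metis Un_iff)
  have PD: "P \<subseteq> D" using inD by blast
  have cl: "q \<in> P \<or> q = u \<or> q = v \<or> q = z" if "p \<in> P" "ad p q" for p q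
    using Dd(9)[of p q] inD that PQ(2) unfolding adj_edge by blast
  have f: "fragment u v z P"
    unfolding fragment_def using PQ(3) PD Dd(1,3-8) cl w_V w_ne by blast
  then show "adj E {z} P" using frag_nbr(3) unfolding adj_edge by blast
  have c: "conn E ({a} \<union> P)" if ab: "{a, b} = {u, v}" "a \<noteq> b" for a b
  proof (rule connI_pointed[of a])
    fix R S assume RS: "R \<union> S = {a} \<union> P" "R \<inter> S = {}" "a \<in> R" "S \<noteq> {}"
    show "adj E R S"
    proof (rule ccontr)
      assume n: "\<not> adj E R S"
      have ab': "a = u \<and> b = v \<or> a = v \<and> b = u" using ab(1) by (auto simp: doubleton_eq_iff)
      have inP: "x \<in> R \<or> x \<in> S \<longleftrightarrow> x = a \<or> x \<in> P" for x using RS(1) by (metis Un_iff singleton_iff)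
      obtain x where x: "x \<in> S" using RS(4) by blast
      have SP: "S \<subseteq> P" using inP RS(2,3) by blast
      have "\<forall>p\<in>S. \<forall>q. ad p q \<longrightarrow> q \<in> S \<or> q = b \<or> q = z"
      proof (intro ballI allI impI)
        fix p q assume pq: "p \<in> S" "ad p q"
        have "q \<notin> R" using n pq ad_sym[OF pq(2)] unfolding adj_edge by blast
        moreover have "q \<in> P \<or> q = a \<or> q = b \<or> q = z" using cl[of p q] pq SP ab' by blast
        ultimately show "q \<in> S \<or> q = b \<or> q = z" using inP[of q] RS(3) by blast
      qed
      then show False using two_sep[of S x b z w] x SP PD Dd(1) w_V w_ne ab' by blast
    qed
  qed simp
  show "conn E ({u} \<union> P)" "conn E ({v} \<union> P)" using c[of u v] c[of v u] dist by (simp_all add: insert_commute)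
qed

lemma obstructed_u_adj:
  assumes two: "two_comp X {z, w} C2" and uv: "u \<in> C2" and zu: "ad z u"
  shows "obstructed ((V, E), X)"
proof (rule obstructed_K4_tip[OF two, of "{u}" "{v} \<union> D"])
  show "{u} \<union> ({v} \<union> D) = {u, v} \<union> D" by auto
  show "{u} \<inter> ({v} \<union> D) = {}" using dist Dd(6) by simp
  show "conn E {u}" by (rule conn_singleton)
  have "\<not> adj E D {}" by (simp add: adj_def)
  then show "conn E ({v} \<union> D)" using conn_half(2)[of D "{}"] Dd(2) by simp
  show "adj E {z} {u}" using zu by (simp add: adj_edge)
  show "adj E {z} ({v} \<union> D)" using D_ad(3) by (simp add: adj_Un_right del: Un_insert_left)
  obtain y where y: "y \<in> C2" "xd u y" "y \<noteq> u" "ad u y" using xnbr[OF two_comp_sym[OF two] uv] by metis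
  have "z \<notin> C2" "w \<notin> C2" using two_comp_disj[OF two] by blast+
  then have "y \<in> {v} \<union> D" using V_cases[of y] ad_V(2)[OF y(4)] y(1,3) by blast
  then show "adj X {u} ({v} \<union> D)" using y(2) unfolding adj_edge by blast
qed simp_all

lemma obstructed_both_covered:
  assumes two: "two_comp X {z, w} C2" and u: "u \<in> C2" and v: "v \<in> C2"
  shows "obstructed ((V, E), X)"
proof -
  interpret sw: trivial_fragment V E X v u z w by (rule trivial_fragment_swap)
  have zwC2: "z \<notin> C2" "w \<notin> C2" using two_comp_disj[OF two] by blast+
  have inC2: "x = u \<or> x = v \<or> x \<in> D" if "x \<in> C2" for x
  proof -
    have "x \<in> V" using xnbr[OF two_comp_sym[OF two] that] ad_V(1) by metis
    then show ?thesis using V_cases[of x] zwC2 that by blast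
  qed
  have nuv: "u \<notin> D" "v \<notin> D" using Dd by blast+
  consider "ad z u" | "ad z v" | "\<not> ad z u" "\<not> ad z v" "conn E D" | "\<not> conn E D" by blast
  then show ?thesis
  proof cases
    case 1 then show ?thesis by (rule obstructed_u_adj[OF two u])
  next
    case 2 then show ?thesis by (rule sw.obstructed_u_adj[OF two v])
  next
    case 3
    obtain D1 D2 where D: "D1 \<union> D2 = D" "D1 \<inter> D2 = {}" "conn E D1" "conn E D2" "D1 \<noteq> {}" "D2 \<noteq> {}"
      "adj E {u} D1" "adj E {z} D1" "adj E {v} D2" "adj E {z} D2" "adj E D1 D2"
      using split_D[OF 3(3,1,2)] .
    have inD: "x \<in> D1 \<or> x \<in> D2 \<longleftrightarrow> x \<in> D" for x using D(1) by (metis Un_iff)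
    show ?thesis
    proof (rule obstructed_K4_tip[OF two, of "{u} \<union> D1" "{v} \<union> D2"])
      show "{u} \<union> D1 \<union> ({v} \<union> D2) = {u, v} \<union> D" using D(1) by auto
      show "({u} \<union> D1) \<inter> ({v} \<union> D2) = {}" using D(2) inD nuv dist by blast
      show "conn E ({u} \<union> D1)" "conn E ({v} \<union> D2)"
        using conn_Un[OF conn_singleton D(3,7)] conn_Un[OF conn_singleton D(4,9)] .
      show "adj E {z} ({u} \<union> D1)" "adj E {z} ({v} \<union> D2)"
        using D(8,10) by (simp_all add: adj_Un_right del: Un_insert_left)
      have uA: "u \<in> {u} \<union> D1" and vA: "v \<notin> {u} \<union> D1" using dist inD nuv by blast+
      \<comment> \<open>\<open>C2\<close> is connected and contains \<open>u\<close> and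
        \<open>v\<close>, so an edge of \<open>X\<close> leaves the bag of \<open>u\<close>; as
        \<open>C2\<close> misses \<open>z\<close> and \<open>w\<close>, it ends in the bag of
        \<open>v\<close>.\<close>
      obtain a b where ab: "a \<in> {u} \<union> D1" "b \<in> C2" "b \<notin> {u} \<union> D1" "{a, b} \<in> X"
        by (rule conn_cut[where \<phi> = "\<lambda>x. x \<in> {u} \<union> D1",
              OF two_comp_conn[OF two_comp_sym[OF two]] u uA v vA])
      then have "b \<in> {v} \<union> D2" using inC2[of b] inD[of b] by blast
      then show "adj X ({u} \<union> D1) ({v} \<union> D2)" using ab(1,4) by (intro adjI)
    qed simp_all
  next
    case 4
    then obtain P Q where PQ: "P \<union> Q = D" "P \<inter> Q = {}" "P \<noteq> {}" "Q \<noteq> {}" "\<not> adj E P Q"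
      using connI[of D E] by blast
    have QP: "Q \<union> P = D" "Q \<inter> P = {}" "\<not> adj E Q P"
      using PQ adj_commute[of E P Q] by (simp_all add: Un_commute Int_commute)
    obtain y where y: "y \<in> C2" "xd u y" "y \<noteq> u" "ad u y" using xnbr[OF two_comp_sym[OF two] u] by metis
    have inD: "x \<in> P \<or> x \<in> Q \<longleftrightarrow> x \<in> D" for x using PQ(1) by (metis Un_iff)
    \<comment> \<open>The part containing the partner \<open>y\<close> of \<open>u\<close> goes to
      the bag of \<open>v\<close>, so that the edge \<open>uy\<close> of \<open>X\<close> runs
      between the bags.\<close>
    have *: ?thesis
      if S: "S \<union> T = D" "S \<inter> T = {}" "S \<noteq> {}" "T \<noteq> {}" "\<not> adj E S T" "\<not> adj E T S" "y = v \<or> y \<in> S" for S T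
    proof -
      have inST: "x \<in> S \<or> x \<in> T \<longleftrightarrow> x \<in> D" for x using S(1) by (metis Un_iff)
      have TS: "T \<union> S = D" using S(1) by (simp add: Un_commute)
      show ?thesis
      proof (rule obstructed_K4_tip[OF two, of "{u} \<union> T" "{v} \<union> S"])
        show "{u} \<union> T \<union> ({v} \<union> S) = {u, v} \<union> D" using S(1) by auto
        show "({u} \<union> T) \<inter> ({v} \<union> S) = {}" using S(2) inST nuv dist by blast
        show "conn E ({u} \<union> T)" "conn E ({v} \<union> S)"
          using conn_half(1)[OF TS S(6,4)] conn_half(2)[OF S(1,5,3)] .
        show "adj E {z} ({u} \<union> T)" "adj E {z} ({v} \<union> S)"
          using conn_half(3)[OF TS S(6,4)] conn_half(3)[OF S(1,5,3)]
          by (simp_all add: adj_Un_right del: Un_insert_left)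
        show "adj X ({u} \<union> T) ({v} \<union> S)" using y(2) S(7) unfolding adj_edge by blast
      qed simp_all
    qed
    have "y = v \<or> y \<in> P \<or> y \<in> Q" using inC2[OF y(1)] inD y(3) by blast
    then show ?thesis using *[OF PQ(1-5) QP(3)] *[OF QP(1,2) PQ(4,3) QP(3) PQ(5)] by blast
  qed
qed

lemma obstructed_trivial: "obstructed ((V, E), X)"
proof -
  interpret sw: trivial_fragment V E X v u z w by (rule trivial_fragment_swap)
  have "\<not> F z w" using w_nbr_not_F[of w] w_ad(6) by blast
  then obtain C1 C2 where two: "two_comp X C1 C2" and z: "z \<in> C1" and w: "w \<in> C2 \<or> C1 = {z, w}"
    using not_F by blast
  show ?thesis
  proof (cases "w \<in> C2")
    case True
    obtain y where y: "y \<in> C2" "xd w y" "ad w y" using xnbr[OF two_comp_sym[OF two] True] by metis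
    have "y \<noteq> z" using y(1) two_comp_disj[OF two z] by blast
    then have "y = u \<or> y = v" using w_nbr[OF y(3)] by blast
    then show ?thesis
      using obstructed_apart[OF two z True] sw.obstructed_apart[OF two z True] y(2) by blast
  next
    case False
    then have two': "two_comp X {z, w} C2" using w two by simp
    \<comment> \<open>If both were uncovered, \<open>triangle_third\<close> would provide an edge at
      \<open>u\<close> outside \<open>F\<close>, but every edge at an uncovered vertex is in
      \<open>F\<close>.\<close>
    have "u \<in> C2 \<or> v \<in> C2"
    proof (rule ccontr)
      assume n: "\<not> ?thesis"
      have U: "u \<notin> \<Union>X" "v \<notin> \<Union>X"
        using two_comp_cover[OF two', of u] two_comp_cover[OF two', of v] n w_ne dist by blast+
      then show False using triangle_third F_unc by blast
    qed
    then show ?thesis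
      using obstructed_both_covered[OF two'] obstructed_one_covered[OF two']
        sw.obstructed_one_covered[OF two'] by blast
  qed
qed

end

section \<open>Reduction to critical constraint graphs\<close>

lemma (in minimal_fragment) obstructed_minimal_fragment: "obstructed ((V, E), X)"
proof (cases "\<exists>w. C = {w}")
  case True
  then obtain w where "C = {w}" by blast
  then have "trivial_fragment V E X u v z w" using minimal_fragment_axioms by (simp add: trivial_fragment_def)
  then show ?thesis by (rule trivial_fragment.obstructed_trivial)
next
  case False
  then show ?thesis by (intro obstructed_nontrivial) blast
qed

lemma (in contraction_critical) obstructed_critical: "obstructed ((V, E), X)"
proof -
  define S where "S = {n. \<exists>u v z C. ad u v \<and> F u v \<and> fragment u v z C \<and> card C = n}"
  obtain u0 v0 where "ad u0 v0" "F u0 v0" using ex_F by blast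
  then have "\<exists>n. n \<in> S" using critical unfolding S_def in_separator_def by blast
  then have "(LEAST n. n \<in> S) \<in> S" by (rule LeastI_ex)
  then obtain u v z C where *: "ad u v" "F u v" "fragment u v z C" "card C = (LEAST n. n \<in> S)"
    unfolding S_def by blast
  have "minimal_fragment V E X u v z C"
  proof
    fix u' v' z' C' assume "ad u' v'" "F u' v'" "fragment u' v' z' C'"
    then have "card C' \<in> S" unfolding S_def by blast
    then show "card C \<le> card C'" using Least_le[of "\<lambda>n. n \<in> S"] *(4) by simp
  qed (use * in blast)+
  then show ?thesis by (rule minimal_fragment.obstructed_minimal_fragment)
qed

text \<open>The two parts of \<open>X\<close> use up two vertices each, and 3-connectivity on four
  vertices forces a complete graph.\<close>

lemma (in three_connected) obstructed_4:
  assumes "card V = 4" "X \<subseteq> E" "disconnected X"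
  shows "obstructed ((V, E), X)"
proof -
  have cX: "card e = 2" if "e \<in> X" for e using that assms(2) card_edge by blast
  note UX = in_Union_edge[of X, OF cX]
  obtain P Q where PQ: "P \<union> Q = \<Union>X" "P \<inter> Q = {}" "P \<noteq> {}" "Q \<noteq> {}" "\<not> adj X P Q"
    using assms(3) connI[of "\<Union>X" X] unfolding disconnected_def by blast
  have inX: "x \<in> P \<or> x \<in> Q \<longleftrightarrow> x \<in> \<Union>X" for x using PQ(1) by (metis Un_iff)
  have P: "b \<in> S" if "edge X a b" "a \<in> S" "S = P \<or> S = Q" for a b S
  proof -
    have "b \<in> P \<or> b \<in> Q" using inX UX[of b] edge_sym[of X a b] that(1) by blast
    then show ?thesis using that PQ(5) edge_sym[of X a b] unfolding adj_edge by blast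
  qed
  obtain a where "a \<in> P" using PQ(3) by blast
  then obtain b where ab: "a \<in> P" "edge X a b" "b \<in> P" using inX UX[of a] P by blast
  obtain c where "c \<in> Q" using PQ(4) by blast
  then obtain d where cd: "c \<in> Q" "edge X c d" "d \<in> Q" using inX UX[of c] P by blast
  have ad: "ad a b" "ad c d" using ab(2) cd(2) assms(2) by (auto simp: edge_def)
  then have inV: "a \<in> V" "b \<in> V" "c \<in> V" "d \<in> V" and ne: "a \<noteq> b" "c \<noteq> d" using ad_V by blast+
  have ne': "a \<noteq> c" "a \<noteq> d" "b \<noteq> c" "b \<noteq> d" using ab(1,3) cd(1,3) PQ(2) by blast+
  have "card {a, b, c, d} = 4" using ne ne' by simp
  then have Veq: "{a, b, c, d} = V"
    using card_subset_eq[OF finite_V, of "{a, b, c, d}"] inV assms(1) by simp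
  have adj: "adj E {x} {y}" if "x \<in> V" "y \<in> V" "x \<noteq> y" for x y
  proof (rule ccontr)
    assume "\<not> adj E {x} {y}"
    then have n: "\<not> ad x y" by (simp add: adj_edge)
    have "\<not> V \<subseteq> {x, y}"
    proof
      assume "V \<subseteq> {x, y}"
      then have "card V \<le> card {x, y}" by (intro card_mono) auto
      also have "\<dots> \<le> 2" by (simp add: card_insert_if)
      finally show False using assms(1) by simp
    qed
    then obtain p where p: "p \<in> V" "p \<noteq> x" "p \<noteq> y" by blast
    have "\<not> V \<subseteq> {x, y, p}" using card_3_less[of x y p] card_mono[of "{x, y, p}" V] by auto
    then obtain q where q: "q \<in> V" "q \<noteq> x" "q \<noteq> y" "q \<noteq> p" by blast
    have "card {x, y, p, q} = 4" using p q that(3) by auto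
    then have V: "{x, y, p, q} = V"
      using card_subset_eq[OF finite_V, of "{x, y, p, q}"] that(1,2) p(1) q(1) assms(1) by simp
    have "\<forall>p'\<in>{x}. \<forall>q'. ad p' q' \<longrightarrow> q' \<in> {x} \<or> q' = p \<or> q' = q"
      using n ad_V(2) V by blast
    then show False using two_sep[of "{x}" x p q y] that p q by blast
  qed
  have nX: "\<not> adj X {x} {y}" if "x \<in> P" "y \<in> Q" for x y
    using PQ(5) that unfolding adj_edge by blast
  show ?thesis
  proof (rule obstructed_K4[OF simple assms(2), of "{a}" "{b}" "{c}" "{d}"])
    show "bags V E [{a}, {b}, {c}, {d}]"
    proof -
      have "{a} \<union> {b} \<union> {c} \<union> {d} = V" unfolding Veq[symmetric] by blast
      then show ?thesis unfolding bags_4 using ne ne' by (simp add: conn_singleton)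
    qed
    show "adj X {a} {b}" "adj X {c} {d}" using ab(2) cd(2) by (simp_all add: adj_edge)
  qed (use adj inV ne' nX ab cd in auto)
qed

lemma obstructed_of_disc:
  assumes "three_connected V E" "X \<subseteq> E" "disconnected X"
  shows "obstructed ((V, E), X)"
  using assms
proof (induct "card V" arbitrary: V E X rule: less_induct)
  case less
  interpret three_connected V E by (rule less.prems(1))
  show ?case
  proof (cases "card V = 4")
    case True then show ?thesis using obstructed_4 less.prems by blast
  next
    case False
    then have V5: "5 \<le> card V" using card_V by simp
    show ?thesis
    proof (cases "\<exists>u v. ad u v \<and> keeps_disconnected X u v \<and> \<not> in_separator u v")
      case True
      \<comment> \<open>Adjacency and \<open>in_separator\<close> are symmetric, so the ends can be
        named such that merging \<open>v\<close> into \<open>u\<close> keeps \<open>X\<close>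
        disconnected.\<close>
      then obtain u v where uv: "ad u v" "disconnected (contract_edges u v X)" "\<not> in_separator u v"
        using in_separator_sym ad_sym unfolding keeps_disconnected_def by metis
      have uvV: "u \<in> V" "v \<in> V" "u \<noteq> v" using ad_V uv(1) by blast+
      have "card (V - {v}) < card V" using finite_V uvV(2) by (rule card_Diff1_less)
      moreover have "three_connected (V - {v}) (contract_edges u v E)" by (rule contract_three_connected[OF uv(1) V5 uv(3)])
      moreover have "contract_edges u v X \<subseteq> contract_edges u v E"
        using less.prems(2) by (auto simp: contract_edges_def)
      ultimately have "obstructed ((V - {v}, contract_edges u v E), contract_edges u v X)"
        using less.hyps uv(2) by blast
      moreover have "minor_step ((V, E), X) ((V - {v}, contract_edges u v E), contract_edges u v X)"
        using minor_step.contract[of u v "(V, E)" X] uv(1) merge_image[OF uvV]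
        by (simp add: edge_def contract_def)
      ultimately show ?thesis using obstructed_step by blast
    next
      case False
      then have "contraction_critical V E X" using less.prems V5 by unfold_locales blast+
      then show ?thesis by (rule contraction_critical.obstructed_critical)
    qed
  qed
qed

theorem theorem2p1:
  fixes G :: "'a graph" and X :: "'a set set"
  assumes "simple_graph G" and "k_connected 3 G" and "X \<subseteq> edges G"
  shows "constraint_connected (G, X) \<longleftrightarrow>
    \<not> (\<exists>H. constraint_minor H (G, X) \<and> (\<exists>K \<in> obstructions. cgraph_iso H K))"
proof -
  obtain V E where G: "G = (V, E)" by (cases G)
  have three_connected: "three_connected V E" using assms unfolding G by (intro three_connected_of_k_connected)
  have "card e = 2" if "e \<in> X" for e using assms that by (auto simp: simple_graph_def)
  then have "constraint_connected (G, X) \<longleftrightarrow> \<not> disconnected X"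
    by (simp add: constraint_connected_def disconnected_def connected_edge_set_iff_conn)
  also have "\<dots> \<longleftrightarrow> \<not> obstructed (G, X)"
    using conn_not_obstructed[of X G] obstructed_of_disc[OF three_connected, of X] assms(3)
    unfolding G disconnected_def by auto
  finally show ?thesis by (simp add: obstructed_def)
qed

end
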